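(* For every finite simple undirected graph $G$ (not necessarily connected), the graph $R_{W_4}(G)$, regarded as a partitioned graph all of whose vertices are bound, is pre-Lorentzian.
   Context: All graphs are finite, simple and undirected. The operator $R_{W_4}$. The graph $W_4$ has vertices $p_1,p_2,p_3,p_4,q_1,q_2,q_3,q_4$ and edges $p_1p_2,\ p_2p_3,\ p_3p_4$ and $p_jq_j$ for $j=1,2,3,4$. Its endpoints are $p_1$ and $p_4$. $R_{W_4}(G)$ is obtained from $G$ by deleting each edge $\{u,v\}$ and adding a new disjoint copy of $W_4$ whose endpoints $p_1,p_4$ are identified with $u$ and $v$ respectively (the other six vertices of the copy are new). Coloured and partitioned graphs. A coloured graph is a pair $(G,i)$ with $G$ a graph and $i$ a map from $V(G)$ to a set of colours (not required to be a proper colouring). A vertex, and its colour, is free if no other vertex has the same colour. A partitioned graph is a coloured graph with a distinguished colour, the bound colour, such that every colour other than the bound colour is free; vertices of the bound colour are called bound. Coloured independence polynomial. For a coloured graph $\mathcal{G}=(G,i)$, $\mathrm{C}(\mathcal{G})=\sum_{S}\prod_{v\in S}x_{i(v)}$, the sum being over all independent sets $S\subseteq V(G)$ (sets containing no two adjacent vertices). Homogenisation. For a polynomial $p$ in $x_1,\dots,x_n$, $\mathrm{H}(p)$ is the homogeneous polynomial in $x_1,\dots,x_n,y$ of minimal degree with $\mathrm{H}(p)|_{y=1}=p$; $y$ is the homogenising variable. Lorentzian polynomials. A finite set $A\subset\mathbb{Z}^n$ is M-convex if for all $\alpha,\beta\in A$ and every index $i$ with $\alpha_i>\beta_i$ there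 is an index $j$ with $\beta_j>\alpha_j$ and $\alpha-e_i+e_j\in A$, where $e_i$ is the $i$th standard basis vector. The support of $p=\sum_\alpha c_\alpha x^\alpha$ is $\{\alpha: c_\alpha\neq0\}$. A homogeneous real polynomial $p$ of degree $d$ with non-negative coefficients is Lorentzian if its support is M-convex and, for every partial derivative of $p$ of order $d-2$, the corresponding Hessian matrix has at most one positive eigenvalue. Pre-Lorentzian. A partitioned graph $\mathcal{G}$ is pre-Lorentzian if there exists $k\in\mathbb{N}$ such that $(xy)^k\cdot\mathrm{H}(\mathrm{C}(\mathcal{G}))$ is Lorentzian, where $x$ is the variable of the bound colour and $y$ is the homogenising variable. *)

theory Defs
  imports
    "HOL-Library.Poly_Mapping"
    "HOL-Computational_Algebra.Polynomial"
    "Jordan_Normal_Form.Char_Poly"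
    "Graph_Theory.Pair_Digraph"
begin

section \<open>Real polynomials in several variables\<close>

text \<open>Monomials are finitely supported exponent vectors, so \<open>'v rpoly\<close> is the polynomial
  ring over the reals in the variables \<^typ>\<open>'v\<close>, with the ring operations of
  \<^theory>\<open>HOL-Library.Poly_Mapping\<close>.\<close>

type_synonym 'v rpoly = "('v \<Rightarrow>\<^sub>0 nat) \<Rightarrow>\<^sub>0 real"

definition Var :: "'v \<Rightarrow> 'v rpoly" where
  "Var v = Poly_Mapping.single (Poly_Mapping.single v 1) 1"

definition poly_vars :: "'v rpoly \<Rightarrow> 'v set" where
  "poly_vars p = (\<Union>m\<in>Poly_Mapping.keys p. Poly_Mapping.keys m)"

definition total_degree :: "('v \<Rightarrow>\<^sub>0 nat) \<Rightarrow> nat" where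
  "total_degree m = (\<Sum>v\<in>Poly_Mapping.keys m. Poly_Mapping.lookup m v)"

text \<open>The zero polynomial is homogeneous of every degree.\<close>

definition homogeneous :: "nat \<Rightarrow> 'v rpoly \<Rightarrow> bool" where
  "homogeneous d p \<longleftrightarrow> (\<forall>m\<in>Poly_Mapping.keys p. total_degree m = d)"

definition poly_subst :: "('v \<Rightarrow> 'w rpoly) \<Rightarrow> 'v rpoly \<Rightarrow> 'w rpoly" where
  "poly_subst \<sigma> p =
     (\<Sum>m\<in>Poly_Mapping.keys p. Poly_Mapping.single 0 (Poly_Mapping.lookup p m) *
        (\<Prod>v\<in>Poly_Mapping.keys m. \<sigma> v ^ Poly_Mapping.lookup m v))"

text \<open>If \<open>v\<close> does not divide the monomial \<open>m\<close>, the truncated exponent below comes with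
  coefficient zero.\<close>

definition partial_deriv :: "'v \<Rightarrow> 'v rpoly \<Rightarrow> 'v rpoly" where
  "partial_deriv v p =
     (\<Sum>m\<in>Poly_Mapping.keys p. Poly_Mapping.single (m - Poly_Mapping.single v 1)
                     (real (Poly_Mapping.lookup m v) * Poly_Mapping.lookup p m))"

text \<open>Homogenisation of a polynomial in the variables \<open>'c\<close> adds one variable: \<^term>\<open>Some c\<close> is the
  old variable \<open>c\<close> and \<^term>\<open>None\<close> is the homogenising variable \<open>y\<close>.\<close>

definition dehomogenise :: "'c option rpoly \<Rightarrow> 'c rpoly" where
  "dehomogenise = poly_subst (case_option 1 Var)"

definition is_homogenisation :: "'c rpoly \<Rightarrow> 'c option rpoly \<Rightarrow> bool" where
  "is_homogenisation p h \<longleftrightarrow>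
     (\<exists>d. homogeneous d h \<and> dehomogenise h = p \<and>
          (\<forall>d' h'. homogeneous d' h' \<and> dehomogenise h' = p \<longrightarrow> d \<le> d'))"

definition homogenisation :: "'c rpoly \<Rightarrow> 'c option rpoly" where
  "homogenisation p = (THE h. is_homogenisation p h)"


section \<open>Lorentzian polynomials\<close>

text \<open>Exponent vectors live in \<open>'v \<Rightarrow> int\<close>. All vectors in a support vanish outside the variables of
  the polynomial, so the indices \<open>i\<close> and \<open>j\<close> below are automatically variables of it.\<close>

definition M_convex :: "('v \<Rightarrow> int) set \<Rightarrow> bool" where
  "M_convex A \<longleftrightarrow> finite A \<and>
     (\<forall>\<alpha>\<in>A. \<forall>\<beta>\<in>A. \<forall>i. \<alpha> i > \<beta> i \<longrightarrow>
        (\<exists>j. \<beta> j > \<alpha> j \<and> (\<lambda>v. \<alpha> v - of_bool (v = i) + of_bool (v = j)) \<in> A))"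

definition support :: "'v rpoly \<Rightarrow> ('v \<Rightarrow> int) set" where
  "support p = {\<alpha>. \<exists>m. Poly_Mapping.lookup p m \<noteq> 0 \<and> \<alpha> = (\<lambda>v. int (Poly_Mapping.lookup m v))}"

text \<open>The Hessian matrix, for a listing \<open>xs\<close> of the variables, of a quadratic form: the second
  derivatives are constants, given by their constant coefficient.\<close>

definition hessian :: "'v list \<Rightarrow> 'v rpoly \<Rightarrow> real mat" where
  "hessian xs q = mat (length xs) (length xs)
     (\<lambda>(i, j). Poly_Mapping.lookup (partial_deriv (xs ! i) (partial_deriv (xs ! j) q)) 0)"

text \<open>Eigenvalues are counted with multiplicity.\<close>

definition at_most_one_positive_eigenvalue :: "real mat \<Rightarrow> bool" where
  "at_most_one_positive_eigenvalue A \<longleftrightarrow> size (filter_mset (\<lambda>e. e > 0) (proots (char_poly A))) \<le> 1"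

text \<open>\<open>X\<close> is the finite set of variables. The partial derivatives of order \<open>d - 2\<close> are taken
  successively along the lists \<open>vs\<close> of variables; there are none if \<open>d < 2\<close>. Reordering the listing
  \<open>xs\<close> of \<open>X\<close> only conjugates the Hessian by a permutation matrix.\<close>

definition lorentzian :: "'v set \<Rightarrow> 'v rpoly \<Rightarrow> bool" where
  "lorentzian X p \<longleftrightarrow> finite X \<and> poly_vars p \<subseteq> X \<and>
     (\<exists>d. homogeneous d p \<and>
          (\<forall>m. Poly_Mapping.lookup p m \<ge> 0) \<and>
          M_convex (support p) \<and>
          (\<forall>vs. set vs \<subseteq> X \<and> length vs + 2 = d \<longrightarrow>
             (\<forall>xs. distinct xs \<and> set xs = X \<longrightarrow>
                at_most_one_positive_eigenvalue (hessian xs (foldr partial_deriv vs p)))))"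


section \<open>Coloured and partitioned graphs\<close>

text \<open>Finite simple undirected graphs are \<^locale>\<open>pair_graph\<close>s: the edge \<open>{u, v}\<close> is represented by
  the two arcs \<open>(u, v)\<close> and \<open>(v, u)\<close>. A coloured graph is a graph \<open>G\<close> with a map \<open>i\<close>, of which only
  the values on the vertices of \<open>G\<close> matter; a partitioned graph has in addition a bound colour \<open>b\<close>.\<close>

definition independent_sets :: "'a pair_pre_digraph \<Rightarrow> 'a set set" where
  "independent_sets G = {S. S \<subseteq> pverts G \<and> (\<forall>u\<in>S. \<forall>v\<in>S. (u, v) \<notin> parcs G)}"

definition coloured_indep_poly :: "'a pair_pre_digraph \<Rightarrow> ('a \<Rightarrow> 'c) \<Rightarrow> 'c rpoly" where
  "coloured_indep_poly G i = (\<Sum>S\<in>independent_sets G. \<Prod>v\<in>S. Var (i v))"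

definition free_vertex :: "'a pair_pre_digraph \<Rightarrow> ('a \<Rightarrow> 'c) \<Rightarrow> 'a \<Rightarrow> bool" where
  "free_vertex G i v \<longleftrightarrow> (\<forall>w\<in>pverts G. i w = i v \<longrightarrow> w = v)"

definition partitioned_graph :: "'a pair_pre_digraph \<Rightarrow> ('a \<Rightarrow> 'c) \<Rightarrow> 'c \<Rightarrow> bool" where
  "partitioned_graph G i b \<longleftrightarrow>
     pair_graph G \<and> (\<forall>v\<in>pverts G. i v \<noteq> b \<longrightarrow> free_vertex G i v)"

definition pre_lorentzian :: "'a pair_pre_digraph \<Rightarrow> ('a \<Rightarrow> 'c) \<Rightarrow> 'c \<Rightarrow> bool" where
  "pre_lorentzian G i b \<longleftrightarrow> partitioned_graph G i b \<and>
     (\<exists>k::nat. lorentzian (insert None (Some ` insert b (i ` pverts G)))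
        ((Var (Some b) * Var None) ^ k * homogenisation (coloured_indep_poly G i)))"


section \<open>Replacing edges by a rooted graph\<close>

text \<open>An orientation \<open>D\<close> names, for every edge \<open>{u, v}\<close>, one of its ends as \<open>u\<close>: it contains exactly
  one of the arcs \<open>(u, v)\<close> and \<open>(v, u)\<close>.\<close>

definition orientation :: "('a \<times> 'a) set \<Rightarrow> 'a pair_pre_digraph \<Rightarrow> bool" where
  "orientation D G \<longleftrightarrow>
     D \<subseteq> parcs G \<and> (\<forall>u v. (u, v) \<in> parcs G \<longrightarrow> ((u, v) \<in> D \<longleftrightarrow> (v, u) \<notin> D))"

text \<open>The vertex \<open>h\<close> of the copy of a graph with endpoints \<open>s\<close> and \<open>t\<close> that replaces the edge
  \<open>{u, v}\<close>: \<open>s\<close> and \<open>t\<close> are identified with \<open>u\<close> and \<open>v\<close>, the other vertices are new.\<close>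

definition copy_vertex :: "'h \<Rightarrow> 'h \<Rightarrow> 'a \<times> 'a \<Rightarrow> 'h \<Rightarrow> 'a + ('a \<times> 'a) \<times> 'h" where
  "copy_vertex s t e h =
     (if h = s then Inl (fst e) else if h = t then Inl (snd e) else Inr (e, h))"

definition edge_replacement ::
  "'h pair_pre_digraph \<Rightarrow> 'h \<Rightarrow> 'h \<Rightarrow> ('a \<times> 'a) set \<Rightarrow> 'a pair_pre_digraph \<Rightarrow>
   ('a + ('a \<times> 'a) \<times> 'h) pair_pre_digraph" where
  "edge_replacement H s t D G =
     \<lparr> pverts = Inl ` pverts G \<union> (\<Union>e\<in>D. copy_vertex s t e ` pverts H),
       parcs = (\<Union>e\<in>D. (\<lambda>(g, h). (copy_vertex s t e g, copy_vertex s t e h)) ` parcs H) \<rparr>"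

datatype W4_vertex = p_vertex nat | q_vertex nat

definition W4_edges :: "(W4_vertex \<times> W4_vertex) set" where
  "W4_edges =
     {(p_vertex 1, p_vertex 2), (p_vertex 2, p_vertex 3), (p_vertex 3, p_vertex 4)} \<union>
     {(p_vertex j, q_vertex j) |j. j \<in> {1..4}}"

definition W4 :: "W4_vertex pair_pre_digraph" where
  "W4 = \<lparr> pverts = p_vertex ` {1..4} \<union> q_vertex ` {1..4}, parcs = W4_edges \<union> W4_edges\<inverse> \<rparr>"

text \<open>Since \<^const>\<open>W4\<close> has an automorphism exchanging its endpoints, different orientations give
  isomorphic graphs.\<close>

definition R_W4 ::
  "('a \<times> 'a) set \<Rightarrow> 'a pair_pre_digraph \<Rightarrow> ('a + ('a \<times> 'a) \<times> W4_vertex) pair_pre_digraph" where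
  "R_W4 D G = edge_replacement W4 (p_vertex 1) (p_vertex 4) D G"


section \<open>Well-definedness\<close>

lemma prod_single_one:
  "finite A \<Longrightarrow> (\<Prod>a\<in>A. Poly_Mapping.single (f a) (1::real)) = Poly_Mapping.single (\<Sum>a\<in>A. (f a :: 'c \<Rightarrow>\<^sub>0 nat)) 1"
  by (induction A rule: finite_induct) (auto simp: mult_single)

lemma Var_power: "Var v ^ n = Poly_Mapping.single (Poly_Mapping.single v n) 1"
  by (induction n) (auto simp: Var_def mult_single simp flip: single_add)

lemma dehomogenise_monomial:
  fixes m :: "'c option \<Rightarrow>\<^sub>0 nat"
  shows "(\<Prod>v\<in>Poly_Mapping.keys m. case_option 1 Var v ^ Poly_Mapping.lookup m v) =
     Poly_Mapping.single (Poly_Mapping.map_key Some m) (1::real)"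
proof -
  have 1: "(case_option 1 Var v :: 'c rpoly) ^ Poly_Mapping.lookup m v =
     Poly_Mapping.single (case v of None \<Rightarrow> 0 | Some c \<Rightarrow> Poly_Mapping.single c (Poly_Mapping.lookup m v)) 1" for v
    by (cases v) (auto simp: Var_power)
  have 2: "(\<Sum>v\<in>Poly_Mapping.keys m. (case v of None \<Rightarrow> 0 | Some c \<Rightarrow> Poly_Mapping.single c (Poly_Mapping.lookup m v)))
     = Poly_Mapping.map_key Some m" (is "?L = _")
  proof (rule poly_mapping_eqI)
    fix c
    have "Poly_Mapping.lookup ?L c = (\<Sum>v\<in>Poly_Mapping.keys m. if v = Some c then Poly_Mapping.lookup m v else 0)"
      unfolding lookup_sum by (rule sum.cong) (auto split: option.splits simp: lookup_single)
    also have "\<dots> = Poly_Mapping.lookup m (Some c)"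
      by (simp add: in_keys_iff)
    finally show "Poly_Mapping.lookup ?L c = Poly_Mapping.lookup (Poly_Mapping.map_key Some m) c"
      by (simp add: map_key.rep_eq)
  qed
  show ?thesis unfolding 1 by (simp add: prod_single_one 2)
qed

lemma dehomogenise_altdef:
  "dehomogenise h = (\<Sum>m\<in>Poly_Mapping.keys h.
     Poly_Mapping.single (Poly_Mapping.map_key Some m) (Poly_Mapping.lookup h m))"
  by (simp add: dehomogenise_def poly_subst_def dehomogenise_monomial mult_single)

lemma total_degree_option:
  "total_degree m = Poly_Mapping.lookup m None + total_degree (Poly_Mapping.map_key Some m)"
proof -
  have "total_degree m = (\<Sum>v\<in>insert None (Some ` Poly_Mapping.keys (Poly_Mapping.map_key Some m)). Poly_Mapping.lookup m v)"
    unfolding total_degree_def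
  proof (rule sum.mono_neutral_left)
    show "Poly_Mapping.keys m \<subseteq> insert None (Some ` Poly_Mapping.keys (Poly_Mapping.map_key Some m))"
    proof
      fix v assume "v \<in> Poly_Mapping.keys m"
      then show "v \<in> insert None (Some ` Poly_Mapping.keys (Poly_Mapping.map_key Some m))"
        by (cases v) (auto simp: in_keys_iff map_key.rep_eq)
    qed
  qed (auto simp: in_keys_iff)
  also have "\<dots> = Poly_Mapping.lookup m None + total_degree (Poly_Mapping.map_key Some m)"
    unfolding total_degree_def
    by (subst sum.insert) (auto simp: sum.reindex map_key.rep_eq)
  finally show ?thesis .
qed

lemma lookup_dehomogenise:
  assumes "homogeneous d h"
  shows "Poly_Mapping.lookup (dehomogenise h) (Poly_Mapping.map_key Some m) =
     (if total_degree m = d then Poly_Mapping.lookup h m else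
       Poly_Mapping.lookup (dehomogenise h) (Poly_Mapping.map_key Some m))"
proof (cases "total_degree m = d")
  case True
  have eq: "m' = m" if "m' \<in> Poly_Mapping.keys h" "Poly_Mapping.map_key Some m' = Poly_Mapping.map_key Some m" for m'
  proof (rule poly_mapping_eqI)
    fix v
    have "total_degree m' = total_degree m" using assms that True by (simp add: homogeneous_def)
    then have "Poly_Mapping.lookup m' None = Poly_Mapping.lookup m None"
      using that(2) by (simp add: total_degree_option)
    moreover have "Poly_Mapping.lookup m' (Some c) = Poly_Mapping.lookup m (Some c)" for c
      using arg_cong[OF that(2), of "\<lambda>q. Poly_Mapping.lookup q c"] by (simp add: map_key.rep_eq)
    ultimately show "Poly_Mapping.lookup m' v = Poly_Mapping.lookup m v" by (cases v) auto
  qed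
  have "Poly_Mapping.lookup (dehomogenise h) (Poly_Mapping.map_key Some m) =
    (\<Sum>m'\<in>Poly_Mapping.keys h. if m' = m then Poly_Mapping.lookup h m' else 0)"
    unfolding dehomogenise_altdef lookup_sum
    by (rule sum.cong) (auto simp: lookup_single when_def dest: eq)
  also have "\<dots> = Poly_Mapping.lookup h m" by (simp add: in_keys_iff)
  finally show ?thesis using True by simp
qed auto

lemma dehomogenise_inj:
  assumes "homogeneous d h" "homogeneous d h'" "dehomogenise h = dehomogenise h'"
  shows "h = h'"
proof (rule poly_mapping_eqI)
  fix m
  show "Poly_Mapping.lookup h m = Poly_Mapping.lookup h' m"
  proof (cases "total_degree m = d")
    case True
    then show ?thesis
      using lookup_dehomogenise[OF assms(1), of m] lookup_dehomogenise[OF assms(2), of m] assms(3) by simp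
  next
    case False
    then show ?thesis using assms(1,2) unfolding homogeneous_def by (metis in_keys_iff)
  qed
qed

lemma ex_lift:
  fixes n :: "'c \<Rightarrow>\<^sub>0 nat"
  assumes "total_degree n \<le> d"
  shows "\<exists>m. total_degree m = d \<and> Poly_Mapping.map_key Some m = n"
proof -
  define f where "f = case_option (d - total_degree n) (Poly_Mapping.lookup n)"
  have "v \<in> insert None (Some ` Poly_Mapping.keys n)" if "f v \<noteq> 0" for v
    using that by (cases v) (auto simp: f_def in_keys_iff)
  then have "{v. f v \<noteq> 0} \<subseteq> insert None (Some ` Poly_Mapping.keys n)" by blast
  then have fin: "finite {v. f v \<noteq> 0}" by (rule finite_subset) auto
  define m where "m = Abs_poly_mapping f"
  have l: "Poly_Mapping.lookup m = f" unfolding m_def using fin by simp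
  have 1: "Poly_Mapping.map_key Some m = n"
    by (rule poly_mapping_eqI) (simp add: map_key.rep_eq l f_def)
  show ?thesis
    by (rule exI[of _ m]) (use 1 assms in \<open>simp add: total_degree_option l f_def\<close>)
qed

lemma ex1_homogenisation: "\<exists>!h. is_homogenisation p h"
proof -
  define P where "P d \<longleftrightarrow> (\<exists>h. homogeneous d h \<and> dehomogenise h = p)" for d
  define d where "d = Max (insert 0 (total_degree ` Poly_Mapping.keys p))"
  have le: "total_degree n \<le> d" if "n \<in> Poly_Mapping.keys p" for n
    unfolding d_def using that by (intro Max_ge) auto
  then have "\<forall>n\<in>Poly_Mapping.keys p. \<exists>m. total_degree m = d \<and> Poly_Mapping.map_key Some m = n"
    using ex_lift by blast
  then obtain L where L: "\<And>n. n \<in> Poly_Mapping.keys p \<Longrightarrow> total_degree (L n) = d"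
    "\<And>n. n \<in> Poly_Mapping.keys p \<Longrightarrow> Poly_Mapping.map_key Some (L n) = n" by metis
  have inj: "inj_on L (Poly_Mapping.keys p)" by (metis L(2) inj_onI)
  define h where "h = (\<Sum>n\<in>Poly_Mapping.keys p. Poly_Mapping.single (L n) (Poly_Mapping.lookup p n))"
  have lh: "Poly_Mapping.lookup h (L n) = Poly_Mapping.lookup p n" if "n \<in> Poly_Mapping.keys p" for n
  proof -
    have "Poly_Mapping.lookup h (L n) = (\<Sum>n'\<in>Poly_Mapping.keys p. if n' = n then Poly_Mapping.lookup p n' else 0)"
      unfolding h_def lookup_sum
      by (rule sum.cong) (use inj that in \<open>auto simp: lookup_single when_def inj_on_def\<close>)
    also have "\<dots> = Poly_Mapping.lookup p n" by (simp add: in_keys_iff)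
    finally show ?thesis .
  qed
  have "Poly_Mapping.keys h \<subseteq> L ` Poly_Mapping.keys p"
    unfolding h_def by (rule order.trans[OF keys_sum]) auto
  moreover have "L ` Poly_Mapping.keys p \<subseteq> Poly_Mapping.keys h"
    using lh by (auto simp: in_keys_iff)
  ultimately have kh: "Poly_Mapping.keys h = L ` Poly_Mapping.keys p" by auto
  have "dehomogenise h = (\<Sum>n\<in>Poly_Mapping.keys p. Poly_Mapping.single n (Poly_Mapping.lookup p n))"
    unfolding dehomogenise_altdef kh by (subst sum.reindex[OF inj]) (auto intro!: sum.cong simp: lh L)
  also have "\<dots> = p"
  proof (rule poly_mapping_eqI)
    fix k
    show "Poly_Mapping.lookup (\<Sum>n\<in>Poly_Mapping.keys p. Poly_Mapping.single n (Poly_Mapping.lookup p n)) k = Poly_Mapping.lookup p k"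
      by (simp add: lookup_sum lookup_single when_def in_keys_iff)
  qed
  finally have "P d" unfolding P_def homogeneous_def using kh L by (intro exI[of _ h]) auto
  then have PL: "P (LEAST d. P d)" by (rule LeastI)
  have least: "(LEAST d. P d) \<le> d'" if "P d'" for d' using that by (rule Least_le)
  from PL obtain g where g: "homogeneous (LEAST d. P d) g" "dehomogenise g = p" unfolding P_def by blast
  show ?thesis
  proof (rule ex1I)
    show "is_homogenisation p g"
      unfolding is_homogenisation_def
    proof (intro exI conjI allI impI)
      show "homogeneous (LEAST d. P d) g" by (rule g)
      show "dehomogenise g = p" by (rule g)
      fix d' h'
      assume "homogeneous d' h' \<and> dehomogenise h' = p"
      then show "(LEAST d. P d) \<le> d'" by (intro least) (auto simp: P_def)
    qed
    fix g' assume "is_homogenisation p g'"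
    then obtain e where e: "homogeneous e g'" "dehomogenise g' = p"
      "\<And>d' h'. homogeneous d' h' \<Longrightarrow> dehomogenise h' = p \<Longrightarrow> e \<le> d'"
      unfolding is_homogenisation_def by blast
    have "P e" unfolding P_def using e(1,2) by blast
    then have "e = (LEAST d. P d)" using e(3)[OF g] least by (simp add: le_antisym)
    then show "g' = g" using dehomogenise_inj[of e g' g] e(1,2) g by simp
  qed
qed

corollary is_homogenisation_homogenisation: "is_homogenisation p (homogenisation p)"
  unfolding homogenisation_def by (rule theI'[OF ex1_homogenisation])

lemma W4_pair_graph: "pair_graph W4"
  by unfold_locales (auto simp: W4_def W4_edges_def symmetric_def sym_def)

lemma ex_orientation:
  assumes "pair_graph G" shows "\<exists>D. orientation D G"
proof -
  interpret pair_graph G by fact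
  have sym: "(u, v) \<in> parcs G \<Longrightarrow> (v, u) \<in> parcs G" for u v
    using pair_sym_arcs by (auto simp: symmetric_def sym_def)
  have nl: "(u, u) \<notin> parcs G" for u using pair_no_loops by fastforce
  obtain f :: "'a \<Rightarrow> nat" where f: "inj_on f (pverts G)" using pair_finite_verts finite_imp_inj_to_nat_seg by blast
  have "orientation {(u, v). (u, v) \<in> parcs G \<and> f u < f v} G"
    unfolding orientation_def
  proof (intro conjI allI impI)
    fix u v assume a: "(u, v) \<in> parcs G"
    have "u \<noteq> v" using a nl by blast
    then have "f u \<noteq> f v" using f in_arcsD1[OF a] in_arcsD2[OF a] by (auto dest: inj_onD)
    then show "((u, v) \<in> {(u, v). (u, v) \<in> parcs G \<and> f u < f v}) =
      ((v, u) \<notin> {(u, v). (u, v) \<in> parcs G \<and> f u < f v})" using a sym by auto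
  qed auto
  then show ?thesis by blast
qed

lemma pair_graph_R_W4:
  assumes "pair_graph G" "orientation D G" shows "pair_graph (R_W4 D G)"
proof -
  interpret pair_graph G by fact
  interpret W: pair_graph W4 by (rule W4_pair_graph)
  have D: "D \<subseteq> parcs G" using assms(2) by (simp add: orientation_def)
  have finD: "finite D" using D pair_finite_arcs finite_subset by blast
  have nl: "fst e \<noteq> snd e" if "e \<in> D" for e using that D pair_no_loops by blast
  have sW: "(h, g) \<in> parcs W4" if "(g, h) \<in> parcs W4" for g h
    using that W.pair_sym_arcs by (auto simp: symmetric_def sym_def)
  have nW: "g \<noteq> h" if "(g, h) \<in> parcs W4" for g h using that W.pair_no_loops by fastforce
  show ?thesis
  proof unfold_locales
    show "finite (pverts (R_W4 D G))"
      using finD pair_finite_verts W.pair_finite_verts by (simp add: R_W4_def edge_replacement_def)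
    show "finite (parcs (R_W4 D G))"
      using finD W.pair_finite_arcs by (simp add: R_W4_def edge_replacement_def)
    show "symmetric (with_proj (R_W4 D G))"
      unfolding symmetric_def with_proj_simps
    proof (rule symI)
      fix x y assume "(x, y) \<in> parcs (R_W4 D G)"
      then obtain e g h where "e \<in> D" "(g, h) \<in> parcs W4"
        "x = copy_vertex (p_vertex 1) (p_vertex 4) e g" "y = copy_vertex (p_vertex 1) (p_vertex 4) e h"
        by (auto simp: R_W4_def edge_replacement_def)
      then show "(y, x) \<in> parcs (R_W4 D G)"
        using sW[of g h] by (force simp: R_W4_def edge_replacement_def)
    qed
    show "fst e \<in> pverts (R_W4 D G)" if "e \<in> parcs (R_W4 D G)" for e
      using that W.in_arcsD1 by (fastforce simp: R_W4_def edge_replacement_def)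
    show "snd e \<in> pverts (R_W4 D G)" if "e \<in> parcs (R_W4 D G)" for e
      using that W.in_arcsD2 by (fastforce simp: R_W4_def edge_replacement_def)
    show "fst e \<noteq> snd e" if e_in: "e \<in> parcs (R_W4 D G)" for e
    proof -
      obtain x y where e: "e = (x, y)" by (cases e)
      obtain a g h where a: "a \<in> D" "(g, h) \<in> parcs W4"
        "x = copy_vertex (p_vertex 1) (p_vertex 4) a g" "y = copy_vertex (p_vertex 1) (p_vertex 4) a h"
        using e_in e by (auto simp: R_W4_def edge_replacement_def)
      show ?thesis using e a(3,4) nW[OF a(2)] nl[OF a(1)] by (auto simp: copy_vertex_def split: if_splits)
    qed
  qed
qed

end

theory Submission
  imports Defs "HOL-Analysis.Function_Topology" "HOL-Analysis.Convex" "HOL-Computational_Algebra.Formal_Power_Series"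
begin

text \<open>
  Why the theorem is true. If all vertices are bound, the homogenised polynomial is
  \<open>\<Sum>j. c\<^sub>j x\<^sup>j y\<^bsup>\<alpha> - j\<^esup>\<close>, where \<open>c\<^sub>j\<close> counts the independent sets with \<open>j\<close> vertices. A bivariate form of
  degree \<open>d\<close> with an interval of positive coefficients \<open>a\<^sub>i\<close> is Lorentzian as soon as the sequence
  \<open>i! (d - i)! a\<^sub>i\<close> is log-concave (\<open>lorentzian_bivariate\<close>). Multiplication by \<open>(x y)\<^sup>k\<close> only weakens this
  condition, so it suffices to find some monomial multiple for which the inequalities hold
  (\<open>lorentzian_homogenised_if_log_concave\<close>).

  Summing first over the six inner vertices of every copy of \<open>W4\<close> gives
  \<open>\<Sum>j. c\<^sub>j x\<^sup>j = \<Sum>U. x\<^bsup>card U\<^esup> \<Prod>a. (1 + x)\<^sup>2 w(o(a))\<close>, where \<open>U\<close> runs over the sets of vertices of \<open>G\<close>,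
  \<open>a\<close> over its edges, \<open>o(a)\<close> is the number of ends of \<open>a\<close> outside \<open>U\<close>, and
  \<open>w(o) = (1 + x)\<^sup>o + o x (1 + x)\<^bsup>o - 1\<^esup>\<close> (\<open>W4_sum\<close>). Since \<open>w(o)\<close> is the coefficient of \<open>t\<close> in
  \<open>(x + t) (t + 1 + x)\<^sup>o\<close>, the whole sum is the coefficient of \<open>\<Prod>a. t\<^sub>a\<close> in a product of linear forms
  \<open>x + t\<^sub>a\<close> and of one form for every vertex \<open>v\<close>. In homogeneous variables, the form of a vertex of
  degree \<open>d\<close> is
     \<open>(x + y)\<^sup>d (y \<Prod>\<^bsub>a at v\<^esub> (t\<^sub>a + x + y) + x y\<^sup>d)\<close>,
  whose two summands stand for \<open>v\<close> outside \<open>U\<close> and for \<open>v\<close> in \<open>U\<close>.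

  Call a form completely log-concave (\<open>clc\<close>) if all the quadratic forms obtained from it by
  differentiating in nonnegative directions satisfy the reversed Cauchy-Schwarz inequality. This
  property passes to derivatives in nonnegative directions and to nonnegative linear substitutions
  for trivial reasons, and to products by \<open>clc_mult\<close>. Extracting the coefficient of \<open>t\<^sub>a\<close> is
  differentiating in the direction of \<open>t\<^sub>a\<close> and then setting \<open>t\<^sub>a = 0\<close>. So it remains to see that a
  multiple of each vertex form by \<open>(x y)\<^sup>k\<close> is completely log-concave (\<open>vertex_form_clc\<close>); reading the
  inequality in the plane of \<open>x\<close> and \<open>y\<close> then yields the log-concavity needed above
  (\<open>glued_sum_log_concave\<close>).

  Both facts rest on the same trickling-down principle (\<open>trickle_down_form\<close>, \<open>clc_trickle_down\<close>): a form of
  degree at least three is completely log-concave if its partial derivatives are, provided that the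
  nonnegative Hessian matrices are connected. For a product of forms in disjoint variables
  connectedness is automatic, since variables of different factors are always adjacent. For the
  vertex form, derivatives in a direction \<open>t\<^sub>a\<close> are products of linear forms, and one is left with
  explicit quadratic forms, which are hyperbolic in the limit of large \<open>k\<close> by inequalities between
  binomial coefficients (\<open>vertex_asymptotics\<close>).
\<close>

section \<open>Quadratic forms with one positive direction\<close>

definition bil :: "'i set \<Rightarrow> ('i \<Rightarrow> 'i \<Rightarrow> real) \<Rightarrow> ('i \<Rightarrow> real) \<Rightarrow> ('i \<Rightarrow> real) \<Rightarrow> real" where
  "bil K H a b = (\<Sum>i\<in>K. \<Sum>j\<in>K. a i * b j * H i j)"

lemma bil_commute:
  assumes "\<And>i j. i \<in> K \<Longrightarrow> j \<in> K \<Longrightarrow> H i j = H j i"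
  shows "bil K H a b = bil K H b a"
proof -
  have "bil K H a b = (\<Sum>i\<in>K. \<Sum>j\<in>K. b j * a i * H j i)"
    unfolding bil_def by (intro sum.cong refl) (simp add: assms)
  also have "\<dots> = bil K H b a" unfolding bil_def by (rule sum.swap)
  finally show ?thesis .
qed

lemma bil_lin_left: "bil K H (\<lambda>i. s * a i + t * b i) c = s * bil K H a c + t * bil K H b c"
  by (simp add: bil_def sum_distrib_left sum.distrib algebra_simps)

lemma bil_lin_right: "bil K H c (\<lambda>i. s * a i + t * b i) = s * bil K H c a + t * bil K H c b"
  by (simp add: bil_def sum_distrib_left sum.distrib algebra_simps)

lemma bil_nonneg:
  "(\<And>i j. i \<in> K \<Longrightarrow> j \<in> K \<Longrightarrow> 0 \<le> H i j) \<Longrightarrow> (\<And>i. i \<in> K \<Longrightarrow> 0 \<le> a i) \<Longrightarrow> (\<And>i. i \<in> K \<Longrightarrow> 0 \<le> b i) \<Longrightarrow> 0 \<le> bil K H a b"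
  unfolding bil_def by (intro sum_nonneg mult_nonneg_nonneg) auto

lemma bil_right: "bil K H a b = (\<Sum>i\<in>K. a i * (\<Sum>j\<in>K. b j * H i j))"
  by (simp add: bil_def sum_distrib_left mult.assoc)

text \<open>If a symmetric form is negative semidefinite on the orthogonal complement of one vector, then the
  plane spanned by any two vectors meets that complement, which gives the inequality in the plane.\<close>

lemma reversed_Cauchy_Schwarz:
  assumes sym: "\<And>i j. i \<in> K \<Longrightarrow> j \<in> K \<Longrightarrow> H i j = H j i"
    and neg: "\<And>z. bil K H v z = 0 \<Longrightarrow> bil K H z z \<le> 0"
    and a: "bil K H a a \<ge> 0"
  shows "bil K H a a * bil K H z z \<le> (bil K H a z)\<^sup>2"
proof (cases "bil K H a a > 0 \<and> bil K H z z > 0")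
  case False
  then have "bil K H a a * bil K H z z \<le> 0"
    using a by (auto simp: not_less mult_nonneg_nonpos)
  then show ?thesis by (smt (verit) zero_le_power2)
next
  case True
  define \<alpha> where "\<alpha> = bil K H v a"
  define \<zeta> where "\<zeta> = bil K H v z"
  have "\<alpha> \<noteq> 0" using neg[of a] True by (force simp: \<alpha>_def)
  have "\<zeta> \<noteq> 0" using neg[of z] True by (force simp: \<zeta>_def)
  define w where "w = (\<lambda>i. \<zeta> * a i + (- \<alpha>) * z i)"
  have "bil K H v w = 0"
    by (simp only: w_def bil_lin_right) (simp add: \<alpha>_def \<zeta>_def)
  then have "bil K H w w \<le> 0" by (rule neg)
  moreover have "bil K H w w = \<zeta>\<^sup>2 * bil K H a a - 2 * \<zeta> * \<alpha> * bil K H a z + \<alpha>\<^sup>2 * bil K H z z"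
    by (simp only: w_def bil_lin_left bil_lin_right bil_commute[OF sym, where a=z and b=a])
      (simp add: power2_eq_square algebra_simps)
  ultimately have le: "\<zeta>\<^sup>2 * bil K H a a + \<alpha>\<^sup>2 * bil K H z z \<le> 2 * \<zeta> * \<alpha> * bil K H a z" by linarith
  define A where "A = \<zeta>\<^sup>2 * bil K H a a"
  define B where "B = \<alpha>\<^sup>2 * bil K H z z"
  have pos: "A > 0" "B > 0" using True \<open>\<alpha> \<noteq> 0\<close> \<open>\<zeta> \<noteq> 0\<close> by (auto simp: A_def B_def)
  have "(A + B)\<^sup>2 \<le> (2 * \<zeta> * \<alpha> * bil K H a z)\<^sup>2"
    using le pos by (intro power_mono) (auto simp: A_def B_def)
  moreover have "4 * (A * B) \<le> (A + B)\<^sup>2"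
    using zero_le_power2[of "A - B"] by (simp add: power2_eq_square algebra_simps)
  ultimately have "4 * (A * B) \<le> (2 * \<zeta> * \<alpha> * bil K H a z)\<^sup>2" by linarith
  then have "(4 * \<zeta>\<^sup>2 * \<alpha>\<^sup>2) * (bil K H a a * bil K H z z) \<le> (4 * \<zeta>\<^sup>2 * \<alpha>\<^sup>2) * (bil K H a z)\<^sup>2"
    by (simp add: A_def B_def power_mult_distrib algebra_simps)
  moreover have "4 * \<zeta>\<^sup>2 * \<alpha>\<^sup>2 > 0" using \<open>\<alpha> \<noteq> 0\<close> \<open>\<zeta> \<noteq> 0\<close> by simp
  ultimately show ?thesis by (rule mult_left_le_imp_le)
qed

text \<open>First-order condition at a maximum: the quadratic growth of a perturbation cannot absorb a linear
  term.\<close>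

lemma linear_term_zero:
  fixes b c :: real
  assumes "\<And>t. 2 * t * b + t\<^sup>2 * c \<le> 0"
  shows "b = 0"
proof (rule ccontr)
  assume "b \<noteq> 0"
  define s where "s = \<bar>c\<bar> + 1"
  have s: "s > 0" "c > - 2 * s" by (auto simp: s_def)
  have "2 * (b / s) * b + (b / s)\<^sup>2 * c = b\<^sup>2 / s\<^sup>2 * (2 * s + c)"
    using s by (simp add: field_simps power2_eq_square)
  moreover have "b\<^sup>2 / s\<^sup>2 * (2 * s + c) > 0" using s \<open>b \<noteq> 0\<close> by simp
  ultimately show False using assms[of "b / s"] by linarith
qed

lemma max_on_sphere:
  fixes d l :: "'i \<Rightarrow> real"
  assumes fin: "finite K" and d: "\<And>i. i \<in> K \<Longrightarrow> d i > 0"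
    and y: "(\<Sum>i\<in>K. l i * y i) = 0" "(\<Sum>i\<in>K. d i * (y i)\<^sup>2) = 1"
  obtains z where "(\<Sum>i\<in>K. l i * z i) = 0" "(\<Sum>i\<in>K. d i * (z i)\<^sup>2) = 1"
    "\<And>x. (\<Sum>i\<in>K. l i * x i) = 0 \<Longrightarrow> (\<Sum>i\<in>K. d i * (x i)\<^sup>2) = 1 \<Longrightarrow> bil K H x x \<le> bil K H z z"
proof -
  define B where "B = Pi\<^sub>E (UNIV :: 'i set) (\<lambda>i. if i \<in> K then {- sqrt (1 / d i) .. sqrt (1 / d i)} else {0::real})"
  have "compactin (product_topology (\<lambda>_. euclidean) (UNIV :: 'i set)) B"
    unfolding B_def by (subst compactin_PiE) (auto simp: compactin_euclidean_iff)
  then have cB: "compact B" by (simp add: euclidean_product_topology compactin_euclidean_iff)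
  have cont: "continuous_on UNIV (\<lambda>x. \<Sum>i\<in>K. l i * x i)" "continuous_on UNIV (\<lambda>x. \<Sum>i\<in>K. d i * (x i)\<^sup>2)"
     "continuous_on UNIV (\<lambda>x. bil K H x x)"
    unfolding bil_def by (intro continuous_intros continuous_on_product_coordinates)+
  have cl: "closed {x. (\<Sum>i\<in>K. l i * x i) = 0}" "closed {x. (\<Sum>i\<in>K. d i * (x i)\<^sup>2) = 1}"
    using cont by (auto intro!: closed_Collect_eq)
  define C where "C = B \<inter> ({x. (\<Sum>i\<in>K. l i * x i) = 0} \<inter> {x. (\<Sum>i\<in>K. d i * (x i)\<^sup>2) = 1})"
  have cC: "compact C" unfolding C_def using cB cl by (intro compact_Int_closed closed_Int)
  have restr: "(\<lambda>i. if i \<in> K then x i else 0) \<in> C" if "(\<Sum>i\<in>K. l i * x i) = 0" "(\<Sum>i\<in>K. d i * (x i)\<^sup>2) = 1" for x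
  proof -
    have "\<bar>x i\<bar> \<le> sqrt (1 / d i)" if i: "i \<in> K" for i
    proof -
      have "d i * (x i)\<^sup>2 \<le> (\<Sum>i\<in>K. d i * (x i)\<^sup>2)"
        using fin i d by (intro member_le_sum) (auto intro!: mult_nonneg_nonneg simp: less_imp_le)
      then have "(x i)\<^sup>2 \<le> 1 / d i" using that \<open>(\<Sum>i\<in>K. d i * (x i)\<^sup>2) = 1\<close> d[OF i] by (simp add: field_simps)
      then show ?thesis using real_sqrt_le_mono by fastforce
    qed
    then have "(\<lambda>i. if i \<in> K then x i else 0) \<in> B"
      unfolding B_def by (auto simp: PiE_def Pi_def abs_le_iff) (metis minus_le_iff)+
    then show ?thesis unfolding C_def using that by auto
  qed
  have ne: "C \<noteq> {}" using restr[OF y] by auto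
  obtain z where z: "z \<in> C" "\<And>x. x \<in> C \<Longrightarrow> bil K H x x \<le> bil K H z z"
    using continuous_attains_sup[OF cC ne continuous_on_subset[OF cont(3)]] by auto
  show ?thesis
  proof (rule that[of z])
    fix x assume x: "(\<Sum>i\<in>K. l i * x i) = 0" "(\<Sum>i\<in>K. d i * (x i)\<^sup>2) = 1"
    have "bil K H x x = bil K H (\<lambda>i. if i \<in> K then x i else 0) (\<lambda>i. if i \<in> K then x i else 0)"
      unfolding bil_def by (intro sum.cong) auto
    then show "bil K H x x \<le> bil K H z z" using z(2)[OF restr[OF x]] by simp
  qed (use z(1) in \<open>auto simp: C_def\<close>)
qed

text \<open>The trickling-down principle for a cubic form with partial derivatives \<open>T k\<close> and \<open>H\<close> its derivative
  in the direction \<open>v\<close>. Reversed Cauchy-Schwarz for the \<open>T k\<close> sums up to \<open>H \<le> H d\<^sup>-\<^sup>1 H\<close>, where \<open>d\<close> is the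
  diagonal matrix with \<open>d v = H v\<close>. So the eigenvalues of \<open>H\<close> relative to \<open>d\<close> do not lie strictly
  between 0 and 1. On the other hand, by Perron-Frobenius no eigenvalue exceeds 1, and connectedness
  makes \<open>v\<close> the only eigenvector for 1. Only the rows on which \<open>H\<close> does not vanish matter.\<close>

lemma trickle_down_form:
  fixes H :: "'i \<Rightarrow> 'i \<Rightarrow> real" and v :: "'i \<Rightarrow> real"
  assumes fin: "finite I" and sym: "\<And>i j. i \<in> I \<Longrightarrow> j \<in> I \<Longrightarrow> H i j = H j i"
    and nn: "\<And>i j. i \<in> I \<Longrightarrow> j \<in> I \<Longrightarrow> H i j \<ge> 0"
    and v: "\<And>i. i \<in> I \<Longrightarrow> v i > 0"
    and conn: "\<And>r i j. (\<And>i j. i \<in> I \<Longrightarrow> j \<in> I \<Longrightarrow> H i j > 0 \<Longrightarrow> (r i :: real) = r j) \<Longrightarrow>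
       i \<in> I \<Longrightarrow> j \<in> I \<Longrightarrow> \<exists>k\<in>I. H i k > 0 \<Longrightarrow> \<exists>k\<in>I. H j k > 0 \<Longrightarrow> r i = r j"
    and T_sum: "\<And>z. bil I H z z = (\<Sum>k\<in>I. v k * T k z)"
    and T: "\<And>k z. k \<in> I \<Longrightarrow> (\<Sum>j\<in>I. v j * H k j) * T k z \<le> (\<Sum>j\<in>I. z j * H k j)\<^sup>2"
    and T0: "\<And>k z. k \<in> I \<Longrightarrow> (\<And>j. j \<in> I \<Longrightarrow> H k j = 0) \<Longrightarrow> T k z \<le> 0"
    and z: "bil I H v z = 0"
  shows "bil I H z z \<le> 0"
proof -
  define K where "K = {i\<in>I. \<exists>k\<in>I. H i k > 0}"
  have K: "K \<subseteq> I" "finite K" using fin by (auto simp: K_def)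
  have H0: "H i j = 0" if "i \<in> I - K" "j \<in> I" for i j
    using that nn[of i j] by (force simp: K_def)
  have bilK: "bil I H a b = bil K H a b" for a b
  proof -
    have "bil I H a b = (\<Sum>i\<in>K. \<Sum>j\<in>I. a i * b j * H i j)"
      unfolding bil_def using K fin H0 by (intro sum.mono_neutral_right) (auto intro!: sum.neutral)
    also have "\<dots> = bil K H a b"
    proof -
      have "H i j = 0" if "i \<in> K" "j \<in> I - K" for i j
        using that H0[of j i] sym[of i j] K by auto
      then show ?thesis
        unfolding bil_def using K fin by (intro sum.cong refl sum.mono_neutral_right) auto
    qed
    finally show ?thesis .
  qed
  have symK: "\<And>i j. i \<in> K \<Longrightarrow> j \<in> K \<Longrightarrow> H i j = H j i" using sym K by auto
  have rowK: "(\<Sum>j\<in>I. a j * H k j) = (\<Sum>j\<in>K. a j * H k j)" if "k \<in> I" for a k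
    using K fin H0 sym that by (intro sum.mono_neutral_right) (auto simp: subset_eq)
  define h where "h k = (\<Sum>j\<in>K. v j * H k j)" for k
  have hpos: "h k > 0" if k: "k \<in> K" for k
  proof -
    obtain j where j: "j \<in> I" "H k j > 0" "k \<in> I" using k by (auto simp: K_def)
    have "(\<Sum>j\<in>I. v j * H k j) > 0"
      using j fin v nn by (intro sum_pos2[of I j]) (auto intro!: mult_nonneg_nonneg mult_pos_pos intro: less_imp_le)
    then show ?thesis using rowK[OF j(3)] by (simp add: h_def)
  qed
  have vpos: "\<And>i. i \<in> K \<Longrightarrow> v i > 0" using v K by auto
  define d where "d i = h i / v i" for i
  have dpos: "d i > 0" if "i \<in> K" for i using hpos vpos that by (simp add: d_def)
  have bvz: "bil K H v x = (\<Sum>i\<in>K. h i * x i)" for x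
    by (subst bil_commute[OF symK]) (simp_all add: bil_right h_def mult.commute)
  have key: "bil K H x x \<le> (\<Sum>k\<in>K. v k * (\<Sum>j\<in>K. x j * H k j)\<^sup>2 / h k)" for x
  proof -
    have "bil K H x x = (\<Sum>k\<in>I. v k * T k x)" using T_sum bilK by metis
    also have "\<dots> \<le> (\<Sum>k\<in>K. v k * T k x)"
    proof -
      have "(\<Sum>k\<in>I - K. v k * T k x) \<le> 0"
        using T0 H0 v by (intro sum_nonpos mult_nonneg_nonpos) (auto simp: less_imp_le)
      then show ?thesis using sum.subset_diff[OF K(1) fin, of "\<lambda>k. v k * T k x"] by linarith
    qed
    also have "\<dots> \<le> (\<Sum>k\<in>K. v k * ((\<Sum>j\<in>K. x j * H k j)\<^sup>2 / h k))"
    proof (intro sum_mono mult_left_mono)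
      fix k assume k: "k \<in> K"
      then have "h k * T k x \<le> (\<Sum>j\<in>K. x j * H k j)\<^sup>2" using T[of k x] rowK K by (auto simp: h_def subset_eq)
      then show "T k x \<le> (\<Sum>j\<in>K. x j * H k j)\<^sup>2 / h k" using hpos[OF k] by (simp add: field_simps)
      show "0 \<le> v k" using vpos[OF k] by simp
    qed
    finally show ?thesis by simp
  qed
  show ?thesis
  proof (rule ccontr)
    assume "\<not> bil I H z z \<le> 0"
    then have zpos: "bil K H z z > 0" using bilK by simp
    define N where "N x = (\<Sum>i\<in>K. d i * (x i)\<^sup>2)" for x
    have Nnn: "N x \<ge> 0" for x unfolding N_def using dpos by (intro sum_nonneg mult_nonneg_nonneg) (auto simp: less_imp_le)
    have Nscale: "N (\<lambda>i. c * x i) = c\<^sup>2 * N x" for c x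
      by (simp add: N_def sum_distrib_left power_mult_distrib algebra_simps)
    have Bscale: "bil K H (\<lambda>i. c * x i) (\<lambda>i. c * x i) = c\<^sup>2 * bil K H x x" for c x
      by (simp add: bil_def sum_distrib_left power2_eq_square algebra_simps)
    have Lscale: "(\<Sum>i\<in>K. h i * (c * x i)) = c * (\<Sum>i\<in>K. h i * x i)" for c x
      by (simp add: sum_distrib_left algebra_simps)
    have N0: "bil K H x x = 0" if "N x = 0" for x
    proof -
      have "\<forall>i\<in>K. d i * (x i)\<^sup>2 = 0"
        using that K(2) dpos unfolding N_def by (subst (asm) sum_nonneg_eq_0_iff) (auto intro!: mult_nonneg_nonneg simp: less_imp_le)
      then have "\<forall>i\<in>K. x i = 0" using dpos by fastforce
      then show ?thesis by (simp add: bil_def)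
    qed
    have "N z > 0" using N0[of z] zpos Nnn[of z] by fastforce
    define y where "y = (\<lambda>i. (1 / sqrt (N z)) * z i)"
    have zz: "(\<Sum>i\<in>K. h i * z i) = 0" using z bilK bvz by simp
    have y: "(\<Sum>i\<in>K. h i * y i) = 0" "N y = 1" "bil K H y y > 0"
      using Lscale[of "1 / sqrt (N z)" z] Nscale[of "1 / sqrt (N z)" z] Bscale[of "1 / sqrt (N z)" z] zz zpos \<open>N z > 0\<close>
      by (auto simp: y_def power_divide)
    obtain w where w: "(\<Sum>i\<in>K. h i * w i) = 0" "N w = 1"
      "\<And>x. (\<Sum>i\<in>K. h i * x i) = 0 \<Longrightarrow> N x = 1 \<Longrightarrow> bil K H x x \<le> bil K H w w"
      unfolding N_def by (rule max_on_sphere[OF K(2) dpos y(1) y(2)[unfolded N_def], of H]) auto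
    define \<mu> where "\<mu> = bil K H w w"
    have lpos: "\<mu> > 0" using w(3)[OF y(1,2)] y(3) by (simp add: \<mu>_def)
    have max: "bil K H x x \<le> \<mu> * N x" if x: "(\<Sum>i\<in>K. h i * x i) = 0" for x
    proof (cases "N x = 0")
      case True then show ?thesis using N0 by simp
    next
      case False
      then have "N x > 0" using Nnn[of x] by simp
      define x' where "x' = (\<lambda>i. (1 / sqrt (N x)) * x i)"
      have "bil K H x' x' \<le> \<mu>"
        unfolding \<mu>_def using Lscale[of "1 / sqrt (N x)" x] Nscale[of "1 / sqrt (N x)" x] x \<open>N x > 0\<close>
        by (intro w(3)) (auto simp: x'_def power_divide)
      then have "bil K H x x / N x \<le> \<mu>" unfolding x'_def Bscale using \<open>N x > 0\<close> by (simp add: power_divide)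
      then show ?thesis using \<open>N x > 0\<close> by (simp add: field_simps)
    qed
    define P where "P x = (\<Sum>i\<in>K. d i * x i * w i)" for x
    have stat: "bil K H x w = \<mu> * P x" if x: "(\<Sum>i\<in>K. h i * x i) = 0" for x
    proof -
      have "bil K H x w - \<mu> * P x = 0"
      proof (rule linear_term_zero)
        fix t
        have o: "(\<Sum>i\<in>K. h i * (1 * w i + t * x i)) = 0"
          using x w(1) by (simp add: algebra_simps sum.distrib flip: sum_distrib_left)
        have "N (\<lambda>i. 1 * w i + t * x i) = N w + 2 * t * P x + t\<^sup>2 * N x"
          by (simp add: N_def P_def power2_eq_square algebra_simps sum.distrib sum_distrib_left)
        moreover have "bil K H (\<lambda>i. 1 * w i + t * x i) (\<lambda>i. 1 * w i + t * x i)
            = \<mu> + 2 * t * bil K H x w + t\<^sup>2 * bil K H x x"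
          by (simp only: bil_lin_left bil_lin_right bil_commute[OF symK, where a=w and b=x])
            (simp add: \<mu>_def power2_eq_square algebra_simps)
        ultimately show "2 * t * (bil K H x w - \<mu> * P x) + t\<^sup>2 * (bil K H x x - \<mu> * N x) \<le> 0"
          using max[OF o] w(2) by (simp add: algebra_simps)
      qed
      then show ?thesis by simp
    qed
    have Pv: "P v = 0" using w(1) vpos by (simp add: P_def d_def) (smt (verit) sum.cong nonzero_eq_divide_eq less_irrefl times_divide_eq_left)
    have bvw: "bil K H v w = 0" using bvz w(1) by simp
    have hv: "(\<Sum>i\<in>K. h i * v i) > 0 \<or> K = {}"
      using K(2) hpos vpos by (cases "K = {}") (auto intro!: sum_pos)
    have Kne: "K \<noteq> {}" using w(2) by (auto simp: N_def)
    have stat': "bil K H x w = \<mu> * P x" for x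
    proof -
      define c where "c = (\<Sum>i\<in>K. h i * x i) / (\<Sum>i\<in>K. h i * v i)"
      have "(\<Sum>i\<in>K. h i * (1 * x i + (- c) * v i)) = (\<Sum>i\<in>K. h i * x i) - c * (\<Sum>i\<in>K. h i * v i)"
        by (simp add: algebra_simps sum_subtractf sum_distrib_left)
      also have "\<dots> = 0" using hv Kne by (simp add: c_def)
      finally have "bil K H (\<lambda>i. 1 * x i + (- c) * v i) w = \<mu> * P (\<lambda>i. 1 * x i + (- c) * v i)" by (rule stat)
      moreover have "P (\<lambda>i. 1 * x i + (- c) * v i) = P x - c * P v"
        by (simp add: P_def algebra_simps sum_subtractf sum_distrib_left)
      ultimately show ?thesis by (simp only: bil_lin_left bvw Pv) simp
    qed
    have row: "(\<Sum>j\<in>K. w j * H k j) = \<mu> * d k * w k" if k: "k \<in> K" for k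
    proof -
      have "(\<Sum>j\<in>K. w j * H k j) = bil K H (\<lambda>i. of_bool (i = k)) w"
        using k K(2) by (simp add: bil_right of_bool_def if_distrib[where f="\<lambda>x. x * _"] cong: if_cong)
      also have "\<dots> = \<mu> * P (\<lambda>i. of_bool (i = k))" by (rule stat')
      also have "P (\<lambda>i. of_bool (i = k)) = d k * w k"
        using k K(2) by (simp add: P_def of_bool_def if_distrib[where f="\<lambda>x. _ * x"] if_distrib[where f="\<lambda>x. x * _"] cong: if_cong)
      finally show ?thesis by simp
    qed
    have "\<mu> \<le> (\<Sum>k\<in>K. v k * (\<mu> * d k * w k)\<^sup>2 / h k)"
      using key[of w] row by (simp add: \<mu>_def[symmetric])
    also have "\<dots> = (\<Sum>k\<in>K. \<mu>\<^sup>2 * (d k * (w k)\<^sup>2))"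
    proof (intro sum.cong refl)
      fix k assume k: "k \<in> K"
      show "v k * (\<mu> * d k * w k)\<^sup>2 / h k = \<mu>\<^sup>2 * (d k * (w k)\<^sup>2)"
        using hpos[OF k] vpos[OF k] by (simp add: d_def power2_eq_square field_simps)
    qed
    also have "\<dots> = \<mu>\<^sup>2" using w(2) by (simp add: N_def flip: sum_distrib_left)
    finally have l1: "\<mu> \<ge> 1" using lpos by (simp add: power2_eq_square)
    \<comment> \<open>Perron-Frobenius: the defect of \<open>w\<close> from \<open>v\<close> is a sum of squares along the edges of \<open>H\<close>.\<close>
    define r where "r i = w i / v i" for i
    have wr: "w i = r i * v i" if "i \<in> K" for i using vpos[OF that] by (simp add: r_def)
    define E where "E = (\<Sum>i\<in>K. \<Sum>j\<in>K. H i j * v i * v j * (r i - r j)\<^sup>2)"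
    have n1: "(\<Sum>i\<in>K. \<Sum>j\<in>K. H i j * v i * v j * (r i)\<^sup>2) = N w"
      unfolding N_def d_def h_def
    proof (intro sum.cong refl)
      fix i assume "i \<in> K"
      then have "v i \<noteq> 0" using vpos by fastforce
      then show "(\<Sum>j\<in>K. H i j * v i * v j * (r i)\<^sup>2) = (\<Sum>j\<in>K. v j * H i j) / v i * (w i)\<^sup>2"
        by (simp add: r_def sum_distrib_right sum_distrib_left sum_divide_distrib power2_eq_square field_simps)
    qed
    have n2: "(\<Sum>i\<in>K. \<Sum>j\<in>K. H i j * v i * v j * (r j)\<^sup>2) = N w"
      by (subst sum.swap) (use symK n1 in \<open>simp add: mult.assoc mult.left_commute cong: sum.cong\<close>)
    have n3: "(\<Sum>i\<in>K. \<Sum>j\<in>K. H i j * v i * v j * (r i * r j)) = \<mu>"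
      unfolding \<mu>_def bil_def by (intro sum.cong refl) (simp add: wr algebra_simps)
    have "E = (\<Sum>i\<in>K. \<Sum>j\<in>K. H i j * v i * v j * (r i)\<^sup>2) + (\<Sum>i\<in>K. \<Sum>j\<in>K. H i j * v i * v j * (r j)\<^sup>2)
       - 2 * (\<Sum>i\<in>K. \<Sum>j\<in>K. H i j * v i * v j * (r i * r j))"
      unfolding E_def sum_distrib_left sum.distrib[symmetric] sum_subtractf[symmetric]
      by (intro sum.cong refl) (simp add: power2_eq_square algebra_simps)
    then have E: "E \<le> 0" using n1 n2 n3 w(2) l1 by simp
    have term_nn: "0 \<le> H i j * v i * v j * (r i - r j)\<^sup>2" if "i \<in> K" "j \<in> K" for i j
      using that nn K vpos by (intro mult_nonneg_nonneg) (auto simp: less_imp_le)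
    have "E = 0" using E term_nn unfolding E_def by (intro antisym sum_nonneg) auto
    then have "\<forall>i\<in>K. (\<Sum>j\<in>K. H i j * v i * v j * (r i - r j)\<^sup>2) = 0"
      unfolding E_def using K(2) term_nn by (subst (asm) sum_nonneg_eq_0_iff) (auto intro!: sum_nonneg)
    then have all0: "H i j * v i * v j * (r i - r j)\<^sup>2 = 0" if "i \<in> K" "j \<in> K" for i j
      using that K(2) term_nn sum_nonneg_eq_0_iff[of K "\<lambda>j. H i j * v i * v j * (r i - r j)\<^sup>2"] by simp
    have req: "r i = r j" if "i \<in> I" "j \<in> I" "H i j > 0" for i j
    proof -
      have "H j i > 0" using that sym[of i j] by simp
      then have "i \<in> K" "j \<in> K" using that unfolding K_def by blast+
      then show ?thesis using all0[of i j] that vpos[of i] vpos[of j] by simp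
    qed
    obtain k where k: "k \<in> K" using Kne by auto
    have rk: "r i = r k" if "i \<in> K" for i
      using conn[of r i k] req that k by (auto simp: K_def)
    have "0 = r k * (\<Sum>i\<in>K. h i * v i)"
      using w(1) rk by (simp add: wr sum_distrib_left algebra_simps cong: sum.cong)
    then have "r k = 0" using hv Kne by auto
    then have "\<forall>i\<in>K. w i = 0" using wr rk by simp
    then show False using w(2) by (simp add: N_def)
  qed
qed

section \<open>Polynomials as iterated directional derivatives\<close>

text \<open>A homogeneous polynomial of degree \<open>n\<close> is determined by its derivatives along \<open>n\<close> directions at the
  origin. A polynomial is therefore encoded as a function of lists of directions. Then directional
  derivatives and linear substitutions are immediate, and by the Leibniz rule the product becomes the
  shuffle product. Symmetry and multilinearity are imposed by \<open>form\<close> below.\<close>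

typedef 'i polar = "UNIV :: (('i \<Rightarrow> real) list \<Rightarrow> real) set"
  morphisms dv Polar ..

setup_lifting type_definition_polar

lemma dv_eqI: "(\<And>vs. dv f vs = dv g vs) \<Longrightarrow> f = g"
  by transfer auto

lift_definition Der :: "('i \<Rightarrow> real) \<Rightarrow> 'i polar \<Rightarrow> 'i polar" is "\<lambda>v f vs. f (v # vs)" .

fun shuffle_prod :: "('d list \<Rightarrow> real) \<Rightarrow> ('d list \<Rightarrow> real) \<Rightarrow> 'd list \<Rightarrow> real" where
  "shuffle_prod f g [] = f [] * g []"
| "shuffle_prod f g (v # vs) =
     shuffle_prod (\<lambda>us. f (v # us)) g vs + shuffle_prod f (\<lambda>us. g (v # us)) vs"

lemma shuffle_prod_add_left: "shuffle_prod (\<lambda>us. f us + g us) h vs = shuffle_prod f h vs + shuffle_prod g h vs"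
  by (induction vs arbitrary: f g h) (auto simp: algebra_simps)

lemma shuffle_prod_commute: "shuffle_prod f g vs = shuffle_prod g f vs"
  by (induction vs arbitrary: f g) auto

lemma shuffle_prod_add_right: "shuffle_prod h (\<lambda>us. f us + g us) vs = shuffle_prod h f vs + shuffle_prod h g vs"
  by (metis shuffle_prod_add_left shuffle_prod_commute)

lemma shuffle_prod_0: "shuffle_prod (\<lambda>_. 0) g vs = 0"
  by (induction vs arbitrary: g) auto

lemma shuffle_prod_const:
  assumes "\<And>us. us \<noteq> [] \<Longrightarrow> f us = 0"
  shows "shuffle_prod f g vs = f [] * g vs"
  using assms by (induction vs arbitrary: g) (auto simp: shuffle_prod_0)

lemma shuffle_prod_assoc: "shuffle_prod (shuffle_prod f g) h vs = shuffle_prod f (shuffle_prod g h) vs"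
  by (induction vs arbitrary: f g h) (auto simp: shuffle_prod_add_left shuffle_prod_add_right)

instantiation polar :: (type) comm_ring_1
begin
lift_definition zero_polar :: "'a polar" is "\<lambda>_. 0" .
lift_definition one_polar :: "'a polar" is "\<lambda>vs. if vs = [] then 1 else 0" .
lift_definition plus_polar :: "'a polar \<Rightarrow> 'a polar \<Rightarrow> 'a polar" is "\<lambda>f g vs. f vs + g vs" .
lift_definition uminus_polar :: "'a polar \<Rightarrow> 'a polar" is "\<lambda>f vs. - f vs" .
lift_definition minus_polar :: "'a polar \<Rightarrow> 'a polar \<Rightarrow> 'a polar" is "\<lambda>f g vs. f vs - g vs" .
lift_definition times_polar :: "'a polar \<Rightarrow> 'a polar \<Rightarrow> 'a polar" is shuffle_prod .
instance
proof
  fix a b c :: "'a polar"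
  show "a + b + c = a + (b + c)" by transfer (auto simp: fun_eq_iff)
  show "a + b = b + a" by transfer (auto simp: fun_eq_iff)
  show "0 + a = a" by transfer auto
  show "- a + a = 0" by transfer auto
  show "a - b = a + - b" by transfer auto
  show "a * b * c = a * (b * c)" by transfer (auto simp: fun_eq_iff shuffle_prod_assoc)
  show "a * b = b * a" by transfer (auto simp: fun_eq_iff shuffle_prod_commute)
  show "1 * a = a" by transfer (auto simp: fun_eq_iff shuffle_prod_const)
  show "(a + b) * c = a * c + b * c" by transfer (auto simp: fun_eq_iff shuffle_prod_add_left)
  show "(0::'a polar) \<noteq> 1" by transfer (auto simp: fun_eq_iff)
qed
end

lemma dv_0 [simp]: "dv 0 vs = 0" and dv_1: "dv 1 vs = (if vs = [] then 1 else 0)"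
  and dv_add [simp]: "dv (f + g) vs = dv f vs + dv g vs"
  and dv_Der [simp]: "dv (Der v f) vs = dv f (v # vs)"
  by (transfer, simp)+

lemma dv_mult_Nil [simp]: "dv (f * g) [] = dv f [] * dv g []"
  by transfer simp

lemma Der_add [simp]: "Der v (f + g) = Der v f + Der v g" and Der_0 [simp]: "Der v 0 = 0" and Der_1 [simp]: "Der v 1 = 0"
  by (rule dv_eqI; simp add: dv_1)+

lemma Der_mult: "Der v (f * g) = Der v f * g + f * Der v g"
  by transfer (auto simp: fun_eq_iff)

lemma dv_mult_Cons: "dv (f * g) (v # vs) = dv (Der v f * g) vs + dv (f * Der v g) vs"
  by (metis Der_mult dv_Der dv_add)

lemma dv_sum: "dv (sum f A) vs = (\<Sum>a\<in>A. dv (f a) vs)"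
  by (induction A rule: infinite_finite_induct) auto

definition Ders :: "('i \<Rightarrow> real) list \<Rightarrow> 'i polar \<Rightarrow> 'i polar" where
  "Ders vs f = fold Der vs f"

lemma Ders_simps [simp]: "Ders [] f = f" "Ders (v # vs) f = Ders vs (Der v f)"
  by (simp_all add: Ders_def)

lemma dv_Ders: "dv (Ders us f) vs = dv f (us @ vs)"
  by (induction us arbitrary: f) auto

lemma Ders_add [simp]: "Ders vs (f + g) = Ders vs f + Ders vs g"
  by (rule dv_eqI) (simp add: dv_Ders)

lemma dv_mult_const: "(\<And>us. us \<noteq> [] \<Longrightarrow> dv f us = 0) \<Longrightarrow> dv (f * g) vs = dv f [] * dv g vs"
  by transfer (rule shuffle_prod_const)

lift_definition const :: "real \<Rightarrow> 'i polar" is "\<lambda>c vs. if vs = [] then c else 0" .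

lemma dv_const: "dv (const c) vs = (if vs = [] then c else 0)"
  by transfer simp

lemma Der_const [simp]: "Der v (const c) = 0"
  by (rule dv_eqI) (simp add: dv_const)

lemma dv_const_mult [simp]: "dv (const c * f) vs = c * dv f vs"
  by (simp add: dv_mult_const dv_const)

text \<open>The substitution of a linear map \<open>A\<close> into a polynomial.\<close>

lift_definition pull :: "(('j \<Rightarrow> real) \<Rightarrow> 'i \<Rightarrow> real) \<Rightarrow> 'i polar \<Rightarrow> 'j polar" is "\<lambda>A f vs. f (map A vs)" .

lemma dv_pull [simp]: "dv (pull A f) vs = dv f (map A vs)"
  by transfer simp

lemma Der_pull: "Der v (pull A f) = pull A (Der (A v) f)"
  by (rule dv_eqI) simp

lemma pull_mult: "pull A (f * g) = pull A f * pull A g"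
proof (rule dv_eqI)
  fix vs show "dv (pull A (f * g)) vs = dv (pull A f * pull A g) vs"
  proof (induction vs arbitrary: f g)
    case (Cons v vs)
    then show ?case by (simp add: dv_mult_Cons Der_pull)
  qed simp
qed

lemma pull_add: "pull A (f + g) = pull A f + pull A g" and pull_1: "pull A 1 = 1" and pull_0: "pull A 0 = 0"
  by (rule dv_eqI; simp add: dv_1)+

lemma pull_power: "pull A (f ^ n) = pull A f ^ n"
  by (induction n) (auto simp: pull_1 pull_mult)

lemma pull_prod: "pull A (prod f E) = (\<Prod>x\<in>E. pull A (f x))"
  by (induction E rule: infinite_finite_induct) (auto simp: pull_1 pull_mult)

lift_definition coord :: "'i \<Rightarrow> 'i polar" is "\<lambda>i vs. case vs of [v] \<Rightarrow> v i | _ \<Rightarrow> 0" .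

lemma dv_coord: "dv (coord i) vs = (case vs of [v] \<Rightarrow> v i | _ \<Rightarrow> 0)"
  by transfer simp

section \<open>Homogeneous forms\<close>

definition basis :: "'i \<Rightarrow> 'i \<Rightarrow> real" where "basis i = (\<lambda>j. of_bool (j = i))"

definition nonneg :: "('i \<Rightarrow> real) \<Rightarrow> bool" where "nonneg v \<longleftrightarrow> (\<forall>i. 0 \<le> v i)"

lemma nonneg_basis [simp]: "nonneg (basis i)" by (simp add: nonneg_def basis_def)

text \<open>Homogeneous polynomials of degree \<open>n\<close> in the variables \<open>I\<close> with nonnegative coefficients. Linearity
  is stated as an expansion along the basis, which also says that no other variables occur.\<close>

definition form :: "'i set \<Rightarrow> nat \<Rightarrow> 'i polar \<Rightarrow> bool" where
  "form I n f \<longleftrightarrow>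
     (\<forall>vs. dv f vs \<noteq> 0 \<longrightarrow> length vs = n) \<and>
     (\<forall>us v w ws. dv f (us @ v # w # ws) = dv f (us @ w # v # ws)) \<and>
     (\<forall>us v ws. dv f (us @ v # ws) = (\<Sum>i\<in>I. v i * dv f (us @ basis i # ws))) \<and>
     (\<forall>vs. (\<forall>v\<in>set vs. nonneg v) \<longrightarrow> 0 \<le> dv f vs)"

lemma form_degree: "form I n f \<Longrightarrow> length vs \<noteq> n \<Longrightarrow> dv f vs = 0"
  by (auto simp: form_def)

lemma form_swap:
  assumes "form I n f" shows "dv f (us @ v # w # ws) = dv f (us @ w # v # ws)"
  by (rule assms[unfolded form_def, THEN conjunct2, THEN conjunct1, rule_format])

lemma form_linear:
  assumes "form I n f" shows "dv f (us @ v # ws) = (\<Sum>i\<in>I. v i * dv f (us @ basis i # ws))"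
  by (rule assms[unfolded form_def, THEN conjunct2, THEN conjunct2, THEN conjunct1, rule_format])

lemma form_nonneg:
  assumes "form I n f" "\<And>v. v \<in> set vs \<Longrightarrow> nonneg v" shows "0 \<le> dv f vs"
  using assms(1)[unfolded form_def, THEN conjunct2, THEN conjunct2, THEN conjunct2] assms(2) by simp

lemma formI:
  assumes "\<And>vs. dv f vs \<noteq> 0 \<Longrightarrow> length vs = n"
    and "\<And>us v w ws. dv f (us @ v # w # ws) = dv f (us @ w # v # ws)"
    and "\<And>us v ws. dv f (us @ v # ws) = (\<Sum>i\<in>I. v i * dv f (us @ basis i # ws))"
    and "\<And>vs. (\<And>v. v \<in> set vs \<Longrightarrow> nonneg v) \<Longrightarrow> 0 \<le> dv f vs"
  shows "form I n f"
  unfolding form_def by (intro conjI allI impI; rule assms) blast+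

lemma form_Der:
  assumes "form I n f" "nonneg v" shows "form I (n - 1) (Der v f)"
  unfolding form_def
proof (intro conjI allI impI)
  fix vs assume "dv (Der v f) vs \<noteq> 0"
  then show "length vs = n - 1" using form_degree[OF assms(1), of "v # vs"] by (cases "length (v # vs) = n") auto
next
  fix us w x ws show "dv (Der v f) (us @ w # x # ws) = dv (Der v f) (us @ x # w # ws)"
    using form_swap[OF assms(1), of "v # us"] by simp
next
  fix us w ws show "dv (Der v f) (us @ w # ws) = (\<Sum>i\<in>I. w i * dv (Der v f) (us @ basis i # ws))"
    using form_linear[OF assms(1), of "v # us" w ws] by simp
next
  fix vs :: "('a \<Rightarrow> real) list" assume "\<forall>v\<in>set vs. nonneg v"
  then show "0 \<le> dv (Der v f) vs" using form_nonneg[OF assms(1), of "v # vs"] assms(2) by auto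
qed

lemma form_Ders: "form I n f \<Longrightarrow> (\<And>v. v \<in> set vs \<Longrightarrow> nonneg v) \<Longrightarrow> form I (n - length vs) (Ders vs f)"
proof (induction vs arbitrary: n f)
  case (Cons v vs)
  from Cons.IH[of "n - 1" "Der v f"] form_Der[OF Cons.prems(1)] Cons.prems(2) show ?case by simp
qed simp

lemma form_move: "form I n f \<Longrightarrow> dv f (us @ v # ws) = dv f (v # us @ ws)"
proof (induction us arbitrary: ws rule: rev_induct)
  case (snoc u us)
  then show ?case using form_swap[OF snoc.prems, of us u v ws] by simp
qed simp

lemma form_Der_Ders: "form I n f \<Longrightarrow> Der v (Ders us f) = Ders us (Der v f)"
  by (rule dv_eqI) (simp add: dv_Ders form_move[of I n f us v])

lemma form_outside: "form I n f \<Longrightarrow> i \<notin> I \<Longrightarrow> Der (basis i) f = 0"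
proof (rule dv_eqI)
  fix vs assume f: "form I n f" "i \<notin> I"
  have "dv f (basis i # vs) = (\<Sum>j\<in>I. basis i j * dv f (basis j # vs))" using form_linear[OF f(1), of "[]" "basis i" vs] by simp
  also have "\<dots> = 0" by (intro sum.neutral) (use f(2) in \<open>auto simp: basis_def\<close>)
  finally show "dv (Der (basis i) f) vs = dv 0 vs" by simp
qed

lemma form_mono:
  assumes "form I n f" "I \<subseteq> J" "finite J" shows "form J n f"
proof -
  have "dv f (us @ v # ws) = (\<Sum>i\<in>J. v i * dv f (us @ basis i # ws))" for us v ws
  proof -
    have "(\<Sum>i\<in>J. v i * dv f (us @ basis i # ws)) = (\<Sum>i\<in>I. v i * dv f (us @ basis i # ws))"
    proof (intro sum.mono_neutral_right ballI)
      fix i assume "i \<in> J - I"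
      then have "Der (basis i) f = 0" by (intro form_outside[OF assms(1)]) simp
      then have "dv f (basis i # us @ ws) = 0" using dv_Der[of "basis i" f "us @ ws"] by simp
      then show "v i * dv f (us @ basis i # ws) = 0" using form_move[OF assms(1), of us "basis i" ws] by simp
    qed (use assms in auto)
    then show ?thesis using form_linear[OF assms(1), of us v ws] by simp
  qed
  note lin = this
  show ?thesis
  proof (rule formI)
    show "length vs = n" if "dv f vs \<noteq> 0" for vs using that form_degree[OF assms(1), of vs] by argo
    show "dv f (us @ v # w # ws) = dv f (us @ w # v # ws)" for us v w ws by (rule form_swap[OF assms(1)])
    show "dv f (us @ v # ws) = (\<Sum>i\<in>J. v i * dv f (us @ basis i # ws))" for us v ws by (rule lin)
    show "0 \<le> dv f vs" if "\<And>v. v \<in> set vs \<Longrightarrow> nonneg v" for vs by (rule form_nonneg[OF assms(1) that])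
  qed
qed

lemma form_add:
  assumes f: "form I n f" and g: "form I n g" shows "form I n (f + g)"
  unfolding form_def dv_add
proof (intro conjI allI impI)
  fix vs assume "dv f vs + dv g vs \<noteq> 0"
  then show "length vs = n" using form_degree[OF f, of vs] form_degree[OF g, of vs] by force
next
  fix us v w ws show "dv f (us @ v # w # ws) + dv g (us @ v # w # ws) = dv f (us @ w # v # ws) + dv g (us @ w # v # ws)"
    by (simp only: form_swap[OF f, of us v w] form_swap[OF g, of us v w])
next
  fix us v ws
  show "dv f (us @ v # ws) + dv g (us @ v # ws) = (\<Sum>i\<in>I. v i * (dv f (us @ basis i # ws) + dv g (us @ basis i # ws)))"
    by (simp only: form_linear[OF f, of us v] form_linear[OF g, of us v] distrib_left sum.distrib)
next
  fix vs :: "('a \<Rightarrow> real) list" assume "\<forall>v\<in>set vs. nonneg v"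
  then show "0 \<le> dv f vs + dv g vs" using form_nonneg[OF f, of vs] form_nonneg[OF g, of vs] by simp
qed

lemma form_1: "form I 0 1"
  by (auto simp: form_def dv_1)

lemma form_coord: "finite I \<Longrightarrow> i \<in> I \<Longrightarrow> form I 1 (coord i)"
  unfolding form_def
proof (intro conjI allI impI)
  assume fin: "finite I" and i: "i \<in> I"
  fix us ws :: "('a \<Rightarrow> real) list" and v :: "'a \<Rightarrow> real"
  show "dv (coord i) (us @ v # ws) = (\<Sum>j\<in>I. v j * dv (coord i) (us @ basis j # ws))"
  proof (cases "us = [] \<and> ws = []")
    case True
    then show ?thesis
      using fin i by (simp add: dv_coord basis_def of_bool_def if_distrib[where f="\<lambda>x. _ * x"] cong: if_cong)
  next
    case False
    have "dv (coord i) (us @ u # ws) = 0" for u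
      unfolding dv_coord using False by (cases us; cases ws) (auto split: list.split)
    then show ?thesis by simp
  qed
qed (auto simp: dv_coord nonneg_def split: list.splits)

lemma dv_mult_split:
  assumes "dv (f * g) vs \<noteq> 0"
  obtains us ws where "length us + length ws = length vs" "set us \<subseteq> set vs" "set ws \<subseteq> set vs" "dv f us \<noteq> 0" "dv g ws \<noteq> 0"
proof -
  have "\<exists>us ws. length us + length ws = length vs \<and> set us \<subseteq> set vs \<and> set ws \<subseteq> set vs \<and> dv f us \<noteq> 0 \<and> dv g ws \<noteq> 0"
    using assms
  proof (induction vs arbitrary: f g)
    case Nil
    then show ?case by (intro exI[of _ "[]"]) auto
  next
    case (Cons v vs)
    then consider "dv (Der v f * g) vs \<noteq> 0" | "dv (f * Der v g) vs \<noteq> 0" by (fastforce simp: dv_mult_Cons)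
    then show ?case
    proof cases
      case 1
      from Cons.IH[OF this] obtain us ws where "length us + length ws = length vs" "set us \<subseteq> set vs" "set ws \<subseteq> set vs" "dv f (v # us) \<noteq> 0" "dv g ws \<noteq> 0"
        by auto
      then show ?thesis by (intro exI[of _ "v # us"] exI[of _ ws]) auto
    next
      case 2
      from Cons.IH[OF this] obtain us ws where "length us + length ws = length vs" "set us \<subseteq> set vs" "set ws \<subseteq> set vs" "dv f us \<noteq> 0" "dv g (v # ws) \<noteq> 0"
        by auto
      then show ?thesis by (intro exI[of _ us] exI[of _ "v # ws"]) auto
    qed
  qed
  then show ?thesis using that by blast
qed

lemma dv_mult_nonneg:
  "form I m f \<Longrightarrow> form J n g \<Longrightarrow> (\<And>v. v \<in> set vs \<Longrightarrow> nonneg v) \<Longrightarrow> 0 \<le> dv (f * g) vs"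
proof (induction vs arbitrary: f g m n)
  case Nil
  then show ?case using form_nonneg[of I m f "[]"] form_nonneg[of J n g "[]"] by simp
next
  case (Cons v vs)
  have "0 \<le> dv (Der v f * g) vs" using Cons.IH[OF form_Der Cons.prems(2)] Cons.prems by simp
  moreover have "0 \<le> dv (f * Der v g) vs" using Cons.IH[OF Cons.prems(1) form_Der] Cons.prems by simp
  ultimately show ?case by (simp add: dv_mult_Cons)
qed

text \<open>The value of a product is a sum over the ways to distribute the directions over the two factors; one
  of the nonnegative summands is a lower bound.\<close>

lemma dv_mult_ge:
  "form I m f \<Longrightarrow> form J n g \<Longrightarrow> (\<And>v. v \<in> set us \<union> set ws \<Longrightarrow> nonneg v) \<Longrightarrow>
     dv f us * dv g ws \<le> dv (f * g) (us @ ws)"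
proof (induction us arbitrary: f m)
  case Nil
  then show ?case
  proof (induction ws arbitrary: g n)
    case Nil
    then show ?case by simp
  next
    case (Cons w ws)
    have "dv f [] * dv (Der w g) ws \<le> dv (f * Der w g) ([] @ ws)"
      using Cons.prems by (intro Cons.IH[of "n-1" "Der w g"]) (auto intro!: form_Der simp del: One_nat_def)
    moreover have "0 \<le> dv (Der w f * g) ws"
      using Cons.prems by (intro dv_mult_nonneg[of I "m-1" "Der w f" J n g]) (auto intro!: form_Der simp del: One_nat_def)
    ultimately show ?case by (simp add: dv_mult_Cons)
  qed
next
  case (Cons u us)
  have "dv (Der u f) us * dv g ws \<le> dv (Der u f * g) (us @ ws)"
    using Cons.prems by (intro Cons.IH[of "m-1" "Der u f"]) (auto intro!: form_Der simp del: One_nat_def)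
  moreover have "0 \<le> dv (f * Der u g) (us @ ws)"
    using Cons.prems by (intro dv_mult_nonneg[of I m f J "n-1" "Der u g"]) (auto intro!: form_Der simp del: One_nat_def)
  ultimately show ?case by (simp add: dv_mult_Cons)
qed

lemma form_mult:
  assumes f: "form I m f" and g: "form I n g"
  shows "form I (m + n) (f * g)"
  unfolding form_def
proof (intro conjI allI impI)
  fix vs assume "dv (f * g) vs \<noteq> 0"
  then show "length vs = m + n"
    by (rule dv_mult_split) (use form_degree[OF f] form_degree[OF g] in metis)
next
  fix us ws :: "('a \<Rightarrow> real) list" and v w
  show "dv (f * g) (us @ v # w # ws) = dv (f * g) (us @ w # v # ws)"
  proof -
    define S where "S h \<longleftrightarrow> (\<forall>us v w ws. dv h (us @ v # w # ws) = dv h (us @ w # v # ws))" for h :: "'a polar"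
    have SD: "S (Der x h)" if "S h" for h x
      unfolding S_def dv_Der
    proof (intro allI)
      fix us v w ws show "dv h (x # us @ v # w # ws) = dv h (x # us @ w # v # ws)"
        using that[unfolded S_def, rule_format, of "x # us" v w ws] by simp
    qed
    have Sc: "Der x (Der y h) = Der y (Der x h)" if "S h" for h x y
      by (rule dv_eqI) (use that[unfolded S_def, rule_format, of "[]" y x] in simp)
    have "S f \<Longrightarrow> S g \<Longrightarrow> dv (f * g) (us @ v # w # ws) = dv (f * g) (us @ w # v # ws)"
    proof (induction us arbitrary: f g)
      case Nil
      have "Der w (Der v (f * g)) = Der v (Der w (f * g))"
        using Sc[OF Nil(1), of v w] Sc[OF Nil(2), of v w] by (simp add: Der_mult algebra_simps)
      then show ?case using dv_Der[of w "Der v (f * g)" ws] dv_Der[of v "Der w (f * g)" ws] by simp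
    next
      case (Cons u us)
      then show ?case using SD[of f u] SD[of g u] by (simp add: dv_mult_Cons)
    qed
    moreover have "S f" "S g" unfolding S_def by (intro allI form_swap[OF f] form_swap[OF g])+
    ultimately show ?thesis by blast
  qed
next
  fix us ws :: "('a \<Rightarrow> real) list" and v
  define L where "L h \<longleftrightarrow> (\<forall>us v ws. dv h (us @ v # ws) = (\<Sum>i\<in>I. v i * dv h (us @ basis i # ws)))" for h :: "'a polar"
  have LD: "L (Der x h)" if "L h" for h x
    unfolding L_def dv_Der
  proof (intro allI)
    fix us v ws show "dv h (x # us @ v # ws) = (\<Sum>i\<in>I. v i * dv h (x # us @ basis i # ws))"
      using that[unfolded L_def, rule_format, of "x # us" v ws] by simp
  qed
  have Lc: "Der v h = (\<Sum>i\<in>I. const (v i) * Der (basis i) h)" if "L h" for h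
  proof (rule dv_eqI)
    fix vs show "dv (Der v h) vs = dv (\<Sum>i\<in>I. const (v i) * Der (basis i) h) vs"
      using that[unfolded L_def, rule_format, of "[]" v vs] by (simp add: dv_sum)
  qed
  have main: "L f \<Longrightarrow> L g \<Longrightarrow> dv (f * g) (us @ v # ws) = (\<Sum>i\<in>I. v i * dv (f * g) (us @ basis i # ws))"
  proof (induction us arbitrary: f g)
    case Nil
    have "Der v f * g = (\<Sum>i\<in>I. const (v i) * (Der (basis i) f * g))"
      by (simp only: Lc[OF Nil(1)] sum_distrib_right mult.assoc)
    moreover have "f * Der v g = (\<Sum>i\<in>I. const (v i) * (f * Der (basis i) g))"
      by (simp only: Lc[OF Nil(2)] sum_distrib_left mult.left_commute)
    ultimately show ?case by (simp add: dv_mult_Cons dv_sum sum.distrib distrib_left)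
  next
    case (Cons u us)
    have "dv (Der u f * g) (us @ v # ws) = (\<Sum>i\<in>I. v i * dv (Der u f * g) (us @ basis i # ws))"
      by (rule Cons.IH[OF LD[OF Cons.prems(1)] Cons.prems(2)])
    moreover have "dv (f * Der u g) (us @ v # ws) = (\<Sum>i\<in>I. v i * dv (f * Der u g) (us @ basis i # ws))"
      by (rule Cons.IH[OF Cons.prems(1) LD[OF Cons.prems(2)]])
    ultimately show ?case by (simp only: append_Cons dv_mult_Cons distrib_left sum.distrib)
  qed
  have "L f" "L g" unfolding L_def by (intro allI form_linear[OF f] form_linear[OF g])+
  then show "dv (f * g) (us @ v # ws) = (\<Sum>i\<in>I. v i * dv (f * g) (us @ basis i # ws))" by (rule main)
next
  fix vs :: "('a \<Rightarrow> real) list" assume "\<forall>v\<in>set vs. nonneg v"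
  then show "0 \<le> dv (f * g) vs" using dv_mult_nonneg[OF f g] by blast
qed

section \<open>Completely log-concave forms\<close>

text \<open>Complete log-concavity. The direction \<open>z\<close> is arbitrary, so that the inequality says that the second
  derivative has at most one positive eigenvalue.\<close>

definition clc :: "'i polar \<Rightarrow> bool" where
  "clc f \<longleftrightarrow> (\<forall>vs a z. (\<forall>v\<in>set vs. nonneg v) \<longrightarrow> nonneg a \<longrightarrow>
     dv f (vs @ [a, a]) * dv f (vs @ [z, z]) \<le> (dv f (vs @ [a, z]))\<^sup>2)"

lemma clcI:
  "(\<And>vs a z. (\<And>v. v \<in> set vs \<Longrightarrow> nonneg v) \<Longrightarrow> nonneg a \<Longrightarrow>
     dv f (vs @ [a, a]) * dv f (vs @ [z, z]) \<le> (dv f (vs @ [a, z]))\<^sup>2) \<Longrightarrow> clc f"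
  unfolding clc_def by simp

lemma clcD:
  "clc f \<Longrightarrow> (\<And>v. v \<in> set vs \<Longrightarrow> nonneg v) \<Longrightarrow> nonneg a \<Longrightarrow>
     dv f (vs @ [a, a]) * dv f (vs @ [z, z]) \<le> (dv f (vs @ [a, z]))\<^sup>2"
  unfolding clc_def by simp

lemma clc_Der:
  fixes f :: "'i polar"
  assumes "clc f" "nonneg v" shows "clc (Der v f)"
proof (rule clcI)
  fix vs :: "('i \<Rightarrow> real) list" and a z :: "'i \<Rightarrow> real"
  assume "\<And>v. v \<in> set vs \<Longrightarrow> nonneg v" "nonneg a"
  then show "dv (Der v f) (vs @ [a, a]) * dv (Der v f) (vs @ [z, z]) \<le> (dv (Der v f) (vs @ [a, z]))\<^sup>2"
    using clcD[OF assms(1), of "v # vs" a z] assms(2) by auto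
qed

lemma clc_Ders: "clc f \<Longrightarrow> (\<And>v. v \<in> set vs \<Longrightarrow> nonneg v) \<Longrightarrow> clc (Ders vs f)"
  by (induction vs arbitrary: f) (auto simp: clc_Der)

lemma clc_low_degree:
  assumes "form I n f" "n < 2" shows "clc f"
  by (rule clcI) (use assms in \<open>simp add: form_degree[OF assms(1)]\<close>)

lemma clc_const_mult:
  fixes f :: "'i polar"
  shows "clc f \<Longrightarrow> clc (const c * f)"
proof (rule clcI)
  fix vs :: "('i \<Rightarrow> real) list" and a z :: "'i \<Rightarrow> real"
  assume "clc f" "\<And>v. v \<in> set vs \<Longrightarrow> nonneg v" "nonneg a"
  then have "c\<^sup>2 * (dv f (vs @ [a, a]) * dv f (vs @ [z, z])) \<le> c\<^sup>2 * (dv f (vs @ [a, z]))\<^sup>2"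
    by (intro mult_left_mono clcD) auto
  then show "dv (const c * f) (vs @ [a, a]) * dv (const c * f) (vs @ [z, z]) \<le> (dv (const c * f) (vs @ [a, z]))\<^sup>2"
    unfolding dv_const_mult by (simp only: power2_eq_square mult_ac)
qed

lemma form_bil:
  assumes "form I n f"
  shows "dv f (vs @ [a, z]) = bil I (\<lambda>i j. dv f (vs @ [basis i, basis j])) a z"
proof -
  have "dv f (vs @ [a, z]) = (\<Sum>i\<in>I. a i * dv f (vs @ [basis i, z]))"
    by (rule form_linear[OF assms])
  also have "\<dots> = (\<Sum>i\<in>I. a i * (\<Sum>j\<in>I. z j * dv f (vs @ [basis i, basis j])))"
  proof (intro sum.cong refl arg_cong2[where f="(*)"])
    fix i show "dv f (vs @ [basis i, z]) = (\<Sum>j\<in>I. z j * dv f (vs @ [basis i, basis j]))"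
      using form_linear[OF assms, of "vs @ [basis i]" z "[]"] by simp
  qed
  finally show ?thesis by (simp add: bil_right)
qed

lemma form_last_two:
  assumes "form I n f" shows "dv f (vs @ [a, z]) = dv f (vs @ [z, a])"
  using form_swap[OF assms, of vs a z "[]"] by simp

definition positive :: "('i \<Rightarrow> real) \<Rightarrow> bool" where "positive v \<longleftrightarrow> (\<forall>i. 0 < v i)"

lemma positive_nonneg: "positive v \<Longrightarrow> nonneg v"
  by (simp add: positive_def nonneg_def less_imp_le)

text \<open>A form with nonnegative coefficients that does not vanish at some nonnegative directions is positive
  at all positive ones, because some monomial occurs.\<close>

lemma form_pos:
  "finite I \<Longrightarrow> form I n f \<Longrightarrow> dv f us \<noteq> 0 \<Longrightarrow> (\<And>u. u \<in> set us \<Longrightarrow> nonneg u) \<Longrightarrow>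
     (\<And>w. w \<in> set ws \<Longrightarrow> positive w) \<Longrightarrow> length ws = length us \<Longrightarrow> dv f ws > 0"
proof (induction us arbitrary: f n ws)
  case Nil
  then show ?case using form_nonneg[OF Nil(2), of "[]"] by simp
next
  case (Cons u us)
  obtain w ws' where ws: "ws = w # ws'" "length ws' = length us" using Cons.prems(6) by (cases ws) auto
  have "dv f (u # us) = (\<Sum>i\<in>I. u i * dv f (basis i # us))" using form_linear[OF Cons.prems(2), of "[]" u us] by simp
  then obtain i where i: "i \<in> I" "dv f (basis i # us) \<noteq> 0" using Cons.prems(3) by (metis (no_types, lifting) mult_zero_right sum.neutral)
  have pos: "dv f (basis i # ws') > 0"
    using Cons.IH[OF Cons.prems(1) form_Der[OF Cons.prems(2) nonneg_basis, of i], of ws'] i Cons.prems(4,5) ws by simp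
  have "0 < (\<Sum>i\<in>I. w i * dv f (basis i # ws'))"
  proof (rule sum_pos2[OF Cons.prems(1) i(1)])
    show "0 < w i * dv f (basis i # ws')" using pos Cons.prems(5) ws by (auto simp: positive_def)
    fix j
    have "0 \<le> dv f (basis j # ws')"
      by (rule form_nonneg[OF Cons.prems(2)]) (use Cons.prems(5) ws positive_nonneg in auto)
    moreover have "0 < w j" using Cons.prems(5) ws by (auto simp: positive_def)
    ultimately show "0 \<le> w j * dv f (basis j # ws')" by simp
  qed
  then show ?case using form_linear[OF Cons.prems(2), of "[]" w ws'] ws by simp
qed

lemma continuous_shift:
  assumes "form I n f"
  shows "continuous_on UNIV (\<lambda>\<epsilon>. dv f (us @ map (\<lambda>v i. v i + \<epsilon>) vs @ ws))"
proof (induction vs arbitrary: us)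
  case (Cons v vs)
  have "dv f (us @ map (\<lambda>v i. v i + \<epsilon>) (v # vs) @ ws) =
      (\<Sum>i\<in>I. (v i + \<epsilon>) * dv f ((us @ [basis i]) @ map (\<lambda>v i. v i + \<epsilon>) vs @ ws))" for \<epsilon>
    using form_linear[OF assms, of us "\<lambda>i. v i + \<epsilon>" "map (\<lambda>v i. v i + \<epsilon>) vs @ ws"] by simp
  then show ?case by (simp only:) (intro continuous_intros Cons.IH)
qed simp

text \<open>Nonnegative directions are limits of positive ones, and the values are continuous.\<close>

lemma clc_if_positive:
  fixes f :: "'i polar"
  assumes f: "form I n f"
    and pos: "\<And>vs a z. (\<And>v. v \<in> set vs \<Longrightarrow> positive v) \<Longrightarrow> nonneg a \<Longrightarrow>
     dv f (vs @ [a, a]) * dv f (vs @ [z, z]) \<le> (dv f (vs @ [a, z]))\<^sup>2"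
  shows "clc f"
proof (rule clcI)
  fix vs :: "('i \<Rightarrow> real) list" and a z :: "'i \<Rightarrow> real"
  assume nn: "\<And>v. v \<in> set vs \<Longrightarrow> nonneg v" "nonneg a"
  define h where "h us \<epsilon> = dv f (map (\<lambda>v i. v i + \<epsilon>) vs @ us)" for us \<epsilon>
  have h0: "h us 0 = dv f (vs @ us)" for us by (simp add: h_def)
  have lim: "(h us \<longlongrightarrow> h us 0) (at_right 0)" for us
  proof -
    have "continuous_on UNIV (h us)" unfolding h_def using continuous_shift[OF f, of "[]" vs us] by simp
    then have "isCont (h us) 0" by (simp add: continuous_on_eq_continuous_at)
    then show ?thesis unfolding isCont_def by (rule tendsto_mono[OF at_le[OF subset_UNIV]])
  qed
  have "h [a, a] 0 * h [z, z] 0 \<le> (h [a, z] 0)\<^sup>2"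
  proof (rule tendsto_le[OF trivial_limit_at_right_real])
    show "((\<lambda>\<epsilon>. (h [a, z] \<epsilon>)\<^sup>2) \<longlongrightarrow> (h [a, z] 0)\<^sup>2) (at_right 0)" by (intro tendsto_intros lim)
    show "((\<lambda>\<epsilon>. h [a, a] \<epsilon> * h [z, z] \<epsilon>) \<longlongrightarrow> h [a, a] 0 * h [z, z] 0) (at_right 0)" by (intro tendsto_intros lim)
    show "\<forall>\<^sub>F \<epsilon> in at_right 0. h [a, a] \<epsilon> * h [z, z] \<epsilon> \<le> (h [a, z] \<epsilon>)\<^sup>2"
      unfolding eventually_at_right_field
    proof (intro exI[of _ 1] conjI allI impI)
      fix \<epsilon> :: real assume "0 < \<epsilon>"
      then show "h [a, a] \<epsilon> * h [z, z] \<epsilon> \<le> (h [a, z] \<epsilon>)\<^sup>2"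
        unfolding h_def using nn
        by (intro pos) (auto simp: positive_def nonneg_def add_nonneg_pos)
    qed simp
  qed
  then show "dv f (vs @ [a, a]) * dv f (vs @ [z, z]) \<le> (dv f (vs @ [a, z]))\<^sup>2" by (simp add: h0)
qed

text \<open>In positive directions connectedness is a property of the support only, which is why the limit
  argument comes first. One of the directions plays the role of \<open>v\<close> in \<open>trickle_down_form\<close>.\<close>

lemma clc_trickle_down:
  fixes f :: "'i polar"
  assumes fin: "finite I" and f: "form I n f" and n: "n \<ge> 3"
    and partials: "\<And>i. i \<in> I \<Longrightarrow> clc (Der (basis i) f)"
    and conn: "\<And>vs r i j. length vs + 2 = n \<Longrightarrow> (\<And>v. v \<in> set vs \<Longrightarrow> positive v) \<Longrightarrow>
       (\<And>i j. i \<in> I \<Longrightarrow> j \<in> I \<Longrightarrow> dv f (vs @ [basis i, basis j]) > 0 \<Longrightarrow> (r i :: real) = r j) \<Longrightarrow>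
       i \<in> I \<Longrightarrow> j \<in> I \<Longrightarrow> \<exists>k\<in>I. dv f (vs @ [basis i, basis k]) > 0 \<Longrightarrow> \<exists>k\<in>I. dv f (vs @ [basis j, basis k]) > 0 \<Longrightarrow> r i = r j"
  shows "clc f"
proof (rule clc_if_positive[OF f])
  fix vs :: "('i \<Rightarrow> real) list" and a z :: "'i \<Rightarrow> real"
  assume pos: "\<And>v. v \<in> set vs \<Longrightarrow> positive v" and a: "nonneg a"
  show "dv f (vs @ [a, a]) * dv f (vs @ [z, z]) \<le> (dv f (vs @ [a, z]))\<^sup>2"
  proof (cases "length vs + 2 = n")
    case False
    then show ?thesis by (simp add: form_degree[OF f])
  next
    case len: True
    then obtain v ws where vs: "vs = v # ws" using n by (cases vs) auto
    have nnvs: "nonneg u" if "u \<in> set vs" for u using pos[OF that] by (rule positive_nonneg)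
    define H where "H i j = dv f (vs @ [basis i, basis j])" for i j
    have bil: "dv f (vs @ [b, c]) = bil I H b c" for b c
      using form_bil[OF f, of vs b c] unfolding H_def .
    have sym: "H i j = H j i" for i j unfolding H_def by (rule form_last_two[OF f])
    have nn: "0 \<le> H i j" for i j
      unfolding H_def by (rule form_nonneg[OF f]) (use nnvs in auto)
    have front: "dv f (vs @ [basis k, c]) = dv f (basis k # ws @ [v, c])" for k c
      using form_move[OF f, of vs "basis k" "[c]"] form_move[OF f, of "basis k # ws" v "[c]"]
        form_swap[OF f, of "[]" v "basis k" "ws @ [c]"] by (simp add: vs)
    have row: "(\<Sum>j\<in>I. c j * H k j) = dv f (basis k # ws @ [v, c])" for k c
      using form_linear[OF f, of "vs @ [basis k]" c "[]"] front[of k c] by (simp add: H_def)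
    show ?thesis
      unfolding bil
    proof (rule reversed_Cauchy_Schwarz)
      show "H i j = H j i" for i j by (rule sym)
      show "0 \<le> bil I H a a"
        by (rule bil_nonneg) (use nn a in \<open>auto simp: nonneg_def\<close>)
      fix y assume y: "bil I H v y = 0"
      show "bil I H y y \<le> 0"
      proof (rule trickle_down_form[where v = v and T = "\<lambda>k z. dv f (basis k # ws @ [z, z])", OF fin sym nn _ _ _ _ _ y])
        show "v i > 0" for i using pos[of v] vs by (simp add: positive_def)
        show "bil I H z z = (\<Sum>k\<in>I. v k * dv f (basis k # ws @ [z, z]))" for z
          using form_linear[OF f, of "[]" v "ws @ [z, z]"] bil[of z z] by (simp add: vs)
        show "(\<Sum>j\<in>I. v j * H k j) * dv f (basis k # ws @ [z, z]) \<le> (\<Sum>j\<in>I. z j * H k j)\<^sup>2" if "k \<in> I" for k z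
          unfolding row using clcD[OF partials[OF that], of ws v z] nnvs vs by auto
        show "dv f (basis k # ws @ [z, z]) \<le> 0" if k: "k \<in> I" and H0: "\<And>j. j \<in> I \<Longrightarrow> H k j = 0" for k z
        proof -
          have "dv f (basis k # ws @ [basis i, basis j]) = 0" if "i \<in> I" "j \<in> I" for i j
          proof (rule ccontr)
            define g where "g = Der (basis k) (Der (basis j) f)"
            have dvg: "dv g us = dv f (us @ [basis k, basis j])" for us
              using form_move[OF f, of us "basis k" "[basis j]"] form_move[OF f, of "basis k # us" "basis j" "[]"] by (simp add: g_def)
            have g: "form I (n - 1 - 1) g" unfolding g_def by (intro form_Der f nonneg_basis)
            assume "dv f (basis k # ws @ [basis i, basis j]) \<noteq> 0"
            moreover have "dv f (basis k # ws @ [basis i, basis j]) = dv g (ws @ [basis i])"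
              unfolding dvg using form_move[OF f, of "ws @ [basis i]" "basis k" "[basis j]"] by simp
            ultimately have "dv g vs > 0"
              using nnvs pos by (intro form_pos[OF fin g, of "ws @ [basis i]"]) (auto simp: vs)
            then show False using H0[OF that(2)] by (simp add: dvg H_def)
          qed
          then show ?thesis
            using form_bil[OF f, of "basis k # ws" z z] by (simp add: bil_def)
        qed
      qed (use conn[OF len pos] in \<open>unfold H_def, blast\<close>)
    qed
  qed
qed

section \<open>Products\<close>

definition nonzero :: "'i polar \<Rightarrow> bool" where
  "nonzero f \<longleftrightarrow> (\<exists>us. (\<forall>u\<in>set us. nonneg u) \<and> dv f us \<noteq> 0)"

lemma nonzero_partials:
  assumes f: "form I m f" and g: "form J n g" "n \<ge> 1" and i: "i \<notin> J"
    and vs: "\<And>v. v \<in> set vs \<Longrightarrow> nonneg v" and nz: "dv (f * g) (vs @ [basis i, basis k]) \<noteq> 0"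
    and fg: "form K N (f * g)"
  shows "nonzero (Der (basis i) f)" "\<exists>j\<in>J. nonzero (Der (basis j) g)"
proof -
  have "dv (f * g) (vs @ [basis i, basis k]) = dv (Der (basis i) (f * g)) (vs @ [basis k])"
    using form_move[OF fg, of vs "basis i" "[basis k]"] by simp
  also have "Der (basis i) (f * g) = Der (basis i) f * g" by (simp add: Der_mult form_outside[OF g(1) i])
  finally have "dv (Der (basis i) f * g) (vs @ [basis k]) \<noteq> 0" using nz by simp
  then obtain us ws where uw: "set us \<subseteq> set (vs @ [basis k])" "set ws \<subseteq> set (vs @ [basis k])" "dv (Der (basis i) f) us \<noteq> 0" "dv g ws \<noteq> 0"
    by (rule dv_mult_split)
  have nn: "\<forall>u\<in>set us. nonneg u" "\<forall>u\<in>set ws. nonneg u" using uw(1,2) vs by auto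
  then show "nonzero (Der (basis i) f)" using uw(3) by (auto simp: nonzero_def)
  have "length ws = n" using uw(4) form_degree[OF g(1)] by blast
  then obtain w ws' where ws: "ws = w # ws'" using g(2) by (cases ws) auto
  have "(\<Sum>j\<in>J. w j * dv g (basis j # ws')) \<noteq> 0" using form_linear[OF g(1), of "[]" w ws'] uw(4) ws by simp
  then obtain j where "j \<in> J" "dv g (basis j # ws') \<noteq> 0" by (metis (no_types, lifting) mult_zero_right sum.neutral)
  then show "\<exists>j\<in>J. nonzero (Der (basis j) g)" using nn(2) ws by (intro bexI[of _ j]) (auto simp: nonzero_def intro!: exI[of _ ws'])
qed

text \<open>By induction on the degree: a partial derivative of the product differentiates only one factor. The
  Hessian is connected because a variable of \<open>f\<close> and a variable of \<open>g\<close> that occur at all occur together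
  in a monomial of the product.\<close>

lemma clc_mult_disjoint:
  fixes f g :: "'i polar"
  assumes fin: "finite I" "finite J" and disj: "I \<inter> J = {}"
  shows "form I m f \<Longrightarrow> form J n g \<Longrightarrow> clc f \<Longrightarrow> clc g \<Longrightarrow> clc (f * g)"
proof (induction "m + n" arbitrary: m n f g rule: less_induct)
  case less
  have fg: "form (I \<union> J) (m + n) (f * g)"
    by (intro form_mult form_mono[OF less.prems(1)] form_mono[OF less.prems(2)]) (use fin in auto)
  consider "m = 0" | "n = 0" | "m = 1" "n = 1" | "m \<ge> 1" "n \<ge> 1" "m + n \<ge> 3" by linarith
  then show ?case
  proof cases
    case 1
    have "f = const (dv f [])"
      by (rule dv_eqI) (use form_degree[OF less.prems(1)] 1 in \<open>auto simp: dv_const\<close>)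
    then show ?thesis using clc_const_mult[OF less.prems(4)] by metis
  next
    case 2
    have "g = const (dv g [])"
      by (rule dv_eqI) (use form_degree[OF less.prems(2)] 2 in \<open>auto simp: dv_const\<close>)
    then show ?thesis using clc_const_mult[OF less.prems(3)] mult.commute by metis
  next
    case 3
    have eq: "dv (f * g) [a, z] = dv f [a] * dv g [z] + dv f [z] * dv g [a]" for a z
      by (simp add: dv_mult_Cons form_degree[OF less.prems(1)] form_degree[OF less.prems(2)] 3)
    show ?thesis
    proof (rule clcI)
      fix vs :: "('i \<Rightarrow> real) list" and a z :: "'i \<Rightarrow> real"
      have "(2 * (dv f [a] * dv g [a])) * (2 * (dv f [z] * dv g [z])) \<le> (dv f [a] * dv g [z] + dv f [z] * dv g [a])\<^sup>2"
        using zero_le_power2[of "dv f [a] * dv g [z] - dv f [z] * dv g [a]"]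
        by (simp add: power2_eq_square algebra_simps)
      then show "dv (f * g) (vs @ [a, a]) * dv (f * g) (vs @ [z, z]) \<le> (dv (f * g) (vs @ [a, z]))\<^sup>2"
        by (cases "vs = []") (use eq form_degree[OF fg] 3 in auto)
    qed
  next
    case 4
    have Df: "Der (basis i) (f * g) = Der (basis i) f * g" if "i \<in> I" for i
    proof -
      have "i \<notin> J" using that disj by auto
      then show ?thesis by (simp add: Der_mult form_outside[OF less.prems(2)])
    qed
    have Dg: "Der (basis j) (f * g) = f * Der (basis j) g" if "j \<in> J" for j
    proof -
      have "j \<notin> I" using that disj by auto
      then show ?thesis by (simp add: Der_mult form_outside[OF less.prems(1)])
    qed
    have Dg': "Der (basis j) (h * g) = h * Der (basis j) g" if "j \<in> J" "h = Der (basis i) f" for j h i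
    proof -
      have "j \<notin> I" using that disj by auto
      then show ?thesis by (simp add: Der_mult that(2) form_outside[OF form_Der[OF less.prems(1) nonneg_basis]])
    qed
    show ?thesis
    proof (rule clc_trickle_down[OF _ fg])
      show "clc (Der (basis i) (f * g))" if "i \<in> I \<union> J" for i
      proof (cases "i \<in> I")
        case True
        then show ?thesis unfolding Df[OF True]
          using 4 less.prems by (intro less.hyps[of "m - 1" n] form_Der clc_Der nonneg_basis) auto
      next
        case False
        then have "i \<in> J" using that by simp
        then show ?thesis unfolding Dg[OF \<open>i \<in> J\<close>]
          using 4 less.prems by (intro less.hyps[of m "n - 1"] form_Der clc_Der nonneg_basis) auto
      qed
    next
      fix vs and r :: "'i \<Rightarrow> real" and i j
      assume len: "length vs + 2 = m + n" and pos: "\<And>v. v \<in> set vs \<Longrightarrow> positive v"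
        and r: "\<And>i j. i \<in> I \<union> J \<Longrightarrow> j \<in> I \<union> J \<Longrightarrow> 0 < dv (f * g) (vs @ [basis i, basis j]) \<Longrightarrow> r i = r j"
        and ij: "i \<in> I \<union> J" "j \<in> I \<union> J" "\<exists>k\<in>I \<union> J. 0 < dv (f * g) (vs @ [basis i, basis k])" "\<exists>k\<in>I \<union> J. 0 < dv (f * g) (vs @ [basis j, basis k])"
      have nn: "nonneg v" if "v \<in> set vs" for v using pos[OF that] by (rule positive_nonneg)
      have H: "r a = r b" if ab: "a \<in> I" "b \<in> J" "nonzero (Der (basis a) f)" "nonzero (Der (basis b) g)" for a b
      proof -
        obtain us where us: "\<And>u. u \<in> set us \<Longrightarrow> nonneg u" "dv (Der (basis a) f) us \<noteq> 0" using ab(3) by (auto simp: nonzero_def)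
        obtain ws where ws: "\<And>u. u \<in> set ws \<Longrightarrow> nonneg u" "dv (Der (basis b) g) ws \<noteq> 0" using ab(4) by (auto simp: nonzero_def)
        have Fa: "form I (m - 1) (Der (basis a) f)" and Gb: "form J (n - 1) (Der (basis b) g)"
          using less.prems by (auto intro!: form_Der simp del: One_nat_def)
        have lens: "length us = m - 1" "length ws = n - 1"
          using us(2) ws(2) form_degree[OF Fa] form_degree[OF Gb] by blast+
        have p1: "dv (Der (basis a) f) (take (m - 1) vs) > 0"
          by (rule form_pos[OF fin(1) Fa us(2) us(1)]) (use pos lens len 4 in \<open>auto dest: in_set_takeD\<close>)
        have p2: "dv (Der (basis b) g) (drop (m - 1) vs) > 0"
          by (rule form_pos[OF fin(2) Gb ws(2) ws(1)]) (use pos lens len 4 in \<open>auto dest: in_set_dropD\<close>)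
        have "dv (Der (basis a) f) (take (m - 1) vs) * dv (Der (basis b) g) (drop (m - 1) vs)
             \<le> dv (Der (basis a) f * Der (basis b) g) (take (m - 1) vs @ drop (m - 1) vs)"
          by (rule dv_mult_ge[OF Fa Gb]) (use nn in \<open>auto dest: in_set_takeD in_set_dropD\<close>)
        then have "0 < dv (Der (basis a) f * Der (basis b) g) vs"
          using mult_pos_pos[OF p1 p2] by simp
        also have "Der (basis a) f * Der (basis b) g = Der (basis b) (Der (basis a) (f * g))"
          by (simp add: Df[OF ab(1)] Dg'[OF ab(2) refl])
        also have "dv (Der (basis b) (Der (basis a) (f * g))) vs = dv (f * g) (vs @ [basis a, basis b])"
          using form_move[OF fg, of vs "basis a" "[basis b]"] form_move[OF fg, of "basis a # vs" "basis b" "[]"]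
            form_swap[OF fg, of "[]" "basis a" "basis b" vs] by simp
        finally show ?thesis using r that by blast
      qed
      have gf: "form (I \<union> J) (m + n) (g * f)" using fg by (simp add: mult.commute)
      have A: "nonzero (Der (basis a) f) \<and> (\<exists>b\<in>J. nonzero (Der (basis b) g))" if ab: "a \<in> I" "\<exists>k\<in>I \<union> J. 0 < dv (f * g) (vs @ [basis a, basis k])" for a
      proof -
        obtain k where "dv (f * g) (vs @ [basis a, basis k]) \<noteq> 0" using ab(2) by force
        moreover have "a \<notin> J" using ab disj by auto
        ultimately show ?thesis
          using nonzero_partials[OF less.prems(1,2) 4(2) _ nn _ fg, of a vs k] by blast
      qed
      have B: "nonzero (Der (basis b) g) \<and> (\<exists>a\<in>I. nonzero (Der (basis a) f))" if ab: "b \<in> J" "\<exists>k\<in>I \<union> J. 0 < dv (f * g) (vs @ [basis b, basis k])" for b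
      proof -
        obtain k where "dv (g * f) (vs @ [basis b, basis k]) \<noteq> 0" using ab(2) by (force simp: mult.commute)
        moreover have "b \<notin> I" using ab disj by auto
        ultimately show ?thesis
          using nonzero_partials[OF less.prems(2,1) 4(1) _ nn _ gf, of b vs k] by blast
      qed
      from ij show "r i = r j"
      proof (elim UnE)
        assume "i \<in> I" "j \<in> I"
        then obtain b where "b \<in> J" "nonzero (Der (basis b) g)" "nonzero (Der (basis i) f)" "nonzero (Der (basis j) f)"
          using A[of i] A[of j] ij by blast
        then have "r i = r b" "r j = r b" using H \<open>i \<in> I\<close> \<open>j \<in> I\<close> by blast+
        then show ?thesis by simp
      next
        assume "i \<in> J" "j \<in> J"
        then obtain a where "a \<in> I" "nonzero (Der (basis a) f)" "nonzero (Der (basis i) g)" "nonzero (Der (basis j) g)"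
          using B[of i] B[of j] ij by blast
        then have "r a = r i" "r a = r j" using H \<open>i \<in> J\<close> \<open>j \<in> J\<close> by blast+
        then show ?thesis by simp
      next
        assume "i \<in> I" "j \<in> J"
        then show ?thesis using A[of i] B[of j] H ij by blast
      next
        assume "i \<in> J" "j \<in> I"
        then show ?thesis using A[of j] B[of i] H[of j i] ij by auto
      qed
    qed (use fin 4 in auto)
  qed
qed

definition clc_form :: "'i set \<Rightarrow> nat \<Rightarrow> 'i polar \<Rightarrow> bool" where
  "clc_form I n f \<longleftrightarrow> form I n f \<and> clc f"

lemma form_pull_inj:
  assumes f: "form I n f" and h: "inj_on h I"
  shows "form (h ` I) n (pull (\<lambda>v. v \<circ> h) f)"
proof (rule formI)
  show "length vs = n" if "dv (pull (\<lambda>v. v \<circ> h) f) vs \<noteq> 0" for vs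
    using form_degree[OF f, of "map (\<lambda>v. v \<circ> h) vs"] that by auto
  show "dv (pull (\<lambda>v. v \<circ> h) f) (us @ v # w # ws) = dv (pull (\<lambda>v. v \<circ> h) f) (us @ w # v # ws)" for us v w ws
    using form_swap[OF f, of "map (\<lambda>v. v \<circ> h) us" "v \<circ> h" "w \<circ> h" "map (\<lambda>v. v \<circ> h) ws"] by simp
  show "0 \<le> dv (pull (\<lambda>v. v \<circ> h) f) vs" if "\<And>v. v \<in> set vs \<Longrightarrow> nonneg v" for vs
  proof -
    have "0 \<le> dv f (map (\<lambda>v. v \<circ> h) vs)"
      by (rule form_nonneg[OF f]) (use that in \<open>auto simp: nonneg_def\<close>)
    then show ?thesis by simp
  qed
  show "dv (pull (\<lambda>v. v \<circ> h) f) (us @ v # ws) = (\<Sum>i\<in>h ` I. v i * dv (pull (\<lambda>v. v \<circ> h) f) (us @ basis i # ws))" for us v ws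
  proof -
    have eq: "dv f (map (\<lambda>v. v \<circ> h) us @ (basis (h i) \<circ> h) # map (\<lambda>v. v \<circ> h) ws) = dv f (map (\<lambda>v. v \<circ> h) us @ basis i # map (\<lambda>v. v \<circ> h) ws)"
      if "i \<in> I" for i
    proof -
      have "(\<Sum>j\<in>I. (basis (h i) \<circ> h) j * dv f (map (\<lambda>v. v \<circ> h) us @ basis j # map (\<lambda>v. v \<circ> h) ws)) =
          (\<Sum>j\<in>I. basis i j * dv f (map (\<lambda>v. v \<circ> h) us @ basis j # map (\<lambda>v. v \<circ> h) ws))"
        using that h by (intro sum.cong) (auto simp: basis_def inj_on_eq_iff)
      then show ?thesis
        using form_linear[OF f, of "map (\<lambda>v. v \<circ> h) us" "basis (h i) \<circ> h" "map (\<lambda>v. v \<circ> h) ws"]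
          form_linear[OF f, of "map (\<lambda>v. v \<circ> h) us" "basis i" "map (\<lambda>v. v \<circ> h) ws"] by simp
    qed
    show ?thesis
      using form_linear[OF f, of "map (\<lambda>v. v \<circ> h) us" "v \<circ> h" "map (\<lambda>v. v \<circ> h) ws"] h
      by (simp add: sum.reindex eq)
  qed
qed

lemma clc_pull:
  fixes A :: "('j \<Rightarrow> real) \<Rightarrow> 'i \<Rightarrow> real"
  assumes f: "clc f" and A: "\<And>v. nonneg v \<Longrightarrow> nonneg (A v)" shows "clc (pull A f)"
proof (rule clcI)
  fix vs :: "('j \<Rightarrow> real) list" and a z :: "'j \<Rightarrow> real"
  assume "\<And>v. v \<in> set vs \<Longrightarrow> nonneg v" "nonneg a"
  then show "dv (pull A f) (vs @ [a, a]) * dv (pull A f) (vs @ [z, z]) \<le> (dv (pull A f) (vs @ [a, z]))\<^sup>2"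
    using clcD[OF f, of "map A vs" "A a" "A z"] A by auto
qed

text \<open>The general product is obtained from a product in separate copies of the variables by identifying
  the copies.\<close>

lemma clc_mult:
  fixes f g :: "'a polar"
  assumes fin: "finite I" and f: "form I m f" "clc f" and g: "form I n g" "clc g"
  shows "clc (f * g)"
proof -
  define L :: "('a + 'a \<Rightarrow> real) \<Rightarrow> 'a \<Rightarrow> real" where "L = (\<lambda>v. v \<circ> Inl)"
  define R :: "('a + 'a \<Rightarrow> real) \<Rightarrow> 'a \<Rightarrow> real" where "R = (\<lambda>v. v \<circ> Inr)"
  define A :: "('a \<Rightarrow> real) \<Rightarrow> 'a + 'a \<Rightarrow> real" where "A = (\<lambda>v. case_sum v v)"
  have "clc (pull L f * pull R g)"
  proof (rule clc_mult_disjoint)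
    show "form (Inl ` I) m (pull L f)" unfolding L_def by (rule form_pull_inj[OF f(1)]) simp
    show "form (Inr ` I) n (pull R g)" unfolding R_def by (rule form_pull_inj[OF g(1)]) simp
    show "clc (pull L f)" "clc (pull R g)"
      by (intro clc_pull f g; simp add: L_def R_def nonneg_def)+
  qed (use fin in auto)
  then have "clc (pull A (pull L f * pull R g))"
    by (rule clc_pull) (auto simp: A_def nonneg_def split: sum.split)
  also have "pull A (pull L f * pull R g) = f * g"
  proof -
    have "L (A v) = v" "R (A v) = v" for v by (auto simp: L_def R_def A_def fun_eq_iff)
    then have "pull A (pull L f) = f" "pull A (pull R g) = g"
      by (intro dv_eqI; simp add: comp_def)+
    then show ?thesis by (simp add: pull_mult)
  qed
  finally show ?thesis .
qed

lemma clc_form_mult: "finite I \<Longrightarrow> clc_form I m f \<Longrightarrow> clc_form I n g \<Longrightarrow> clc_form I (m + n) (f * g)"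
  unfolding clc_form_def by (auto intro: form_mult clc_mult)

lemma clc_form_1: "clc_form I 0 1"
  unfolding clc_form_def by (auto intro: form_1 clc_low_degree)

lemma clc_form_linear: "form I 1 f \<Longrightarrow> clc_form I 1 f"
  unfolding clc_form_def by (auto intro: clc_low_degree)

lemma clc_form_power: "finite I \<Longrightarrow> form I 1 f \<Longrightarrow> clc_form I k (f ^ k)"
proof (induction k)
  case (Suc k)
  then show ?case using clc_form_mult[OF _ clc_form_linear Suc.IH, of f] by simp
qed (simp add: clc_form_1)

lemma clc_form_prod:
  assumes "finite I" "finite A" "\<And>a. a \<in> A \<Longrightarrow> clc_form I (n a) (f a)"
  shows "clc_form I (\<Sum>a\<in>A. n a) (\<Prod>a\<in>A. f a)"
  using assms(2,3) by (induction A rule: finite_induct) (auto intro: clc_form_mult clc_form_1 assms(1))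

section \<open>Limits of the quadratic forms at a vertex\<close>

lemma psd_2:
  fixes \<alpha> \<beta> \<gamma> X s :: real
  assumes "\<alpha> > 0" "\<alpha> * \<gamma> \<ge> \<beta>\<^sup>2"
  shows "\<alpha> * X\<^sup>2 + 2 * \<beta> * X * s + \<gamma> * s\<^sup>2 \<ge> 0"
proof -
  have "\<alpha> * (\<alpha> * X\<^sup>2 + 2 * \<beta> * X * s + \<gamma> * s\<^sup>2) = (\<alpha> * X + \<beta> * s)\<^sup>2 + (\<alpha> * \<gamma> - \<beta>\<^sup>2) * s\<^sup>2"
    by (simp add: power2_eq_square algebra_simps)
  also have "\<dots> \<ge> 0" using assms(2) by simp
  finally show ?thesis using assms(1) by (simp add: zero_le_mult_iff)
qed

text \<open>The factors \<open>1 + 1 / (k + p)\<close> come from the factorials in second derivatives of monomials whose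
  exponents grow with \<open>k\<close>. In the limit they disappear, so a strict inequality between the remaining
  constants suffices; in the degenerate first case the form is a square for every \<open>k\<close>.\<close>

lemma eventually_psd:
  fixes Fm F0 Fp Gm Gp W \<delta> :: real
  assumes "(Fp = 0 \<and> Gp = 0 \<and> W = 0) \<or>
    (F0\<^sup>2 - Fp * Fm > 0 \<and> (F0\<^sup>2 - Fp * Fm) * (Gm\<^sup>2 - Fm * W * \<delta>) > (F0 * Gm - Fm * Gp)\<^sup>2)"
  shows "\<forall>\<^sub>F k in sequentially. \<forall>X s.
     (F0\<^sup>2 - (1 + 1 / real (k + p)) * (1 + 1 / real (k + q)) * (Fp * Fm)) * X\<^sup>2
     + 2 * (F0 * Gm - (1 + 1 / real (k + q)) * (Fm * Gp)) * X * s
     + (Gm\<^sup>2 - (1 + 1 / real (k + q)) * (Fm * W * \<delta>)) * s\<^sup>2 \<ge> 0"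
  using assms
proof
  assume z: "Fp = 0 \<and> Gp = 0 \<and> W = 0"
  have "F0\<^sup>2 * X\<^sup>2 + 2 * (F0 * Gm) * X * s + Gm\<^sup>2 * s\<^sup>2 = (F0 * X + Gm * s)\<^sup>2" for X s
    by (simp add: power2_eq_square algebra_simps)
  then show ?thesis using z by simp
next
  assume s: "F0\<^sup>2 - Fp * Fm > 0 \<and> (F0\<^sup>2 - Fp * Fm) * (Gm\<^sup>2 - Fm * W * \<delta>) > (F0 * Gm - Fm * Gp)\<^sup>2"
  have l: "(\<lambda>k. 1 + 1 / real (k + j)) \<longlonglongrightarrow> 1" for j
  proof -
    have "(\<lambda>k. 1 + 1 / real (k + j)) \<longlonglongrightarrow> 1 + 0"
      using LIMSEQ_ignore_initial_segment[OF lim_1_over_n, of j] by (intro tendsto_intros) simp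
    then show ?thesis by simp
  qed
  define \<alpha> where "\<alpha> k = F0\<^sup>2 - (1 + 1 / real (k + p)) * (1 + 1 / real (k + q)) * (Fp * Fm)" for k
  define \<beta> where "\<beta> k = F0 * Gm - (1 + 1 / real (k + q)) * (Fm * Gp)" for k
  define \<gamma> where "\<gamma> k = Gm\<^sup>2 - (1 + 1 / real (k + q)) * (Fm * W * \<delta>)" for k
  have "\<alpha> \<longlonglongrightarrow> F0\<^sup>2 - 1 * 1 * (Fp * Fm)" "\<beta> \<longlonglongrightarrow> F0 * Gm - 1 * (Fm * Gp)" "\<gamma> \<longlonglongrightarrow> Gm\<^sup>2 - 1 * (Fm * W * \<delta>)"
    unfolding \<alpha>_def \<beta>_def \<gamma>_def by (intro tendsto_intros l)+
  then have lims: "\<alpha> \<longlonglongrightarrow> F0\<^sup>2 - Fp * Fm" "(\<lambda>k. \<alpha> k * \<gamma> k - (\<beta> k)\<^sup>2) \<longlonglongrightarrow> (F0\<^sup>2 - Fp * Fm) * (Gm\<^sup>2 - Fm * W * \<delta>) - (F0 * Gm - Fm * Gp)\<^sup>2"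
    by (auto intro!: tendsto_intros)
  have "\<forall>\<^sub>F k in sequentially. 0 < \<alpha> k" "\<forall>\<^sub>F k in sequentially. 0 < \<alpha> k * \<gamma> k - (\<beta> k)\<^sup>2"
    using order_tendstoD(1)[OF lims(1), of 0] order_tendstoD(1)[OF lims(2), of 0] s by auto
  then have "\<forall>\<^sub>F k in sequentially. \<forall>X s. \<alpha> k * X\<^sup>2 + 2 * \<beta> k * X * s + \<gamma> k * s\<^sup>2 \<ge> 0"
    by eventually_elim (intro allI psd_2; simp)
  then show ?thesis by (simp only: \<alpha>_def \<beta>_def \<gamma>_def)
qed

lemma real_choose_2: "real (n choose 2) = real n * (real n - 1) / 2"
proof (induction n)
  case (Suc n)
  then show ?case by (simp add: numeral_2_eq_2 field_simps)
qed simp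

lemma real_choose_3: "real (n choose 3) = real n * (real n - 1) * (real n - 2) / 6"
proof (induction n)
  case (Suc n)
  have "Suc n choose 3 = (n choose 2) + (n choose 3)" by (simp add: numeral_3_eq_3 numeral_2_eq_2)
  then show ?case using Suc real_choose_2[of n] by (simp add: field_simps)
qed simp

lemma real_choose_4: "real (n choose 4) = real n * (real n - 1) * (real n - 2) * (real n - 3) / 24"
proof (induction n)
  case (Suc n)
  have "Suc n choose 4 = (n choose 3) + (n choose 4)" by (simp add: eval_nat_numeral)
  then show ?case using Suc real_choose_3[of n] by (simp add: field_simps)
qed simp

text \<open>The coefficients of \<open>(1 + x) ((1 + x)\<^sup>d + x)\<close>.\<close>

definition vertex_coeff :: "nat \<Rightarrow> nat \<Rightarrow> real" where
  "vertex_coeff d j = real (Suc d choose j) + (if j = 0 then 0 else real (1 choose (j - 1)))"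

text \<open>What \<open>pivot_y\<close> demands of the second derivative of the vertex form when \<open>p\<close> factors \<open>x\<close> beyond \<open>x\<^sup>k\<close> and the
  complementary number of factors \<open>y\<close> are involved: \<open>X\<close> is the scaled coordinate at \<open>x\<close>, and \<open>s\<close> is the sum
  of the coordinates at the edge variables.\<close>

definition vertex_psd :: "nat \<Rightarrow> nat \<Rightarrow> nat \<Rightarrow> bool" where
  "vertex_psd d k p \<longleftrightarrow> (\<forall>X s.
     ((vertex_coeff d p)\<^sup>2 - (1 + 1 / real (k + p)) * (1 + 1 / real (k + (d + 2 - p))) * (vertex_coeff d (p + 1) * vertex_coeff d (p - 1))) * X\<^sup>2
     + 2 * (vertex_coeff d p * real (d choose (p - 1)) - (1 + 1 / real (k + (d + 2 - p))) * (vertex_coeff d (p - 1) * real (d choose p))) * X * s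
     + ((real (d choose (p - 1)))\<^sup>2 - (1 + 1 / real (k + (d + 2 - p))) * (vertex_coeff d (p - 1) * real (d - 1 choose (p - 1)) * (1 - 1 / real d))) * s\<^sup>2 \<ge> 0)"

text \<open>Only \<open>p = 1, 2, 3\<close> matter, as the summand of the vertex form with \<open>y\<^sup>d\<close> contributes to no other second
  derivative that needs a check. If \<open>d < p\<close>, the form degenerates; otherwise the limiting determinant
  is, up to a positive factor, a polynomial in \<open>d - p\<close> with positive coefficients.\<close>

lemma vertex_asymptotics:
  assumes d: "d \<ge> 1"
  shows "\<exists>k. \<forall>p\<in>{1,2,3}. vertex_psd d k p"
proof -
  have F: "vertex_coeff d 0 = 1" "vertex_coeff d 1 = real d + 2" "vertex_coeff d 2 = real d * (real d + 1) / 2 + 1"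
    "vertex_coeff d 3 = (real d + 1) * real d * (real d - 1) / 6" "vertex_coeff d 4 = (real d + 1) * real d * (real d - 1) * (real d - 2) / 24"
    by (simp_all add: vertex_coeff_def real_choose_2 real_choose_3 real_choose_4 field_simps)
  have d1: "real (d - 1) = real d - 1" using d by simp
  have G: "real (d choose 0) = 1" "real (d choose 1) = real d" "real (d choose 2) = real d * (real d - 1) / 2"
    "real (d choose 3) = real d * (real d - 1) * (real d - 2) / 6"
    "real (d - 1 choose 0) = 1" "real (d - 1 choose 1) = real d - 1"
    "real (d - 1 choose 2) = (real d - 1) * (real d - 2) / 2"
    using d1 by (simp_all add: real_choose_2 real_choose_3 field_simps)
  have 1: "(vertex_coeff d 1)\<^sup>2 - vertex_coeff d 2 * vertex_coeff d 0 > 0 \<and> ((vertex_coeff d 1)\<^sup>2 - vertex_coeff d 2 * vertex_coeff d 0) * ((real (d choose 0))\<^sup>2 - vertex_coeff d 0 * real (d - 1 choose 0) * (1 - 1 / real d))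
     > (vertex_coeff d 1 * real (d choose 0) - vertex_coeff d 0 * real (d choose 1))\<^sup>2"
  proof -
    define t where "t = real d - 1"
    have t: "real d = t + 1" "t \<ge> 0" using d by (auto simp: t_def)
    have "(t + 1 + 2)\<^sup>2 - ((t + 1) * (t + 1 + 1) / 2 + 1) - 4 * (t + 1) = (t * t + t + 6) / 2"
      by (simp add: power2_eq_square field_simps)
    also have "\<dots> > 0" using t(2) by (intro divide_pos_pos add_nonneg_pos add_nonneg_nonneg mult_nonneg_nonneg) auto
    finally have pos: "(t + 1 + 2)\<^sup>2 - ((t + 1) * (t + 1 + 1) / 2 + 1) > 4 * (t + 1)" by simp
    have al: "(vertex_coeff d 1)\<^sup>2 - vertex_coeff d 2 * vertex_coeff d 0 = (t + 1 + 2)\<^sup>2 - ((t + 1) * (t + 1 + 1) / 2 + 1)"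
      unfolding F G t(1) by simp
    have be: "vertex_coeff d 1 * real (d choose 0) - vertex_coeff d 0 * real (d choose 1) = 2" unfolding F G by simp
    have ga: "(real (d choose 0))\<^sup>2 - vertex_coeff d 0 * real (d - 1 choose 0) * (1 - 1 / real d) = 1 / (t + 1)"
      unfolding F G t(1) by simp
    show ?thesis unfolding al be ga using pos t(2)
      by (auto simp: pos_less_divide_eq)
  qed
  have 2: "d = 1 \<or> ((vertex_coeff d 2)\<^sup>2 - vertex_coeff d 3 * vertex_coeff d 1 > 0 \<and> ((vertex_coeff d 2)\<^sup>2 - vertex_coeff d 3 * vertex_coeff d 1) * ((real (d choose 1))\<^sup>2 - vertex_coeff d 1 * real (d - 1 choose 1) * (1 - 1 / real d))
     > (vertex_coeff d 2 * real (d choose 1) - vertex_coeff d 1 * real (d choose 2))\<^sup>2)"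
  proof (cases "d = 1")
    case False
    define t where "t = real d - 2"
    have t: "real d = t + 2" "t \<ge> 0" using d False by (auto simp: t_def)
    define a where "a = real d"
    have a: "a > 0" using d by (simp add: a_def)
    have \<alpha>: "(vertex_coeff d 2)\<^sup>2 - vertex_coeff d 3 * vertex_coeff d 1 = (a^4 + 2*a^3 + 17*a^2 + 16*a + 12) / 12"
      unfolding F a_def by (simp add: field_simps power2_eq_square power3_eq_cube power4_eq_xxxx)
    have \<beta>: "vertex_coeff d 2 * real (d choose 1) - vertex_coeff d 1 * real (d choose 2) = 2 * a"
      unfolding F G a_def by (simp add: field_simps power2_eq_square)
    have \<gamma>: "(real (d choose 1))\<^sup>2 - vertex_coeff d 1 * real (d - 1 choose 1) * (1 - 1 / real d) = (3 * a - 2) / a"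
      unfolding F G using a by (simp add: a_def[symmetric] field_simps power2_eq_square)
    have "(a^4 + 2*a^3 + 17*a^2 + 16*a + 12) * (3 * a - 2) - 48 * a^3 = 3*t^5 + 34*t^4 + 151*t^3 + 344*t^2 + 416*t + 192"
      using t(1) by (simp add: a_def eval_nat_numeral algebra_simps)
    also have "\<dots> > 0" using t(2) by (intro add_nonneg_pos add_nonneg_nonneg mult_nonneg_nonneg zero_le_power) auto
    finally have "(a^4 + 2*a^3 + 17*a^2 + 16*a + 12) * (3 * a - 2) > 48 * a^3" by simp
    then have "(a^4 + 2*a^3 + 17*a^2 + 16*a + 12) / 12 * ((3 * a - 2) / a) > (2 * a)\<^sup>2"
      using a by (simp add: field_simps power2_eq_square power3_eq_cube)
    moreover have "(a^4 + 2*a^3 + 17*a^2 + 16*a + 12) / 12 > 0" using a by (simp add: add_pos_pos)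
    ultimately show ?thesis unfolding \<alpha> \<beta> \<gamma> by simp
  qed simp
  have 3: "d = 1 \<or> d = 2 \<or> ((vertex_coeff d 3)\<^sup>2 - vertex_coeff d 4 * vertex_coeff d 2 > 0 \<and> ((vertex_coeff d 3)\<^sup>2 - vertex_coeff d 4 * vertex_coeff d 2) * ((real (d choose 2))\<^sup>2 - vertex_coeff d 2 * real (d - 1 choose 2) * (1 - 1 / real d))
     > (vertex_coeff d 3 * real (d choose 2) - vertex_coeff d 2 * real (d choose 3))\<^sup>2)"
  proof (cases "d = 1 \<or> d = 2")
    case False
    define t where "t = real d - 3"
    have t: "real d = t + 3" "t \<ge> 0" using d False by (auto simp: t_def)
    define a where "a = real d"
    have a: "a > 1" using d False by (simp add: a_def)
    have \<alpha>: "(vertex_coeff d 3)\<^sup>2 - vertex_coeff d 4 * vertex_coeff d 2 = (a + 1) * a * (a - 1) * (a^3 + 3*a^2 - 4*a + 12) / 144"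
      unfolding F a_def by (simp add: field_simps eval_nat_numeral)
    have \<beta>: "vertex_coeff d 3 * real (d choose 2) - vertex_coeff d 2 * real (d choose 3) = a * (a - 1) * (a^2 - a + 4) / 12"
      unfolding F G a_def by (simp add: field_simps eval_nat_numeral)
    have \<gamma>: "(real (d choose 2))\<^sup>2 - vertex_coeff d 2 * real (d - 1 choose 2) * (1 - 1 / real d) = (a - 1)^2 * (a^2 + 4) / (4 * a)"
      unfolding F G using a by (simp add: a_def[symmetric] field_simps eval_nat_numeral)
    have c: "a^3 + 3*a^2 - 4*a + 12 = t^3 + 12*t^2 + 41*t + 54"
      using t(1) by (simp add: a_def eval_nat_numeral algebra_simps)
    have cpos: "a^3 + 3*a^2 - 4*a + 12 > 0"
      unfolding c using t(2) by (intro add_nonneg_pos add_nonneg_nonneg mult_nonneg_nonneg zero_le_power) auto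
    have "(a^2 - 1) * (a^3 + 3*a^2 - 4*a + 12) * (a^2 + 4) - 4 * a^2 * (a^2 - a + 4)^2 =
         t^7 + 20*t^6 + 178*t^5 + 900*t^4 + 2761*t^3 + 5072*t^2 + 5068*t + 2016"
      using t(1) by (simp add: a_def eval_nat_numeral algebra_simps)
    also have "\<dots> > 0" using t(2) by (intro add_nonneg_pos add_nonneg_nonneg mult_nonneg_nonneg zero_le_power) auto
    finally have main: "(a^2 - 1) * (a^3 + 3*a^2 - 4*a + 12) * (a^2 + 4) > 4 * a^2 * (a^2 - a + 4)^2" by simp
    have "(a * (a - 1) * (a^2 - a + 4) / 12)\<^sup>2 = (a - 1)^2 / 576 * (4 * a^2 * (a^2 - a + 4)^2)"
      by (simp add: power2_eq_square)
    also have "\<dots> < (a - 1)^2 / 576 * ((a^2 - 1) * (a^3 + 3*a^2 - 4*a + 12) * (a^2 + 4))"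
      using main a by (intro mult_strict_left_mono) auto
    also have "\<dots> = (a + 1) * a * (a - 1) * (a^3 + 3*a^2 - 4*a + 12) / 144 * ((a - 1)^2 * (a^2 + 4) / (4 * a))"
      using a by (simp add: power2_eq_square field_simps)
    finally show ?thesis unfolding \<alpha> \<beta> \<gamma> using a cpos by simp
  qed blast
  have "\<forall>\<^sub>F k in sequentially. vertex_psd d k 1"
    unfolding vertex_psd_def by (rule eventually_psd) (use 1 in \<open>simp add: numeral_2_eq_2\<close>)
  moreover have "\<forall>\<^sub>F k in sequentially. vertex_psd d k 2"
  proof -
    have *: "2 + 1 = (3::nat)" "2 - 1 = (1::nat)" by auto
    have "d = 1 \<longrightarrow> vertex_coeff d 3 = 0 \<and> real (d choose 2) = 0 \<and> real (d - 1 choose 1) = 0" using F(4) G(3,6) by auto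
    with 2 show ?thesis unfolding vertex_psd_def * by (intro eventually_psd) blast
  qed
  moreover have "\<forall>\<^sub>F k in sequentially. vertex_psd d k 3"
  proof -
    have *: "3 + 1 = (4::nat)" "3 - 1 = (2::nat)" by auto
    have "d = 1 \<or> d = 2 \<longrightarrow> vertex_coeff d 4 = 0 \<and> real (d choose 3) = 0 \<and> real (d - 1 choose 2) = 0"
      using F(5) by (auto simp: binomial_eq_0)
    with 3 show ?thesis unfolding vertex_psd_def * by (intro eventually_psd) blast
  qed
  ultimately have "\<forall>\<^sub>F k in sequentially. vertex_psd d k 1 \<and> vertex_psd d k 2 \<and> vertex_psd d k 3"
    by (intro eventually_conj)
  then obtain k where "vertex_psd d k 1" "vertex_psd d k 2" "vertex_psd d k 3" using eventually_happens'[OF sequentially_bot] by blast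
  then show ?thesis by blast
qed

section \<open>The vertex form and its derivatives\<close>

lemma Der_coord: "Der v (coord i) = const (v i)"
  by (rule dv_eqI) (auto simp: dv_coord dv_const split: list.split)

lemma Der_power: "Der v (f ^ n) = of_nat n * f ^ (n - 1) * Der v f"
proof (induction n)
  case (Suc n)
  then show ?case by (cases n) (auto simp: Der_mult algebra_simps)
qed simp

lemma const_0 [simp]: "const 0 = 0" and const_1 [simp]: "const 1 = 1"
  by (rule dv_eqI; simp add: dv_const dv_1)+

lemma Der_prod_one:
  assumes "finite A" "a \<in> A" "\<And>b. b \<in> A - {a} \<Longrightarrow> Der v (f b) = 0"
  shows "Der v (prod f A) = Der v (f a) * prod f (A - {a})"
proof -
  have "Der v (prod f B) = 0" if "finite B" "\<And>b. b \<in> B \<Longrightarrow> Der v (f b) = 0" for B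
    using that by (induction B rule: finite_induct) (auto simp: Der_mult)
  then have "Der v (prod f (A - {a})) = 0" using assms by auto
  then show ?thesis by (simp add: prod.remove[OF assms(1,2)] Der_mult)
qed

lemma Der_prod_zero:
  "(\<And>b. b \<in> B \<Longrightarrow> Der v (f b) = 0) \<Longrightarrow> Der v (prod f B) = 0"
  by (induction B rule: infinite_finite_induct) (auto simp: Der_mult)

lemma dv_of_nat_mult [simp]: "dv (of_nat n * f) vs = real n * dv f vs"
  by (induction n) (auto simp: algebra_simps)

lemma form_perm:
  assumes f: "form I n f"
  shows "mset us = mset vs \<Longrightarrow> dv f (ws @ us) = dv f (ws @ vs)"
proof (induction us arbitrary: vs ws)
  case (Cons u us)
  then have "u \<in> set vs" by (metis list.set_intros(1) set_mset_mset)
  then obtain p q where vs: "vs = p @ u # q" by (meson split_list)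
  have "dv f (ws @ u # us) = dv f ((ws @ [u]) @ (p @ q))"
    using Cons.IH[of "p @ q" "ws @ [u]"] Cons.prems vs by simp
  also have "\<dots> = dv f (ws @ vs)"
    using form_move[OF f, of ws u "p @ q"] form_move[OF f, of "ws @ p" u q] by (simp add: vs)
  finally show ?case .
qed simp

abbreviation word2 :: "'i \<Rightarrow> 'i \<Rightarrow> nat \<Rightarrow> nat \<Rightarrow> ('i \<Rightarrow> real) list" where
  "word2 x y a b \<equiv> replicate a (basis x) @ replicate b (basis y)"

lemma dv_word2_monomial:
  assumes "x \<noteq> y"
  shows "dv (coord x ^ i * coord y ^ j) (word2 x y a b) = (if a = i \<and> b = j then fact a * fact b else 0)"
proof (induction a arbitrary: i)
  case 0
  show ?case
  proof (induction b arbitrary: j)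
    case 0
    show ?case by (cases i; cases j) (auto simp: dv_coord dv_1)
  next
    case (Suc b)
    have "Der (basis y) (coord x ^ i * coord y ^ j) = of_nat j * (coord x ^ i * coord y ^ (j - 1))"
      using assms by (simp add: Der_mult Der_power Der_coord basis_def)
    then have "dv (coord x ^ i * coord y ^ j) (word2 x y 0 (Suc b)) = real j * dv (coord x ^ i * coord y ^ (j - 1)) (word2 x y 0 b)"
      using dv_Der[of "basis y" "coord x ^ i * coord y ^ j" "word2 x y 0 b"] by simp
    then show ?case using Suc.IH[of "j - 1"] by (cases j) auto
  qed
next
  case (Suc a)
  have "Der (basis x) (coord x ^ i * coord y ^ j) = of_nat i * (coord x ^ (i - 1) * coord y ^ j)"
    using assms by (simp add: Der_mult Der_power Der_coord basis_def)
  then have "dv (coord x ^ i * coord y ^ j) (word2 x y (Suc a) b) = real i * dv (coord x ^ (i - 1) * coord y ^ j) (word2 x y a b)"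
    using dv_Der[of "basis x" "coord x ^ i * coord y ^ j" "word2 x y a b"] by simp
  then show ?case using Suc.IH[of "i - 1"] by (cases i) auto
qed

text \<open>The value at \<open>a\<close> copies of one and \<open>b\<close> copies of another basis direction is \<open>a! b!\<close> times the coefficient
  of the monomial with exponents \<open>a\<close> and \<open>b\<close>.\<close>

lemma dv_word2_binomial:
  assumes "x \<noteq> y"
  shows "dv (coord x ^ i * coord y ^ j * (coord x + coord y) ^ m) (word2 x y a b) =
    (if i \<le> a \<and> j \<le> b \<and> a + b = i + j + m then fact a * fact b * real (m choose (a - i)) else 0)"
proof (induction m arbitrary: i j)
  case 0
  show ?case using dv_word2_monomial[OF assms, of i j a b] by (cases "a = i"; cases "b = j") auto
next
  case (Suc m)
  have "coord x ^ i * coord y ^ j * (coord x + coord y) ^ Suc m =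
     coord x ^ Suc i * coord y ^ j * (coord x + coord y) ^ m + coord x ^ i * coord y ^ Suc j * (coord x + coord y) ^ m"
    by (simp add: algebra_simps)
  then have eq: "dv (coord x ^ i * coord y ^ j * (coord x + coord y) ^ Suc m) (word2 x y a b) =
     (if Suc i \<le> a \<and> j \<le> b \<and> a + b = Suc i + j + m then fact a * fact b * real (m choose (a - Suc i)) else 0)
     + (if i \<le> a \<and> Suc j \<le> b \<and> a + b = i + Suc j + m then fact a * fact b * real (m choose (a - i)) else 0)"
    by (simp only: dv_add Suc.IH)
  show ?case
  proof (cases "i \<le> a \<and> j \<le> b \<and> a + b = i + j + Suc m")
    case True
    consider "a = i" | r where "a = i + Suc r" using True by (metis add_Suc_right le_Suc_ex not0_implies_Suc add_0_right)
    then show ?thesis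
    proof cases
      case 1
      then show ?thesis using True eq by auto
    next
      case 2
      have z: "m choose Suc r = 0" if "\<not> Suc j \<le> b" using that True 2 by (intro binomial_eq_0) auto
      have "fact a * fact b * real (Suc m choose Suc r) = fact a * fact b * real (m choose r) + fact a * fact b * real (m choose Suc r)"
        by (simp only: binomial_Suc_Suc of_nat_add distrib_left)
      then show ?thesis unfolding eq using True 2 z by (cases "Suc j \<le> b") simp_all
    qed
  next
    case False
    then show ?thesis using eq by auto
  qed
qed

lemma clc_degree_2:
  fixes f :: "'i polar"
  assumes f: "form I 2 f"
    and *: "\<And>a z. nonneg a \<Longrightarrow> dv f [a, a] * dv f [z, z] \<le> (dv f [a, z])\<^sup>2"
  shows "clc f"
proof (rule clcI)
  fix vs :: "('i \<Rightarrow> real) list" and a z :: "'i \<Rightarrow> real" assume "nonneg a"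
  then show "dv f (vs @ [a, a]) * dv f (vs @ [z, z]) \<le> (dv f (vs @ [a, z]))\<^sup>2"
    using * by (cases "vs = []") (auto simp: form_degree[OF f])
qed

lemma Ders_mult_killed: "(\<And>v. v \<in> set vs \<Longrightarrow> Der v g = 0) \<Longrightarrow> Ders vs (g * h) = g * Ders vs h"
  by (induction vs arbitrary: h) (auto simp: Der_mult)

lemma Ders_append: "Ders (us @ vs) f = Ders vs (Ders us f)"
  by (simp add: Ders_def)

text \<open>One factor \<open>x + y\<close> is kept with the vertex form: without it, the case of two edges fails by
  correction terms of order \<open>1 / k\<close>. The form is \<open>q E + g\<close>, where \<open>q E\<close> is a product of linear forms and
  \<open>g\<close> involves no edge variables.\<close>

locale vertex_form =
  fixes x y :: 'i and E :: "'i set" and k :: nat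
  assumes xy: "x \<noteq> y" and fin: "finite E" and xE: "x \<notin> E" and yE: "y \<notin> E" and d1: "card E \<ge> 1"
begin

abbreviation "d \<equiv> card E"
abbreviation "I \<equiv> insert x (insert y E)"
abbreviation "S \<equiv> coord x + coord y"

definition q :: "'i set \<Rightarrow> 'i polar" where
  "q A = coord x ^ k * coord y ^ (k + 1) * S * (\<Prod>t\<in>A. coord t + S)"

definition g where "g = coord x ^ (k + 1) * coord y ^ (k + d) * S"

definition \<sigma> where "\<sigma> = q E + g"

lemma finI: "finite I" using fin by simp

lemma forms: "form I 1 (coord x)" "form I 1 (coord y)" "form I 1 S" "t \<in> E \<Longrightarrow> form I 1 (coord t + S)"
  using finI by (auto intro!: form_add form_coord simp del: One_nat_def)

lemma clc_form_q:
  assumes "A \<subseteq> E" shows "clc_form I (2 * k + 2 + card A) (q A)"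
proof -
  have "clc_form I (k + (k + 1) + 1 + (\<Sum>t\<in>A. 1)) (q A)"
    unfolding q_def using assms finite_subset[OF assms fin] forms
    by (intro clc_form_mult clc_form_power clc_form_linear clc_form_prod finI) auto
  moreover have "k + (k + 1) + 1 + (\<Sum>t\<in>A. 1) = 2 * k + 2 + card A" by simp
  ultimately show ?thesis by metis
qed

lemma form_g: "form I (2 * k + 2 + d) g"
proof -
  have "clc_form I ((k + 1) + (k + d) + 1) g"
    unfolding g_def using forms by (intro clc_form_mult clc_form_power clc_form_linear finI) auto
  moreover have "(k + 1) + (k + d) + 1 = 2 * k + 2 + d" by simp
  ultimately show ?thesis unfolding clc_form_def by metis
qed

lemma form_\<sigma>: "form I (2 * k + 2 + d) \<sigma>"
  unfolding \<sigma>_def using clc_form_q[of E] form_g by (intro form_add) (auto simp: clc_form_def)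

lemma Der_q: "t \<in> E \<Longrightarrow> A \<subseteq> E \<Longrightarrow> Der (basis t) (q A) = (if t \<in> A then q (A - {t}) else 0)"
proof -
  assume t: "t \<in> E" and A: "A \<subseteq> E"
  have fA: "finite A" using A fin finite_subset by blast
  have xyt: "basis t x = 0" "basis t y = 0" using t xE yE by (auto simp: basis_def)
  have "Der (basis t) (\<Prod>s\<in>A. coord s + S) = (if t \<in> A then \<Prod>s\<in>A-{t}. coord s + S else 0)"
  proof (cases "t \<in> A")
    case True
    have "Der (basis t) (\<Prod>s\<in>A. coord s + S) = Der (basis t) (coord t + S) * (\<Prod>s\<in>A-{t}. coord s + S)"
      by (rule Der_prod_one[OF fA True]) (auto simp: Der_coord xyt, simp add: basis_def)
    then show ?thesis using True by (simp add: Der_coord xyt) (simp add: basis_def)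
  next
    case False
    then show ?thesis by (auto intro!: Der_prod_zero simp: Der_coord xyt) (auto simp: basis_def)
  qed
  then show ?thesis by (auto simp: q_def Der_mult Der_power Der_coord xyt)
qed

lemma Der_g: "t \<in> E \<Longrightarrow> Der (basis t) g = 0"
proof -
  assume t: "t \<in> E"
  have "basis t x = 0" "basis t y = 0" using t xE yE by (auto simp: basis_def)
  then show ?thesis by (simp add: g_def Der_mult Der_power Der_coord)
qed

lemma Der_\<sigma>: "t \<in> E \<Longrightarrow> Der (basis t) \<sigma> = q (E - {t})"
  by (simp add: \<sigma>_def Der_q Der_g)

lemma word2_q:
  assumes "A \<subseteq> E"
  shows "dv (q A) (word2 x y a b) =
    (if k \<le> a \<and> k + 1 \<le> b \<and> a + b = 2 * k + 2 + card A then fact a * fact b * real (Suc (card A) choose (a - k)) else 0)"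
proof -
  define \<pi> :: "('i \<Rightarrow> real) \<Rightarrow> 'i \<Rightarrow> real" where "\<pi> v = (\<lambda>i. if i \<in> {x, y} then v i else 0)" for v
  have pc: "pull \<pi> (coord i) = (if i \<in> {x, y} then coord i else 0)" for i
    by (rule dv_eqI) (auto simp: dv_coord \<pi>_def split: list.split)
  have "pull \<pi> (\<Prod>t\<in>A. coord t + S) = (\<Prod>t\<in>A. S)"
    unfolding pull_prod using assms xE yE by (intro prod.cong) (auto simp: pull_add pc)
  then have "pull \<pi> (q A) = coord x ^ k * coord y ^ (k + 1) * S ^ Suc (card A)"
    unfolding q_def by (simp add: pull_mult pull_power pull_add pc algebra_simps)
  moreover have "map \<pi> (word2 x y a b) = word2 x y a b"
    by (auto simp: \<pi>_def basis_def fun_eq_iff)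
  ultimately have "dv (q A) (word2 x y a b) = dv (coord x ^ k * coord y ^ (k + 1) * S ^ Suc (card A)) (word2 x y a b)"
    using dv_pull[of \<pi> "q A" "word2 x y a b"] by metis
  then show ?thesis using dv_word2_binomial[OF xy, of k "k + 1" "Suc (card A)" a b]
    by (simp add: algebra_simps mult_2 cong: if_cong)
qed

lemma word2_g: "dv g (word2 x y a b) =
    (if k + 1 \<le> a \<and> k + d \<le> b \<and> a + b = 2 * k + 2 + d then fact a * fact b * real (1 choose (a - (k + 1))) else 0)"
  using dv_word2_binomial[OF xy, of "k + 1" "k + d" 1 a b] by (simp add: g_def)

lemma word2_\<sigma>: "dv \<sigma> (word2 x y a b) =
    (if k \<le> a \<and> a + b = 2 * k + 2 + d then fact a * fact b * vertex_coeff d (a - k) else 0)"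
proof -
  have b: "real (1 choose (a - (k + 1))) = 0" if "k + 1 \<le> a" "\<not> k + d \<le> b" "a + b = 2 * k + 2 + d"
  proof -
    have "a - (k + 1) > 1" using that by auto
    then show ?thesis by (simp add: binomial_eq_0)
  qed
  have c: "real (Suc d choose (a - k)) = 0" if "k \<le> a" "\<not> k + 1 \<le> b" "a + b = 2 * k + 2 + d"
  proof -
    have "a - k > Suc d" using that by auto
    then show ?thesis by (simp add: binomial_eq_0)
  qed
  show ?thesis
    unfolding \<sigma>_def dv_add word2_q[OF order_refl] word2_g vertex_coeff_def using b c by (auto simp: distrib_left binomial_eq_0)
qed

definition sigma_deriv :: "nat \<Rightarrow> nat \<Rightarrow> 'i polar" where "sigma_deriv a b = Ders (word2 x y a b) \<sigma>"

lemma dv_sigma_deriv: "dv (sigma_deriv a b) vs = dv \<sigma> (word2 x y a b @ vs)"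
  by (simp add: sigma_deriv_def dv_Ders)

lemma form_sigma_deriv: "form I (2 * k + 2 + d - (a + b)) (sigma_deriv a b)"
proof -
  have "form I (2 * k + 2 + d - length (word2 x y a b)) (sigma_deriv a b)"
    unfolding sigma_deriv_def by (rule form_Ders[OF form_\<sigma>]) auto
  then show ?thesis by simp
qed

lemma Der_sigma_deriv_x: "Der (basis x) (sigma_deriv a b) = sigma_deriv (Suc a) b"
  unfolding sigma_deriv_def by (simp add: form_Der_Ders[OF form_\<sigma>])

lemma Der_sigma_deriv_y: "Der (basis y) (sigma_deriv a b) = sigma_deriv a (Suc b)"
proof -
  have "word2 x y a (Suc b) = word2 x y a b @ [basis y]" by (simp add: replicate_append_same)
  then show ?thesis unfolding sigma_deriv_def by (simp add: Ders_append)
qed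

lemma Der_sigma_deriv_t: "t \<in> E \<Longrightarrow> Der (basis t) (sigma_deriv a b) = Ders (word2 x y a b) (q (E - {t}))"
  unfolding sigma_deriv_def by (simp add: form_Der_Ders[OF form_\<sigma>] Der_\<sigma>)

lemma word2_pos_\<sigma>: "k \<le> A \<Longrightarrow> k + 1 \<le> B \<Longrightarrow> A + B = 2 * k + 2 + d \<Longrightarrow> dv \<sigma> (word2 x y A B) > 0"
proof -
  assume *: "k \<le> A" "k + 1 \<le> B" "A + B = 2 * k + 2 + d"
  have "Suc d choose (A - k) > 0" using * by (intro zero_less_binomial) auto
  then have "vertex_coeff d (A - k) > 0" by (auto simp: vertex_coeff_def intro!: add_pos_nonneg)
  then show ?thesis unfolding word2_\<sigma> using * by simp
qed

text \<open>If so many derivatives in one of the directions \<open>x\<close>, \<open>y\<close> are taken that only a power of the other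
  variable can survive, the Hessian need not be connected, but the form is a multiple of such a power.\<close>

lemma clc_sigma_deriv_degenerate:
  assumes "a + b + 3 \<le> 2 * k + 2 + d" "max a k + max b (k + 1) \<ge> 2 * k + 2 + d"
  shows "clc (sigma_deriv a b)"
proof -
  have const: "F = const (dv F [])" if "form I 0 F" for F
    by (rule dv_eqI) (use form_degree[OF that] in \<open>auto simp: dv_const\<close>)
  have "clc (coord x ^ k)" "clc (coord y ^ (k + 1))"
    using clc_form_power[OF finI forms(1), of k] clc_form_power[OF finI forms(2), of "k + 1"] unfolding clc_form_def by blast+
  then have cc: "clc (coord x ^ k * const c)" "clc (coord y ^ (k + 1) * const c)" for c
    using clc_const_mult mult.commute by metis+
  have P: "clc_form I d (\<Prod>t\<in>E. coord t + S)"
    using clc_form_prod[OF finI fin, of "\<lambda>_. 1" "\<lambda>t. coord t + S"] clc_form_linear[OF forms(4)] by simp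
  consider "a \<ge> k + d + 1" "b \<le> k + 1" | "b \<ge> k + d + 2" "a \<le> k" using assms d1 by (auto simp: max_def split: if_splits)
  then show ?thesis
  proof cases
    case 1
    define h where "h = coord x ^ k * S * (\<Prod>t\<in>E. coord t + S) + coord x ^ (k + 1) * coord y ^ (d - 1) * S"
    have "form I (k + d + 1) h"
    proof -
      have "form I (k + 1 + d) (coord x ^ k * S * (\<Prod>t\<in>E. coord t + S))"
        using clc_form_mult[OF finI clc_form_mult[OF finI clc_form_power[OF finI forms(1)] clc_form_linear[OF forms(3)]] P, of k] by (simp add: clc_form_def)
      moreover have "form I ((k + 1) + (d - 1) + 1) (coord x ^ (k + 1) * coord y ^ (d - 1) * S)"
        using clc_form_mult[OF finI clc_form_mult[OF finI clc_form_power[OF finI forms(1)] clc_form_power[OF finI forms(2)]] clc_form_linear[OF forms(3)], of "k + 1" "d - 1"] by (simp add: clc_form_def)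
      ultimately show ?thesis unfolding h_def using d1 by (intro form_add) (simp_all add: add.commute add.left_commute)
    qed
    then have "form I (k + d + 1 - length (replicate a (basis x))) (Ders (replicate a (basis x)) h)" by (rule form_Ders) auto
    then have c: "Ders (replicate a (basis x)) h = const (dv (Ders (replicate a (basis x)) h) [])" using 1 by (intro const) simp
    have "coord y ^ (k + d) = coord y ^ (k + 1) * coord y ^ (d - 1)" unfolding power_add[symmetric] using d1 by (intro arg_cong2[where f="(^)"]) auto
    moreover have "u * v * s * P + u' * (v * w) * s = v * (u * s * P + u' * w * s)" for u v w u' s P :: "'i polar"
      by (simp add: algebra_simps)
    ultimately have "\<sigma> = coord y ^ (k + 1) * h"
      unfolding \<sigma>_def q_def g_def h_def by simp
    moreover have "Der (basis x) (coord y ^ (k + 1)) = 0" using xy by (simp add: Der_mult Der_power Der_coord basis_def)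
    ultimately have "Ders (replicate a (basis x)) \<sigma> = coord y ^ (k + 1) * Ders (replicate a (basis x)) h"
      by (auto intro!: Ders_mult_killed)
    then have "clc (Ders (replicate a (basis x)) \<sigma>)" using c cc(2) by metis
    then show ?thesis unfolding sigma_deriv_def Ders_append by (rule clc_Ders) auto
  next
    case 2
    define h where "h = coord y ^ (k + 1) * S * (\<Prod>t\<in>E. coord t + S) + coord x * coord y ^ (k + d) * S"
    have "form I (k + d + 2) h"
    proof -
      have "form I (k + 1 + 1 + d) (coord y ^ (k + 1) * S * (\<Prod>t\<in>E. coord t + S))"
        using clc_form_mult[OF finI clc_form_mult[OF finI clc_form_power[OF finI forms(2)] clc_form_linear[OF forms(3)]] P, of "k + 1"] by (simp add: clc_form_def)
      moreover have "form I (1 + (k + d) + 1) (coord x * coord y ^ (k + d) * S)"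
        using clc_form_mult[OF finI clc_form_mult[OF finI clc_form_linear[OF forms(1)] clc_form_power[OF finI forms(2)]] clc_form_linear[OF forms(3)], of "k + d"] by (simp add: clc_form_def)
      ultimately show ?thesis unfolding h_def by (intro form_add) (simp_all add: add.commute add.left_commute)
    qed
    then have "form I (k + d + 2 - length (replicate b (basis y))) (Ders (replicate b (basis y)) h)" by (rule form_Ders) auto
    then have c: "Ders (replicate b (basis y)) h = const (dv (Ders (replicate b (basis y)) h) [])" using 2 by (intro const) simp
    have "\<sigma> = coord x ^ k * h"
      unfolding \<sigma>_def q_def g_def h_def by (simp add: algebra_simps)
    moreover have "Der (basis y) (coord x ^ k) = 0" using xy by (simp add: Der_mult Der_power Der_coord basis_def)
    ultimately have "Ders (replicate b (basis y)) \<sigma> = coord x ^ k * Ders (replicate b (basis y)) h"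
      by (auto intro!: Ders_mult_killed)
    then have "clc (Ders (replicate b (basis y)) \<sigma>)" using c cc(1) by metis
    then have "clc (Ders (replicate a (basis x)) (Ders (replicate b (basis y)) \<sigma>))" by (rule clc_Ders) auto
    also have "Ders (replicate a (basis x)) (Ders (replicate b (basis y)) \<sigma>) = sigma_deriv a b"
    proof (rule dv_eqI)
      fix vs
      show "dv (Ders (replicate a (basis x)) (Ders (replicate b (basis y)) \<sigma>)) vs = dv (sigma_deriv a b) vs"
        using form_perm[OF form_\<sigma>, of "replicate b (basis y) @ replicate a (basis x) @ vs" "word2 x y a b @ vs" "[]"]
        by (simp add: dv_Ders dv_sigma_deriv)
    qed
    finally show ?thesis .
  qed
qed

text \<open>Otherwise exponents can be shifted between \<open>x\<close> and \<open>y\<close>, and \<open>x\<close> is adjacent to \<open>y\<close> and every edge variable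
  to one of them.\<close>

lemma sigma_deriv_connected:
  assumes ab: "a + b + 3 \<le> 2 * k + 2 + d" and nd: "max a k + max b (k + 1) < 2 * k + 2 + d"
    and len: "length vs + 2 = 2 * k + 2 + d - (a + b)" and pos: "\<And>v. v \<in> set vs \<Longrightarrow> positive v"
  shows "dv (sigma_deriv a b) (vs @ [basis x, basis y]) > 0"
    and "t \<in> E \<Longrightarrow> dv (sigma_deriv a b) (vs @ [basis t, basis x]) > 0 \<or> dv (sigma_deriv a b) (vs @ [basis t, basis y]) > 0"
proof -
  have main: "dv (sigma_deriv a b) (vs @ [u, v]) > 0"
    if uv: "nonneg u" "nonneg v" and us: "dv (sigma_deriv a b) (word2 x y p r @ [u, v]) \<noteq> 0" "p + r = length vs" for u v p r
  proof -
    define h where "h = Der u (Der v (sigma_deriv a b))"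
    have h: "form I (2 * k + 2 + d - (a + b) - 1 - 1) h" unfolding h_def by (intro form_Der form_sigma_deriv uv)
    have dvh: "dv h ws = dv (sigma_deriv a b) (ws @ [u, v])" for ws
      using form_perm[OF form_sigma_deriv[of a b], of "v # u # ws" "ws @ [u, v]" "[]"] by (simp add: h_def)
    have "dv h vs > 0"
      by (rule form_pos[OF finI h, of "word2 x y p r"]) (use us pos in \<open>auto simp: dvh\<close>)
    then show ?thesis by (simp add: dvh)
  qed
  show "dv (sigma_deriv a b) (vs @ [basis x, basis y]) > 0"
  proof -
    \<comment> \<open>The least exponent of \<open>x\<close> that admits one more derivative; the rest of the degree goes to \<open>y\<close>.\<close>
    define A where "A = max (a + 1) k"
    define B where "B = 2 * k + 2 + d - A"
    have AB: "a + 1 \<le> A" "b + 1 \<le> B" "k \<le> A" "k + 1 \<le> B" "A + B = 2 * k + 2 + d"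
      using ab nd d1 by (auto simp: A_def B_def max_def split: if_splits)
    have "dv (sigma_deriv a b) (word2 x y (A - a - 1) (B - b - 1) @ [basis x, basis y]) = dv \<sigma> (word2 x y A B)"
    proof -
      have "replicate_mset A u = replicate_mset a u + replicate_mset (A - a - 1) u + {#u#}"
        "replicate_mset B u = replicate_mset b u + replicate_mset (B - b - 1) u + {#u#}" for u :: "'i \<Rightarrow> real"
        using AB by (auto intro!: multiset_eqI)
      then show ?thesis
        using form_perm[OF form_\<sigma>, of "word2 x y a b @ word2 x y (A - a - 1) (B - b - 1) @ [basis x, basis y]" "word2 x y A B" "[]"]
        by (simp add: dv_sigma_deriv)
    qed
    then show ?thesis using word2_pos_\<sigma>[OF AB(3-5)] AB len
      by (intro main[of _ _ "A - a - 1" "B - b - 1"]) auto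
  qed
  show "dv (sigma_deriv a b) (vs @ [basis t, basis x]) > 0 \<or> dv (sigma_deriv a b) (vs @ [basis t, basis y]) > 0" if t: "t \<in> E"
  proof -
    define B where "B = max b (k + 1)"
    define A where "A = 2 * k + 1 + d - B"
    have AB: "a \<le> A" "b \<le> B" "k \<le> A" "k + 1 \<le> B" "A + B = 2 * k + 1 + d" "a < A \<or> b < B"
      using ab nd d1 by (auto simp: A_def B_def max_def split: if_splits)
    have line_value: "dv \<sigma> (basis t # word2 x y A B) > 0"
    proof -
      have "dv (q (E - {t})) (word2 x y A B) > 0"
        unfolding word2_q[OF Diff_subset] using t fin d1 AB by (auto intro!: zero_less_binomial)
      then show ?thesis using dv_Der[of "basis t" \<sigma> "word2 x y A B"] Der_\<sigma>[OF t] by simp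
    qed
    show ?thesis
    proof (cases "a < A")
      case True
      have "dv (sigma_deriv a b) (word2 x y (A - a - 1) (B - b) @ [basis t, basis x]) = dv \<sigma> (basis t # word2 x y A B)"
      proof -
        have "replicate_mset A u = replicate_mset a u + replicate_mset (A - a - 1) u + {#u#}"
          "replicate_mset B u = replicate_mset b u + replicate_mset (B - b) u" for u :: "'i \<Rightarrow> real"
          using AB True by (auto intro!: multiset_eqI)
        then show ?thesis
          using form_perm[OF form_\<sigma>, of "word2 x y a b @ word2 x y (A - a - 1) (B - b) @ [basis t, basis x]" "basis t # word2 x y A B" "[]"]
          by (simp add: dv_sigma_deriv)
      qed
      then have "dv (sigma_deriv a b) (vs @ [basis t, basis x]) > 0" using line_value AB len True
        by (intro main[of _ _ "A - a - 1" "B - b"]) auto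
      then show ?thesis ..
    next
      case False
      then have bB: "b < B" using AB by simp
      have "dv (sigma_deriv a b) (word2 x y (A - a) (B - b - 1) @ [basis t, basis y]) = dv \<sigma> (basis t # word2 x y A B)"
      proof -
        have "replicate_mset A u = replicate_mset a u + replicate_mset (A - a) u"
          "replicate_mset B u = replicate_mset b u + replicate_mset (B - b - 1) u + {#u#}" for u :: "'i \<Rightarrow> real"
          using AB bB by (auto intro!: multiset_eqI)
        then show ?thesis
          using form_perm[OF form_\<sigma>, of "word2 x y a b @ word2 x y (A - a) (B - b - 1) @ [basis t, basis y]" "basis t # word2 x y A B" "[]"]
          by (simp add: dv_sigma_deriv)
      qed
      then have "dv (sigma_deriv a b) (vs @ [basis t, basis y]) > 0" using line_value AB len bB
        by (intro main[of _ _ "A - a" "B - b - 1"]) auto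
      then show ?thesis ..
    qed
  qed
qed

text \<open>Derivatives in the edge directions turn the vertex form into a product of linear forms, so that the
  trickling down only runs along derivatives in the directions \<open>x\<close> and \<open>y\<close>.\<close>

lemma clc_sigma_deriv_if_base:
  assumes base: "\<And>a b. a + b = 2 * k + d \<Longrightarrow> clc (sigma_deriv a b)"
  shows "clc (sigma_deriv a b)"
proof (induction "2 * k + 2 + d - (a + b)" arbitrary: a b rule: less_induct)
  case less
  consider "a + b > 2 * k + d" | "a + b = 2 * k + d" | "a + b + 3 \<le> 2 * k + 2 + d" by linarith
  then show ?case
  proof cases
    case 1
    then show ?thesis by (intro clc_low_degree[OF form_sigma_deriv]) auto
  next
    case 2
    then show ?thesis by (rule base)
  next
    case 3
    show ?thesis
    proof (cases "max a k + max b (k + 1) \<ge> 2 * k + 2 + d")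
      case True
      then show ?thesis using 3 by (intro clc_sigma_deriv_degenerate)
    next
      case False
      then have nd: "max a k + max b (k + 1) < 2 * k + 2 + d" by simp
      show ?thesis
      proof (rule clc_trickle_down[OF finI form_sigma_deriv])
        show "3 \<le> 2 * k + 2 + d - (a + b)" using 3 by simp
        show "clc (Der (basis i) (sigma_deriv a b))" if "i \<in> I" for i
        proof -
          from that consider "i = x" | "i = y" | "i \<in> E" by blast
          then show ?thesis
          proof cases
            case 1 then show ?thesis using 3 by (simp add: Der_sigma_deriv_x less.hyps)
          next
            case 2 then show ?thesis using 3 by (simp add: Der_sigma_deriv_y less.hyps)
          next
            case 3
            have "clc (q (E - {i}))" using clc_form_q[of "E - {i}"] by (auto simp: clc_form_def)
            then show ?thesis unfolding Der_sigma_deriv_t[OF 3] by (rule clc_Ders) auto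
          qed
        qed
      next
        fix vs and r :: "'i \<Rightarrow> real" and i j
        assume len: "length vs + 2 = 2 * k + 2 + d - (a + b)" and pos: "\<And>v. v \<in> set vs \<Longrightarrow> positive v"
          and r: "\<And>i j. i \<in> I \<Longrightarrow> j \<in> I \<Longrightarrow> 0 < dv (sigma_deriv a b) (vs @ [basis i, basis j]) \<Longrightarrow> r i = r j"
          and ij: "i \<in> I" "j \<in> I"
        note con = sigma_deriv_connected[OF 3 nd len pos]
        have rxy: "r x = r y" using r[of x y] con(1) by simp
        have "r t = r x" if "t \<in> E" for t
          using con(2)[OF _ that] r[of t x] r[of t y] that rxy by auto
        then show "r i = r j" using ij rxy by auto
      qed
    qed
  qed
qed

end

section \<open>Second derivatives of the vertex form\<close>

text \<open>The second derivatives of the vertex form are symmetric in the edge variables, and those with respect to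
  a single edge variable vanish.\<close>

lemma bil_star:
  fixes z :: "'i \<Rightarrow> real"
  assumes fin: "finite E" and x: "x \<noteq> y" "x \<notin> E" "y \<notin> E"
    and sym: "\<And>i j. H i j = H j i"
    and H: "\<And>t. t \<in> E \<Longrightarrow> H x t = P" "\<And>t. t \<in> E \<Longrightarrow> H y t = R"
      "\<And>t t'. t \<in> E \<Longrightarrow> t' \<in> E \<Longrightarrow> H t t' = (if t = t' then 0 else W)"
  defines "s \<equiv> \<Sum>t\<in>E. z t"
  shows "bil (insert x (insert y E)) H z z = H x x * (z x)\<^sup>2 + 2 * H x y * z x * z y + H y y * (z y)\<^sup>2
     + 2 * P * z x * s + 2 * R * z y * s + W * (s\<^sup>2 - (\<Sum>t\<in>E. (z t)\<^sup>2))"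
    and "bil (insert x (insert y E)) H (basis y) z = H x y * z x + H y y * z y + R * s"
proof -
  have Pt: "(\<Sum>t\<in>E. z u * z t * H x t) = z u * P * s" "(\<Sum>t\<in>E. z u * z t * H y t) = z u * R * s" for u
    unfolding s_def sum_distrib_left by (intro sum.cong refl; simp add: H)+
  have tP: "(\<Sum>t\<in>E. z t * z u * H t x) = z u * P * s" "(\<Sum>t\<in>E. z t * z u * H t y) = z u * R * s" for u
    unfolding s_def sum_distrib_left by (intro sum.cong refl; simp add: H sym[of _ x] sym[of _ y])+
  have inner: "(\<Sum>t'\<in>E. z t * z t' * H t t') = W * (z t * s - (z t)\<^sup>2)" if t: "t \<in> E" for t
  proof -
    have "(\<Sum>t'\<in>E. z t * z t' * H t t') = (\<Sum>t'\<in>E. W * (z t * z t') - (if t' = t then W * (z t)\<^sup>2 else 0))"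
      by (intro sum.cong refl) (use t in \<open>auto simp: H power2_eq_square\<close>)
    also have "\<dots> = W * (z t * s) - W * (z t)\<^sup>2"
      using t fin by (simp add: sum_subtractf s_def sum_distrib_left)
    finally show ?thesis by (simp add: algebra_simps)
  qed
  have tt: "(\<Sum>t\<in>E. \<Sum>t'\<in>E. z t * z t' * H t t') = W * (s\<^sup>2 - (\<Sum>t\<in>E. (z t)\<^sup>2))"
  proof -
    have "(\<Sum>t\<in>E. \<Sum>t'\<in>E. z t * z t' * H t t') = (\<Sum>t\<in>E. W * (z t * s - (z t)\<^sup>2))"
      by (intro sum.cong refl inner)
    also have "\<dots> = W * ((\<Sum>t\<in>E. z t * s) - (\<Sum>t\<in>E. (z t)\<^sup>2))"
      by (simp only: sum_distrib_left[symmetric] sum_subtractf)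
    also have "(\<Sum>t\<in>E. z t * s) = s\<^sup>2" by (simp add: s_def power2_eq_square sum_distrib_right)
    finally show ?thesis .
  qed
  show "bil (insert x (insert y E)) H z z = H x x * (z x)\<^sup>2 + 2 * H x y * z x * z y + H y y * (z y)\<^sup>2
     + 2 * P * z x * s + 2 * R * z y * s + W * (s\<^sup>2 - (\<Sum>t\<in>E. (z t)\<^sup>2))"
    unfolding bil_def using fin x
    by (simp add: sum.distrib Pt tP tt) (simp add: sym[of y x] power2_eq_square algebra_simps)
  have yt: "(\<Sum>t\<in>E. z t * H y t) = R * s"
    unfolding s_def sum_distrib_left by (intro sum.cong refl) (simp add: H)
  have "bil (insert x (insert y E)) H (basis y) z = (\<Sum>j\<in>insert x (insert y E). z j * H y j)"
    unfolding bil_right by (subst sum.mono_neutral_right[of "insert x (insert y E)" "{y}"])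
      (use fin in \<open>auto simp: basis_def\<close>)
  also have "\<dots> = H x y * z x + H y y * z y + R * s"
    using fin x by (simp add: yt sym[of y x] algebra_simps)
  finally show "bil (insert x (insert y E)) H (basis y) z = H x y * z x + H y y * z y + R * s" .
qed

lemma sum_squared_le:
  fixes z :: "'i \<Rightarrow> real"
  assumes "finite E"
  shows "(\<Sum>t\<in>E. z t)\<^sup>2 / real (card E) \<le> (\<Sum>t\<in>E. (z t)\<^sup>2)"
proof (cases "card E = 0")
  case True
  then show ?thesis by (simp add: sum_nonneg)
next
  case False
  have "(\<Sum>t\<in>E. z t)\<^sup>2 \<le> (\<Sum>t\<in>E. (z t)\<^sup>2) * real (card E)"
    using sum_squared_le_sum_of_squares[of z E] by simp
  then show ?thesis using False by (simp add: field_simps)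
qed

text \<open>Elimination of the coordinate at \<open>y\<close>: on the orthogonal complement of the direction \<open>y\<close> the quadratic
  form is, up to positive factors, minus the form of \<open>vertex_psd\<close> minus the excess of \<open>\<Sum>t. (z t)\<^sup>2\<close> over its Cauchy-Schwarz bound.
  Here \<open>a!\<close>, \<open>b!\<close> are collected in \<open>u\<close>, and \<open>N\<close> is the number of edge variables.\<close>

lemma pivot_y:
  fixes a b :: nat and u X Y s Q N W F0 Fm Fp Gm Gp :: real
  assumes C: "Fm > 0" and u: "u > 0" and W: "W \<ge> 0" and Q: "Q \<ge> s\<^sup>2 / N" and N: "N > 0"
    and zero: "u * ((a + 1) * (b + 1) * F0) * X + u * ((b + 2) * (b + 1) * Fm) * Y + u * ((b + 1) * Gm) * s = 0"
    and psd: "\<And>X s. (F0\<^sup>2 - (1 + 1 / real (a + 1)) * (1 + 1 / real (b + 1)) * (Fp * Fm)) * X\<^sup>2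
     + 2 * (F0 * Gm - (1 + 1 / real (b + 1)) * (Fm * Gp)) * X * s
     + (Gm\<^sup>2 - (1 + 1 / real (b + 1)) * (Fm * W * (1 - 1 / N))) * s\<^sup>2 \<ge> 0"
  shows "u * ((a + 2) * (a + 1) * Fp) * X\<^sup>2 + 2 * (u * ((a + 1) * (b + 1) * F0)) * X * Y + u * ((b + 2) * (b + 1) * Fm) * Y\<^sup>2
    + 2 * (u * ((a + 1) * Gp)) * X * s + 2 * (u * ((b + 1) * Gm)) * Y * s + u * W * (s\<^sup>2 - Q) \<le> 0"
proof -
  define a1 where "a1 = real a + 1"
  define b1 where "b1 = real b + 1"
  have ab: "a1 > 0" "b1 > 0" by (auto simp: a1_def b1_def)
  have conv: "real a + 2 = a1 + 1" "real b + 2 = b1 + 1" "real a + 1 = a1" "real b + 1 = b1"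
     "real (a + 1) = a1" "real (b + 1) = b1" "real (a + 2) = a1 + 1" "real (b + 2) = b1 + 1" by (auto simp: a1_def b1_def)
  define C where "C = (b1 + 1) * b1 * Fm"
  have Cpos: "C > 0" using C ab by (simp add: C_def)
  define L where "L = a1 * b1 * F0 * X + C * Y + b1 * Gm * s"
  have "u * L = 0" using zero unfolding conv L_def C_def of_nat_mult by (simp add: algebra_simps)
  then have L: "L = 0" using u by simp
  define M where "M = (a1 + 1) * a1 * Fp * X\<^sup>2 + 2 * (a1 * b1 * F0) * X * Y + C * Y\<^sup>2
    + 2 * (a1 * Gp) * X * s + 2 * (b1 * Gm) * Y * s + W * (s\<^sup>2 - Q)"
  define T where "T = (F0\<^sup>2 - (1 + 1 / a1) * (1 + 1 / b1) * (Fp * Fm)) * (a1 * X)\<^sup>2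
     + 2 * (F0 * Gm - (1 + 1 / b1) * (Fm * Gp)) * (a1 * X) * s
     + (Gm\<^sup>2 - (1 + 1 / b1) * (Fm * W * (1 - 1 / N))) * s\<^sup>2"
  have T: "T \<ge> 0" using psd[of "a1 * X" s] unfolding conv T_def .
  define p1 where "p1 = (1 + 1 / a1) * (1 + 1 / b1) * (Fp * Fm) * (a1 * X)\<^sup>2"
  define p2 where "p2 = (1 + 1 / b1) * (Fm * Gp) * (a1 * X) * s"
  define p3 where "p3 = (1 + 1 / b1) * (Fm * W * (1 - 1 / N)) * s\<^sup>2"
  have p: "b1\<^sup>2 * p1 = C * ((a1 + 1) * a1 * Fp * X\<^sup>2)" "b1\<^sup>2 * p2 = C * ((a1 * Gp) * X * s)"
    "b1\<^sup>2 * p3 = C * (W * (s\<^sup>2 - s\<^sup>2 / N))"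
    using ab N by (simp_all add: p1_def p2_def p3_def C_def field_simps power2_eq_square)
  have "T = F0\<^sup>2 * (a1 * X)\<^sup>2 - p1 + 2 * (F0 * Gm * (a1 * X) * s) - 2 * p2 + Gm\<^sup>2 * s\<^sup>2 - p3"
    unfolding T_def p1_def p2_def p3_def left_diff_distrib right_diff_distrib by (simp only: mult.assoc)
  then have "b1\<^sup>2 * T = b1\<^sup>2 * (F0\<^sup>2 * (a1 * X)\<^sup>2) - b1\<^sup>2 * p1 + 2 * (b1\<^sup>2 * (F0 * Gm * (a1 * X) * s)) - 2 * (b1\<^sup>2 * p2) + b1\<^sup>2 * (Gm\<^sup>2 * s\<^sup>2) - b1\<^sup>2 * p3"
    by (simp only:) (simp add: algebra_simps)
  then have T': "b1\<^sup>2 * T = (b1 * F0 * a1 * X)\<^sup>2 - C * ((a1 + 1) * a1 * Fp * X\<^sup>2)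
     + 2 * (b1 * F0 * a1 * X) * (b1 * Gm * s) - 2 * (C * ((a1 * Gp) * X * s)) + (b1 * Gm * s)\<^sup>2 - C * (W * (s\<^sup>2 - s\<^sup>2 / N))"
    unfolding p by (simp add: power2_eq_square mult_ac)
  have "C * M = L\<^sup>2 - b1\<^sup>2 * T - C * (W * (Q - s\<^sup>2 / N))"
    unfolding T' M_def L_def by (simp add: power2_eq_square algebra_simps)
  also have "\<dots> \<le> 0"
  proof -
    have "b1\<^sup>2 * T \<ge> 0" "C * (W * (Q - s\<^sup>2 / N)) \<ge> 0"
      using T Cpos W Q by (intro mult_nonneg_nonneg; simp)+
    then show ?thesis using L by simp
  qed
  finally have "M \<le> 0" using Cpos by (simp add: mult_le_0_iff)
  moreover have "u * ((a + 2) * (a + 1) * Fp) * X\<^sup>2 + 2 * (u * ((a + 1) * (b + 1) * F0)) * X * Y + u * ((b + 2) * (b + 1) * Fm) * Y\<^sup>2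
    + 2 * (u * ((a + 1) * Gp)) * X * s + 2 * (u * ((b + 1) * Gm)) * Y * s + u * W * (s\<^sup>2 - Q) = u * M"
    unfolding M_def C_def conv of_nat_mult by (simp add: algebra_simps)
  ultimately show ?thesis using u by (simp add: mult_le_0_iff)
qed

context vertex_form
begin

definition entry :: "nat \<Rightarrow> nat \<Rightarrow> 'i \<Rightarrow> 'i \<Rightarrow> real" where
  "entry a b i j = dv (sigma_deriv a b) [basis i, basis j]"

lemma entry_sym: "entry a b i j = entry a b j i"
  using form_last_two[OF form_sigma_deriv, of a b "[]" "basis i" "basis j"] by (simp add: entry_def)

lemma entry_xy:
  "entry a b x x = dv \<sigma> (word2 x y (a + 2) b)" "entry a b x y = dv \<sigma> (word2 x y (a + 1) (b + 1))"
  "entry a b y y = dv \<sigma> (word2 x y a (b + 2))"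
  unfolding entry_def dv_sigma_deriv by (rule form_perm[OF form_\<sigma>, of _ _ "[]", simplified]; simp)+

lemma entry_t:
  assumes t: "t \<in> E"
  shows "entry a b x t = dv (q (E - {t})) (word2 x y (a + 1) b)" "entry a b y t = dv (q (E - {t})) (word2 x y a (b + 1))"
    "t' \<in> E \<Longrightarrow> entry a b t t' = (if t = t' then 0 else dv (q (E - {t} - {t'})) (word2 x y a b))"
proof -
  have h: "entry a b i t = dv (q (E - {t})) (word2 x y a b @ [basis i])" for i
  proof -
    have "entry a b i t = dv \<sigma> (basis t # word2 x y a b @ [basis i])"
      unfolding entry_def dv_sigma_deriv by (rule form_perm[OF form_\<sigma>, of _ _ "[]", simplified]) simp
    then show ?thesis using dv_Der[of "basis t" \<sigma> "word2 x y a b @ [basis i]"] Der_\<sigma>[OF t] by simp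
  qed
  have qf: "form I (2 * k + 2 + card (E - {t})) (q (E - {t}))" using clc_form_q[of "E - {t}"] by (auto simp: clc_form_def)
  show "entry a b x t = dv (q (E - {t})) (word2 x y (a + 1) b)" "entry a b y t = dv (q (E - {t})) (word2 x y a (b + 1))"
    unfolding h by (rule form_perm[OF qf, of _ _ "[]", simplified]; simp)+
  show "entry a b t t' = (if t = t' then 0 else dv (q (E - {t} - {t'})) (word2 x y a b))" if t': "t' \<in> E"
  proof -
    have "entry a b t' t = dv (q (E - {t})) (basis t' # word2 x y a b)"
      unfolding h by (rule form_perm[OF qf, of _ _ "[]", simplified]) simp
    also have "\<dots> = dv (Der (basis t') (q (E - {t}))) (word2 x y a b)" by simp
    also have "\<dots> = (if t = t' then 0 else dv (q (E - {t} - {t'})) (word2 x y a b))"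
      using Der_q[OF t', of "E - {t}"] t' by auto
    finally show ?thesis using entry_sym by simp
  qed
qed

lemma clc_base_if:
  assumes ab: "a + b = 2 * k + d"
    and *: "\<And>z. bil I (entry a b) (basis y) z = 0 \<Longrightarrow> bil I (entry a b) z z \<le> 0"
  shows "clc (sigma_deriv a b)"
proof (rule clc_degree_2)
  show f: "form I 2 (sigma_deriv a b)" using form_sigma_deriv[of a b] ab by simp
  fix u z :: "'i \<Rightarrow> real" assume u: "nonneg u"
  have bil: "dv (sigma_deriv a b) [v, w] = bil I (entry a b) v w" for v w
    using form_bil[OF f, of "[]" v w] unfolding entry_def by simp
  show "dv (sigma_deriv a b) [u, u] * dv (sigma_deriv a b) [z, z] \<le> (dv (sigma_deriv a b) [u, z])\<^sup>2"
    unfolding bil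
  proof (rule reversed_Cauchy_Schwarz[OF entry_sym *])
    show "0 \<le> bil I (entry a b) u u"
      unfolding bil[symmetric] by (rule form_nonneg[OF f]) (use u in auto)
  qed
qed

text \<open>Away from the corner of the exponents of \<open>g\<close>, the second derivative does not see \<open>g\<close>.\<close>

lemma clc_base_generic:
  assumes ab: "a + b = 2 * k + d" and a: "a + 1 < k \<or> a > k + 2"
  shows "clc (sigma_deriv a b)"
proof (rule clc_degree_2)
  show f: "form I 2 (sigma_deriv a b)" using form_sigma_deriv[of a b] ab by simp
  have g2: "form I 2 (Ders (word2 x y a b) g)"
  proof -
    have "form I (2 * k + 2 + d - length (word2 x y a b)) (Ders (word2 x y a b) g)" by (rule form_Ders[OF form_g]) auto
    then show ?thesis using ab by simp
  qed
  have perm: "mset us = mset ws \<Longrightarrow> dv g us = dv g ws" for us ws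
    using form_perm[OF form_g, of us ws "[]"] by simp
  have xy0: "dv (Ders (word2 x y a b) g) [basis i, basis j] = 0" if "i \<in> {x, y}" "j \<in> {x, y}" for i j
  proof -
    have "dv g (word2 x y a b @ [basis x, basis x]) = dv g (word2 x y (a + 2) b)" "dv g (word2 x y a b @ [basis x, basis y]) = dv g (word2 x y (a + 1) (b + 1))"
      "dv g (word2 x y a b @ [basis y, basis x]) = dv g (word2 x y (a + 1) (b + 1))"  "dv g (word2 x y a b @ [basis y, basis y]) = dv g (word2 x y a (b + 2))"
      by (rule perm; simp)+
    moreover have "dv g (word2 x y (a + 2) b) = 0" "dv g (word2 x y (a + 1) (b + 1)) = 0" "dv g (word2 x y a (b + 2)) = 0"
      unfolding word2_g using a by (auto simp: binomial_eq_0)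
    ultimately show ?thesis using that by (auto simp: dv_Ders)
  qed
  have t0: "dv (Ders (word2 x y a b) g) [basis t, v] = 0" if "t \<in> E" for t v
  proof -
    have "dv g (word2 x y a b @ [basis t, v]) = dv g (basis t # word2 x y a b @ [v])" by (rule perm) simp
    also have "\<dots> = dv (Der (basis t) g) (word2 x y a b @ [v])" by simp
    finally show ?thesis using Der_g[OF that] by (simp add: dv_Ders)
  qed
  have "dv (Ders (word2 x y a b) g) [basis i, basis j] = 0" if "i \<in> I" "j \<in> I" for i j
    using that xy0 t0 form_last_two[OF g2, of "[]" "basis i" "basis j"] by auto
  then have "dv (Ders (word2 x y a b) g) [v, w] = 0" for v w
    using form_bil[OF g2, of "[]" v w] by (simp add: bil_def)
  then have eq: "dv (sigma_deriv a b) [v, w] = dv (Ders (word2 x y a b) (q E)) [v, w]" for v w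
    by (simp add: sigma_deriv_def \<sigma>_def)
  have "clc (Ders (word2 x y a b) (q E))"
    using clc_form_q[of E] by (intro clc_Ders) (auto simp: clc_form_def)
  then show "dv (sigma_deriv a b) [u, u] * dv (sigma_deriv a b) [z, z] \<le> (dv (sigma_deriv a b) [u, z])\<^sup>2" if "nonneg u" for u z
    unfolding eq using clcD[of "Ders (word2 x y a b) (q E)" "[]" u z] that by simp
qed

text \<open>Here the quadratic form is the product of the coordinate at \<open>x\<close> with a linear form.\<close>

lemma clc_base_corner:
  assumes ab: "a + b = 2 * k + d" and a: "a + 1 = k"
  shows "clc (sigma_deriv a b)"
proof (rule clc_base_if[OF ab])
  fix z assume z: "bil I (entry a b) (basis y) z = 0"
  have P: "entry a b x t = fact (a + 1) * fact b * (if k + 1 \<le> b then real (Suc (d - 1) choose 0) else 0)" if "t \<in> E" for t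
    unfolding entry_t[OF that] word2_q[OF Diff_subset] using that fin d1 ab a by auto
  have R: "entry a b y t = 0" if "t \<in> E" for t
    unfolding entry_t[OF that] word2_q[OF Diff_subset] using a by simp
  have W: "entry a b t t' = (if t = t' then 0 else 0)" if "t \<in> E" "t' \<in> E" for t t'
  proof -
    have "E - {t} - {t'} \<subseteq> E" by auto
    then show ?thesis unfolding entry_t(3)[OF that] using word2_q[of "E - {t} - {t'}" a b] a by auto
  qed
  note star = bil_star[OF fin xy xE yE entry_sym P R W, of z]
  have "entry a b y y = 0" unfolding entry_xy word2_\<sigma> using a by simp
  moreover have "entry a b x y > 0" unfolding entry_xy by (rule word2_pos_\<sigma>) (use a ab d1 in auto)
  ultimately have "z x = 0" using z star(2) by simp
  then show "bil I (entry a b) z z \<le> 0" using star(1) \<open>entry a b y y = 0\<close> by simp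
qed

lemma clc_base_main:
  assumes ab: "a + b = 2 * k + d" and p: "a + 1 = k + p" "p \<in> {1, 2, 3}"
    and psd: "vertex_psd d k p"
  shows "clc (sigma_deriv a b)"
proof (rule clc_base_if[OF ab])
  fix z assume z: "bil I (entry a b) (basis y) z = 0"
  define u :: real where "u = fact a * fact b"
  have u: "u > 0" by (simp add: u_def)
  have ak: "a \<ge> k" "a - k = p - 1" "a + 1 - k = p" "a + 2 - k = p + 1" using p by auto
  have bk: "b + p = k + d + 1" using ab p by linarith
  have fa: "fact (a + 1) = (real a + 1) * fact a" "fact (a + 2) = (real a + 2) * ((real a + 1) * fact a)"
    "fact (b + 1) = (real b + 1) * fact b" "fact (b + 2) = (real b + 2) * ((real b + 1) * fact b)"
    by (simp_all add: numeral_2_eq_2 algebra_simps)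
  have P: "entry a b x t = u * ((a + 1) * real (d choose p))" if t: "t \<in> E" for t
  proof -
    have c: "Suc (card (E - {t})) = d" "card (E - {t}) = d - 1" using t fin d1 by auto
    have "real (d choose p) = 0" if "\<not> k + 1 \<le> b" using that bk by (simp add: binomial_eq_0)
    then show ?thesis
      unfolding entry_t[OF t] word2_q[OF Diff_subset] c ak fa using ak ab d1 by (auto simp: u_def algebra_simps binomial_eq_0)
  qed
  have R: "entry a b y t = u * ((b + 1) * real (d choose (p - 1)))" if t: "t \<in> E" for t
  proof -
    have c: "Suc (card (E - {t})) = d" "card (E - {t}) = d - 1" using t fin d1 by auto
    have "real (d choose (p - 1)) = 0" if "\<not> k + 1 \<le> b + 1" using that bk by (simp add: binomial_eq_0)
    then show ?thesis
      unfolding entry_t[OF t] word2_q[OF Diff_subset] c ak fa using ak ab d1 by (auto simp: u_def algebra_simps binomial_eq_0)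
  qed
  have W: "entry a b t t' = (if t = t' then 0 else u * real (d - 1 choose (p - 1)))" if t: "t \<in> E" "t' \<in> E" for t t'
  proof (cases "t = t'")
    case True
    then show ?thesis using entry_t(3)[OF t] by simp
  next
    case False
    have sub: "E - {t} - {t'} \<subseteq> E" by auto
    have "card {t, t'} \<le> d" using t fin by (intro card_mono) auto
    then have d2: "d \<ge> 2" using False by simp
    have c: "card (E - {t} - {t'}) = d - 2" using t fin False by simp
    have c': "Suc (d - 2) = d - 1" using d2 by simp
    have "real (d - 1 choose (p - 1)) = 0" if "\<not> k + 1 \<le> b" using that bk d2 by (simp add: binomial_eq_0)
    then show ?thesis
      unfolding entry_t(3)[OF t] word2_q[OF sub] c c' ak using False ak ab d2 by (auto simp: u_def binomial_eq_0)
  qed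
  have star: "bil I (entry a b) z z = entry a b x x * (z x)\<^sup>2 + 2 * entry a b x y * z x * z y + entry a b y y * (z y)\<^sup>2
     + 2 * (u * ((a + 1) * real (d choose p))) * z x * sum z E + 2 * (u * ((b + 1) * real (d choose (p - 1)))) * z y * sum z E
     + (u * real (d - 1 choose (p - 1))) * ((sum z E)\<^sup>2 - (\<Sum>t\<in>E. (z t)\<^sup>2))"
    "bil I (entry a b) (basis y) z = entry a b x y * z x + entry a b y y * z y + (u * ((b + 1) * real (d choose (p - 1)))) * sum z E"
    using P R W by (intro bil_star fin xy xE yE entry_sym; simp)+
  have A: "entry a b x x = u * ((a + 2) * (a + 1) * vertex_coeff d (p + 1))"
    unfolding entry_xy word2_\<sigma> ak fa using ak ab by (simp add: u_def algebra_simps)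
  have B: "entry a b x y = u * ((a + 1) * (b + 1) * vertex_coeff d p)"
    unfolding entry_xy word2_\<sigma> ak fa using ak ab by (simp add: u_def algebra_simps)
  have C: "entry a b y y = u * ((b + 2) * (b + 1) * vertex_coeff d (p - 1))"
    unfolding entry_xy word2_\<sigma> ak fa using ak ab by (simp add: u_def algebra_simps)
  have Fm: "vertex_coeff d (p - 1) > 0"
  proof -
    have "Suc d choose (p - 1) > 0" using p d1 by (intro zero_less_binomial) auto
    then show ?thesis by (auto simp: vertex_coeff_def intro!: add_pos_nonneg)
  qed
  have a1: "k + p = a + 1" "k + (d + 2 - p) = b + 1" using p bk d1 by auto
  show "bil I (entry a b) z z \<le> 0"
    unfolding star(1)[unfolded A B C]
    using pivot_y[OF Fm u _ sum_squared_le[OF fin, of z] _ _ psd[unfolded vertex_psd_def a1, rule_format], where X = "z x" and Y = "z y"]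
      z[unfolded star(2)[unfolded B C]] d1
    by simp
qed

end

theorem vertex_form_clc:
  assumes "x \<noteq> y" "finite E" "x \<notin> E" "y \<notin> E" "card E \<ge> 1"
  shows "\<exists>k. clc_form (insert x (insert y E)) (2 * k + 2 + card E)
    (coord x ^ k * coord y ^ k * (coord x + coord y) *
       (coord y * (\<Prod>t\<in>E. coord t + (coord x + coord y)) + coord x * coord y ^ card E))"
proof -
  obtain k where psd: "\<forall>p\<in>{1,2,3}. vertex_psd (card E) k p"
    using vertex_asymptotics[OF assms(5)] by blast
  interpret vertex_form x y E k using assms by unfold_locales
  have "clc (sigma_deriv a b)" if ab: "a + b = 2 * k + d" for a b
  proof -
    consider "a + 1 < k \<or> a > k + 2" | "a + 1 = k" | p where "p \<in> {1,2,3}" "a + 1 = k + p"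
    proof -
      have "a + 1 < k \<or> a > k + 2 \<or> a + 1 = k \<or> a + 1 = k + 1 \<or> a + 1 = k + 2 \<or> a + 1 = k + 3" by linarith
      then show thesis using that by blast
    qed
    then show ?thesis
    proof cases
      case 1 then show ?thesis by (rule clc_base_generic[OF ab])
    next
      case 2 then show ?thesis by (rule clc_base_corner[OF ab])
    next
      case 3 then show ?thesis using psd 3(1) by (intro clc_base_main[OF ab 3(2,1)]) blast
    qed
  qed
  then have "clc (sigma_deriv 0 0)" by (rule clc_sigma_deriv_if_base)
  then have "clc_form I (2 * k + 2 + d) \<sigma>" using form_\<sigma> by (simp add: sigma_deriv_def clc_form_def)
  also have "\<sigma> = coord x ^ k * coord y ^ k * (coord x + coord y) *
       (coord y * (\<Prod>t\<in>E. coord t + (coord x + coord y)) + coord x * coord y ^ card E)"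
  proof -
    have "u * (v * w) * s * P + (u * u') * (v * w') * s = u * v * s * (w * P + u' * w')" for u v w u' w' s P :: "'a polar"
      by (simp add: algebra_simps)
    from this[of "coord x ^ k" "coord y ^ k" "coord y" S _ "coord x" "coord y ^ d"]
    show ?thesis unfolding \<sigma>_def q_def g_def by (simp only: power_add power_one_right)
  qed
  finally show ?thesis by blast
qed

section \<open>Values along a line\<close>

lemma Der_of_nat [simp]: "Der v (of_nat n) = 0"
  by (induction n) auto

text \<open>The values of a polynomial on the line through \<open>p\<close>. This is a ring homomorphism, so products of
  linear forms can be evaluated factor by factor.\<close>

definition line_series :: "('i \<Rightarrow> real) \<Rightarrow> 'i polar \<Rightarrow> real fps" where
  "line_series p f = Abs_fps (\<lambda>n. dv f (replicate n p) / fact n)"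

lemma line_series_add: "line_series p (f + g) = line_series p f + line_series p g"
  by (simp add: line_series_def fps_eq_iff add_divide_distrib)

lemma line_series_1: "line_series p 1 = 1"
  by (auto simp: line_series_def fps_eq_iff dv_1)

lemma line_series_0: "line_series p 0 = 0"
  by (simp add: line_series_def fps_eq_iff)

lemma line_series_Der: "line_series p (Der p f) = fps_deriv (line_series p f)"
  by (rule fps_ext) (simp add: line_series_def del: of_nat_Suc)

lemma line_series_mult: "line_series p (f * g) = line_series p f * line_series p g"
proof (rule fps_ext)
  fix n show "fps_nth (line_series p (f * g)) n = fps_nth (line_series p f * line_series p g) n"
  proof (induction n arbitrary: f g)
    case 0 then show ?case by (simp add: line_series_def)
  next
    case (Suc n)
    have "real (Suc n) * fps_nth (line_series p (f * g)) (Suc n) = fps_nth (line_series p (Der p (f * g))) n"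
      by (simp add: line_series_Der)
    also have "\<dots> = fps_nth (line_series p (Der p f * g)) n + fps_nth (line_series p (f * Der p g)) n"
      by (simp add: Der_mult line_series_add)
    also have "\<dots> = fps_nth (fps_deriv (line_series p f * line_series p g)) n"
      by (simp only: Suc line_series_Der fps_deriv_mult fps_add_nth)
    also have "\<dots> = real (Suc n) * fps_nth (line_series p f * line_series p g) (Suc n)" by (simp only: fps_deriv_nth Suc_eq_plus1)
    finally show ?case by (simp only: mult_cancel_left of_nat_eq_0_iff) simp
  qed
qed

definition line_value :: "('i \<Rightarrow> real) \<Rightarrow> nat \<Rightarrow> real \<Rightarrow> 'i polar \<Rightarrow> bool" where
  "line_value p n c f \<longleftrightarrow> line_series p f = fps_const c * fps_X ^ n"

lemma line_value_coord: "line_value p 1 (p i) (coord i)"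
  unfolding line_value_def
proof (rule fps_ext)
  fix n
  consider "n = 0" | "n = 1" | m where "n = Suc (Suc m)" by (metis One_nat_def not0_implies_Suc)
  then show "fps_nth (line_series p (coord i)) n = fps_nth (fps_const (p i) * fps_X ^ 1) n"
    by cases (simp_all add: line_series_def dv_coord fps_X_def)
qed

lemma line_value_1: "line_value p 0 1 1"
  by (simp add: line_value_def line_series_1)

lemma line_value_0: "line_value p n 0 0"
  by (simp add: line_value_def line_series_0)

lemma line_value_add: "line_value p n c f \<Longrightarrow> line_value p n c' g \<Longrightarrow> line_value p n (c + c') (f + g)"
  by (simp add: line_value_def line_series_add algebra_simps flip: fps_const_add)

lemma line_value_mult: "line_value p m c f \<Longrightarrow> line_value p n c' g \<Longrightarrow> line_value p (m + n) (c * c') (f * g)"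
  by (simp add: line_value_def line_series_mult power_add algebra_simps flip: fps_const_mult)

lemma line_value_power: "line_value p m c f \<Longrightarrow> line_value p (k * m) (c ^ k) (f ^ k)"
  by (induction k) (auto intro: line_value_mult line_value_1)

lemma line_value_power1: "line_value p 1 c f \<Longrightarrow> line_value p k (c ^ k) (f ^ k)"
  using line_value_power[of p 1 c f k] by simp

lemma line_value_prod: "(\<And>a. a \<in> A \<Longrightarrow> line_value p (n a) (c a) (f a)) \<Longrightarrow> line_value p (sum n A) (prod c A) (prod f A)"
  by (induction A rule: infinite_finite_induct) (auto intro: line_value_mult line_value_1)

lemma line_value_sum: "(\<And>a. a \<in> A \<Longrightarrow> line_value p n (c a) (f a)) \<Longrightarrow> line_value p n (sum c A) (sum f A)"
  by (induction A rule: infinite_finite_induct) (auto intro: line_value_add line_value_0)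

lemma line_value_of_nat: "line_value p n c f \<Longrightarrow> line_value p n (of_nat m * c) (of_nat m * f)"
  by (induction m) (auto intro: line_value_add line_value_0 simp: distrib_right)

lemma line_value_dv: "line_value p n c f \<Longrightarrow> dv f (replicate n p) = fact n * c"
proof -
  assume "line_value p n c f"
  then have "fps_nth (line_series p f) n = c" by (simp add: line_value_def)
  then show ?thesis by (simp add: line_series_def field_simps)
qed

lemma binomial_step:
  fixes u :: "nat \<Rightarrow> nat \<Rightarrow> real"
  shows "(\<Sum>i\<le>Suc n. real (Suc n choose i) * t ^ i * u i (Suc n - i)) =
    t * (\<Sum>i\<le>n. real (n choose i) * t ^ i * u (Suc i) (n - i)) + (\<Sum>i\<le>n. real (n choose i) * t ^ i * u i (Suc (n - i)))"
proof -
  have 1: "t * (\<Sum>i\<le>n. real (n choose i) * t ^ i * u (Suc i) (n - i)) =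
      (\<Sum>i\<le>Suc n. (if i = 0 then 0 else real (n choose (i - 1))) * t ^ i * u i (Suc n - i))"
    by (subst sum.atMost_Suc_shift) (simp add: sum_distrib_left algebra_simps)
  have 2: "(\<Sum>i\<le>n. real (n choose i) * t ^ i * u i (Suc (n - i))) = (\<Sum>i\<le>Suc n. real (n choose i) * t ^ i * u i (Suc n - i))"
    by (simp add: Suc_diff_le cong: sum.cong_simp)
  show ?thesis unfolding 1 2 sum.distrib[symmetric]
  proof (intro sum.cong refl)
    fix i
    show "real (Suc n choose i) * t ^ i * u i (Suc n - i) = (if i = 0 then 0 else real (n choose (i - 1))) * t ^ i * u i (Suc n - i) + real (n choose i) * t ^ i * u i (Suc n - i)"
      by (cases i) (auto simp: algebra_simps)
  qed
qed

text \<open>Binomial expansion in the plane of \<open>x\<close> and \<open>y\<close>, at the point with coordinates \<open>t\<close> and 1.\<close>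

lemma dv_on_line:
  assumes fin: "finite I" and xy: "x \<in> I" "y \<in> I" "x \<noteq> y"
    and p: "\<And>i. p i = (if i = x then t else if i = y then 1 else 0)"
  shows "form I m f \<Longrightarrow> dv f (replicate n p) = (\<Sum>i\<le>n. real (n choose i) * t ^ i * dv f (word2 x y i (n - i)))"
proof (induction n arbitrary: f m)
  case (Suc n)
  have "dv f (p # replicate n p) = (\<Sum>i\<in>I. p i * dv f (basis i # replicate n p))"
    using form_linear[OF Suc.prems, of "[]" p] by simp
  also have "\<dots> = (\<Sum>i\<in>{x, y}. p i * dv f (basis i # replicate n p))"
    using fin xy by (intro sum.mono_neutral_right) (auto simp: p)
  also have "\<dots> = t * dv (Der (basis x) f) (replicate n p) + dv (Der (basis y) f) (replicate n p)"
    using xy by (simp add: p)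
  also have "dv (Der (basis x) f) (replicate n p) = (\<Sum>i\<le>n. real (n choose i) * t ^ i * dv f (word2 x y (Suc i) (n - i)))"
    using Suc.IH[OF form_Der[OF Suc.prems nonneg_basis, of x]] by simp
  also have "dv (Der (basis y) f) (replicate n p) = (\<Sum>i\<le>n. real (n choose i) * t ^ i * dv f (word2 x y i (Suc (n - i))))"
  proof -
    have perm: "dv f (basis y # word2 x y i j) = dv f (word2 x y i (Suc j))" for i j
      using form_perm[OF Suc.prems, of "basis y # word2 x y i j" "word2 x y i (Suc j)" "[]"] by simp
    show ?thesis using Suc.IH[OF form_Der[OF Suc.prems nonneg_basis, of y]] perm by simp
  qed
  also have "t * (\<Sum>i\<le>n. real (n choose i) * t ^ i * dv f (word2 x y (Suc i) (n - i))) + (\<Sum>i\<le>n. real (n choose i) * t ^ i * dv f (word2 x y i (Suc (n - i))))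
     = (\<Sum>i\<le>Suc n. real (Suc n choose i) * t ^ i * dv f (word2 x y i (Suc n - i)))"
    using binomial_step[of n t "\<lambda>i j. dv f (word2 x y i j)"] by simp
  finally show ?case by simp
qed simp

lemma clc_word2:
  assumes f: "form I n f" "clc f" and i: "1 \<le> i" "i < n"
  shows "dv f (word2 x y (i - 1) (n - i + 1)) * dv f (word2 x y (i + 1) (n - i - 1)) \<le> (dv f (word2 x y i (n - i)))\<^sup>2"
proof -
  obtain a where a: "i = Suc a" using i by (cases i) auto
  obtain b where b: "n - i = Suc b" using i by (cases "n - i") auto
  have perm: "mset us = mset ws \<Longrightarrow> dv f us = dv f ws" for us ws
    using form_perm[OF f(1), of us ws "[]"] by simp
  have "dv f (word2 x y a b @ [basis x, basis x]) = dv f (word2 x y (a + 2) b)"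
    "dv f (word2 x y a b @ [basis y, basis y]) = dv f (word2 x y a (b + 2))"
    "dv f (word2 x y a b @ [basis x, basis y]) = dv f (word2 x y (a + 1) (b + 1))"
    by (rule perm; simp)+
  moreover have "dv f (word2 x y a b @ [basis x, basis x]) * dv f (word2 x y a b @ [basis y, basis y]) \<le> (dv f (word2 x y a b @ [basis x, basis y]))\<^sup>2"
    by (rule clcD[OF f(2)]) auto
  ultimately show ?thesis by (simp add: a b[unfolded a] mult.commute)
qed

section \<open>Gluing the vertex forms\<close>

datatype 'basis var = Xv | Yv | Tv 'basis

lemma clc_form_mono: "clc_form I n f \<Longrightarrow> I \<subseteq> J \<Longrightarrow> finite J \<Longrightarrow> clc_form J n f"
  unfolding clc_form_def by (auto intro: form_mono)

text \<open>If every direction \<open>c a\<close> only affects the factor \<open>F a\<close>, iterated differentiation acts factor by factor.\<close>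

lemma Ders_separate:
  assumes "distinct es" "\<And>a b. a \<in> set es \<Longrightarrow> b \<in> set es \<Longrightarrow> a \<noteq> b \<Longrightarrow> Der (c a) (F b) = 0"
    "\<And>a b. a \<in> set es \<Longrightarrow> b \<in> set es \<Longrightarrow> a \<noteq> b \<Longrightarrow> Der (c a) (Der (c b) (F b)) = 0"
    "\<And>a. a \<in> set es \<Longrightarrow> Der (c a) C = 0"
  shows "Ders (map c es) (C * (\<Prod>a\<in>set es. F a)) = C * (\<Prod>a\<in>set es. Der (c a) (F a))"
  using assms
proof (induction es arbitrary: C)
  case (Cons a es)
  have z: "Der (c a) (\<Prod>b\<in>set es. F b) = 0" using Cons.prems by (intro Der_prod_zero) auto
  have "Ders (map c (a # es)) (C * (\<Prod>b\<in>set (a # es). F b)) = Ders (map c es) (Der (c a) (C * (F a * (\<Prod>b\<in>set es. F b))))"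
    using Cons.prems(1) by simp
  also have "Der (c a) (C * (F a * (\<Prod>b\<in>set es. F b))) = (C * Der (c a) (F a)) * (\<Prod>b\<in>set es. F b)"
    using Cons.prems(4) z by (simp add: Der_mult algebra_simps)
  also have "Ders (map c es) \<dots> = (C * Der (c a) (F a)) * (\<Prod>b\<in>set es. Der (c b) (F b))"
  proof (rule Cons.IH)
    show "Der (c b) (C * Der (c a) (F a)) = 0" if "b \<in> set es" for b
    proof -
      have "b \<noteq> a" using that Cons.prems(1) by auto
      then show ?thesis using Cons.prems(3)[of b a] Cons.prems(4)[of b] that by (simp add: Der_mult)
    qed
  qed (use Cons.prems in auto)
  finally show ?case using Cons.prems(1) by (simp add: mult.assoc)
qed simp

lemma Ders_sum: "Ders vs (sum f A) = (\<Sum>a\<in>A. Ders vs (f a))"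
  by (rule dv_eqI) (simp add: dv_Ders dv_sum)

lemma basis_Tv: "basis (Tv a) Xv = 0" "basis (Tv a) Yv = 0" "basis (Tv a) (Tv b) = of_bool (a = b)"
  by (auto simp: basis_def)

locale simple_edges =
  fixes V :: "'a set" and A :: "('a \<times> 'a) set"
  assumes finV: "finite V" and finA: "finite A"
    and ends: "\<And>a. a \<in> A \<Longrightarrow> fst a \<in> V \<and> snd a \<in> V \<and> fst a \<noteq> snd a"
begin

definition inc :: "'a \<Rightarrow> ('a \<times> 'a) set" where "inc v = {a \<in> A. v \<in> {fst a, snd a}}"

abbreviation deg :: "'a \<Rightarrow> nat" where "deg v \<equiv> card (inc v)"

definition vars :: "('a \<times> 'a) var set" where "vars = insert Xv (insert Yv (Tv ` A))"

lemma fin_vars: "finite vars" using finA by (simp add: vars_def)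

lemma fin_inc: "finite (inc v)" using finA by (simp add: inc_def)

abbreviation "X \<equiv> coord Xv :: ('a \<times> 'a) var polar"
abbreviation "Y \<equiv> coord Yv :: ('a \<times> 'a) var polar"
abbreviation "T a \<equiv> coord (Tv a) :: ('a \<times> 'a) var polar"
abbreviation "S \<equiv> X + Y"

definition mon :: "nat \<Rightarrow> 'a \<Rightarrow> ('a \<times> 'a) var polar" where
  "mon k v = X ^ k * Y ^ k * S ^ deg v"

text \<open>The vertex form with the full power \<open>(x + y)\<^bsup>deg v\<^esup>\<close>: every edge
  receives one factor \<open>x + y\<close> from each of its ends, which together make up its factor \<open>(1 + x)\<^sup>2\<close>.\<close>

definition vform :: "nat \<Rightarrow> 'a \<Rightarrow> ('a \<times> 'a) var polar" where
  "vform k v = mon k v * (Y * (\<Prod>a\<in>inc v. T a + S) + X * Y ^ deg v)"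

lemma lin: "form vars 1 X" "form vars 1 Y" "form vars 1 S" "a \<in> A \<Longrightarrow> form vars 1 (T a)"
  "a \<in> A \<Longrightarrow> form vars 1 (X + T a)"
  using fin_vars by (auto intro!: form_add form_coord simp: vars_def simp del: One_nat_def)

lemma clc_form_vform: "\<exists>k. clc_form vars (2 * k + 1 + 2 * deg v) (vform k v)"
proof (cases "deg v = 0")
  case True
  then have "inc v = {}" using fin_inc by simp
  then have "vform 0 v = S" by (simp add: vform_def mon_def add.commute)
  then show ?thesis using True clc_form_linear[OF lin(3)] by (intro exI[of _ 0]) simp
next
  case False
  have c: "card (Tv ` inc v) = deg v" by (rule card_image) (auto simp: inj_on_def)
  obtain k where k: "clc_form (insert Xv (insert Yv (Tv ` inc v))) (2 * k + 2 + deg v)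
    (X ^ k * Y ^ k * S * (Y * (\<Prod>t\<in>Tv ` inc v. coord t + S) + X * Y ^ deg v))"
    using vertex_form_clc[of Xv Yv "Tv ` inc v"] fin_inc False unfolding c by fastforce
  have pr: "(\<Prod>t\<in>Tv ` inc v. coord t + S) = (\<Prod>a\<in>inc v. T a + S)"
    by (subst prod.reindex) (auto simp: inj_on_def)
  have "clc_form vars (2 * k + 2 + deg v) (X ^ k * Y ^ k * S * (Y * (\<Prod>a\<in>inc v. T a + S) + X * Y ^ deg v))"
    using clc_form_mono[OF k _ fin_vars] unfolding pr by (auto simp: vars_def inc_def)
  then have "clc_form vars ((2 * k + 2 + deg v) + (deg v - 1)) (X ^ k * Y ^ k * S * (Y * (\<Prod>a\<in>inc v. T a + S) + X * Y ^ deg v) * S ^ (deg v - 1))"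
    by (rule clc_form_mult[OF fin_vars _ clc_form_power[OF fin_vars lin(3)]])
  also have "X ^ k * Y ^ k * S * (Y * (\<Prod>a\<in>inc v. T a + S) + X * Y ^ deg v) * S ^ (deg v - 1) = vform k v"
  proof -
    have s: "s * s ^ (deg v - 1) = s ^ deg v" for s :: "('a \<times> 'a) var polar"
      using False by (metis power_minus_mult mult.commute not_gr_zero)
    have "u * w * s * P * s ^ (deg v - 1) = u * w * (s * s ^ (deg v - 1)) * P" for u w s P :: "('a \<times> 'a) var polar"
      by (simp add: mult_ac)
    then show ?thesis unfolding vform_def mon_def s by blast
  qed
  also have "(2 * k + 2 + deg v) + (deg v - 1) = 2 * k + 1 + 2 * deg v" using False by simp
  finally show ?thesis by blast
qed

definition out :: "'a set \<Rightarrow> 'a \<times> 'a \<Rightarrow> nat" where "out U a = card ({fst a, snd a} - U)"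

text \<open>Double counting of the pairs of an edge and an end outside \<open>U\<close>.\<close>

lemma inc_swap_prod:
  fixes L :: "'a \<times> 'a \<Rightarrow> 'c :: comm_monoid_mult"
  shows "(\<Prod>v\<in>V - U. \<Prod>a\<in>inc v. L a) = (\<Prod>a\<in>A. L a ^ out U a)"
proof -
  have "(\<Prod>v\<in>V - U. \<Prod>a\<in>inc v. L a) = (\<Prod>v\<in>V - U. \<Prod>a\<in>A. if v \<in> {fst a, snd a} then L a else 1)"
  proof (rule prod.cong[OF refl])
    fix v show "(\<Prod>a\<in>inc v. L a) = (\<Prod>a\<in>A. if v \<in> {fst a, snd a} then L a else 1)"
      unfolding inc_def by (rule prod.inter_filter[OF finA])
  qed
  also have "\<dots> = (\<Prod>a\<in>A. \<Prod>v\<in>V - U. if v \<in> {fst a, snd a} then L a else 1)" by (rule prod.swap)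
  also have "\<dots> = (\<Prod>a\<in>A. L a ^ out U a)"
  proof (intro prod.cong refl)
    fix a assume a: "a \<in> A"
    have "(\<Prod>v\<in>V - U. if v \<in> {fst a, snd a} then L a else 1) = (\<Prod>v\<in>{v\<in>V - U. v \<in> {fst a, snd a}}. L a)"
      by (rule prod.inter_filter[symmetric]) (use finV in auto)
    also have "{v\<in>V - U. v \<in> {fst a, snd a}} = {fst a, snd a} - U" using ends[OF a] by auto
    finally show "(\<Prod>v\<in>V - U. if v \<in> {fst a, snd a} then L a else 1) = L a ^ out U a" by (simp add: out_def)
  qed
  finally show ?thesis .
qed

lemma inc_swap_sum: "(\<Sum>v\<in>V - U. deg v) = (\<Sum>a\<in>A. out U a)"
proof -
  have "(2::nat) ^ (\<Sum>v\<in>V - U. deg v) = 2 ^ (\<Sum>a\<in>A. out U a)"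
    using inc_swap_prod[where L = "\<lambda>_. 2::nat" and U = U] by (simp add: power_sum)
  then show ?thesis by simp
qed

lemma out_empty: "a \<in> A \<Longrightarrow> out {} a = 2"
  using ends[of a] by (simp add: out_def)

definition glued_sum :: "real \<Rightarrow> real" where
  "glued_sum x = (\<Sum>U\<in>Pow V. x ^ card U * (\<Prod>a\<in>A. (1 + x)\<^sup>2 * ((1 + x) ^ out U a + real (out U a) * x * (1 + x) ^ (out U a - 1))))"

text \<open>The product \<open>\<Psi>\<close> of the vertex forms and the forms \<open>X + T a\<close> is differentiated once for every edge. Expanding
  the vertex forms turns \<open>\<Psi>\<close> into a sum over the sets \<open>U\<close> of products in which every edge variable
  sits in its own factor \<open>F U a\<close>. On the line through the point \<open>(x, 1)\<close>, where the edge variables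
  vanish, this evaluates to \<open>glued_sum\<close> up to a power of \<open>x\<close>.\<close>

theorem glued_sum_log_concave:
  "\<exists>N K \<phi>. (\<forall>x. x ^ K * glued_sum x = (\<Sum>i\<le>N. \<phi> i / (fact i * fact (N - i)) * x ^ i)) \<and>
     (\<forall>i. 1 \<le> i \<longrightarrow> i < N \<longrightarrow> \<phi> (i - 1) * \<phi> (i + 1) \<le> (\<phi> i)\<^sup>2)"
proof -
  obtain k where k: "\<And>v. clc_form vars (2 * k v + 1 + 2 * deg v) (vform (k v) v)" using clc_form_vform by metis
  obtain es where es: "set es = A" "distinct es" using finite_distinct_list[OF finA] by blast
  define \<Psi> where "\<Psi> = (\<Prod>a\<in>A. X + T a) * (\<Prod>v\<in>V. vform (k v) v)"
  define N where "N = (\<Sum>v\<in>V. 2 * k v + 1 + 2 * deg v)"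
  define \<Phi> where "\<Phi> = Ders (map (\<lambda>a. basis (Tv a)) es) \<Psi>"
  have \<Psi>: "clc_form vars ((\<Sum>a\<in>A. 1) + N) \<Psi>"
    unfolding \<Psi>_def N_def by (intro clc_form_mult clc_form_prod fin_vars finA finV k clc_form_linear lin)
  have "length es = card A" using es distinct_card by fastforce
  moreover have "form vars ((\<Sum>a\<in>A. 1) + N - length (map (\<lambda>a. basis (Tv a)) es)) \<Phi>"
    unfolding \<Phi>_def by (rule form_Ders) (use \<Psi> in \<open>auto simp: clc_form_def\<close>)
  moreover have "clc \<Phi>" unfolding \<Phi>_def by (rule clc_Ders) (use \<Psi> in \<open>auto simp: clc_form_def\<close>)
  ultimately have \<Phi>: "form vars N \<Phi>" "clc \<Phi>" by simp_all
  define C where "C U = (\<Prod>v\<in>V. mon (k v) v) * (\<Prod>v\<in>U. X * Y ^ deg v) * (\<Prod>v\<in>V - U. Y)" for U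
  define F where "F U a = (X + T a) * (T a + S) ^ out U a" for U a
  have \<Psi>_eq: "\<Psi> = (\<Sum>U\<in>Pow V. C U * (\<Prod>a\<in>A. F U a))"
  proof -
    have "(\<Prod>v\<in>V. vform (k v) v) = (\<Prod>v\<in>V. mon (k v) v) * (\<Prod>v\<in>V. X * Y ^ deg v + Y * (\<Prod>a\<in>inc v. T a + S))"
      unfolding vform_def prod.distrib by (simp only: add.commute)
    also have "(\<Prod>v\<in>V. X * Y ^ deg v + Y * (\<Prod>a\<in>inc v. T a + S)) =
        (\<Sum>U\<in>Pow V. (\<Prod>v\<in>U. X * Y ^ deg v) * ((\<Prod>v\<in>V - U. Y) * (\<Prod>a\<in>A. (T a + S) ^ out U a)))"
      unfolding prod_add[OF finV] prod.distrib inc_swap_prod ..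
    finally have vv: "(\<Prod>v\<in>V. vform (k v) v) = (\<Prod>v\<in>V. mon (k v) v) *
        (\<Sum>U\<in>Pow V. (\<Prod>v\<in>U. X * Y ^ deg v) * ((\<Prod>v\<in>V - U. Y) * (\<Prod>a\<in>A. (T a + S) ^ out U a)))" .
    show ?thesis
      unfolding \<Psi>_def vv C_def F_def prod.distrib sum_distrib_left by (intro sum.cong refl) (simp only: mult_ac)
  qed
  have DF: "Der (basis (Tv a)) (F U b) = of_bool (a = b) * ((T b + S) ^ out U b + of_nat (out U b) * ((X + T b) * (T b + S) ^ (out U b - 1)))" for a b U
    by (cases "a = b") (simp_all add: F_def Der_mult Der_power Der_coord basis_Tv algebra_simps)
  have \<Phi>_eq: "\<Phi> = (\<Sum>U\<in>Pow V. C U * (\<Prod>a\<in>A. (T a + S) ^ out U a + of_nat (out U a) * ((X + T a) * (T a + S) ^ (out U a - 1))))"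
    unfolding \<Phi>_def \<Psi>_eq Ders_sum
  proof (intro sum.cong refl)
    fix U
    have CC: "Der (basis (Tv a)) (C U) = 0" for a
    proof -
      have "Der (basis (Tv a)) (\<Prod>v\<in>V. mon (k v) v) = 0" "Der (basis (Tv a)) (\<Prod>v\<in>U. X * Y ^ deg v) = 0" "Der (basis (Tv a)) (\<Prod>v\<in>V - U. Y) = 0"
        by (intro Der_prod_zero; simp add: mon_def Der_mult Der_power Der_coord basis_Tv)+
      then show ?thesis by (simp add: C_def Der_mult)
    qed
    have "Ders (map (\<lambda>a. basis (Tv a)) es) (C U * (\<Prod>a\<in>set es. F U a)) = C U * (\<Prod>a\<in>set es. Der (basis (Tv a)) (F U a))"
    proof (rule Ders_separate[OF es(2)])
      fix a b :: "'a \<times> 'a" assume "a \<noteq> b"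
      then show "Der (basis (Tv a)) (F U b) = 0" by (simp add: DF)
      show "Der (basis (Tv a)) (Der (basis (Tv b)) (F U b)) = 0"
        using \<open>a \<noteq> b\<close> by (simp add: DF Der_mult Der_power Der_coord basis_Tv)
    qed (rule CC)
    then show "Ders (map (\<lambda>a. basis (Tv a)) es) (C U * (\<Prod>a\<in>A. F U a)) =
       C U * (\<Prod>a\<in>A. (T a + S) ^ out U a + of_nat (out U a) * ((X + T a) * (T a + S) ^ (out U a - 1)))"
      by (simp add: es DF)
  qed
  define K where "K = (\<Sum>v\<in>V. k v)"
  define \<phi> where "\<phi> i = dv \<Phi> (word2 Xv Yv i (N - i))" for i
  have eq: "x ^ K * glued_sum x = (\<Sum>i\<le>N. \<phi> i / (fact i * fact (N - i)) * x ^ i)" for x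
  proof -
    define p :: "('a \<times> 'a) var \<Rightarrow> real" where "p i = (if i = Xv then x else if i = Yv then 1 else 0)" for i
    have p: "p Xv = x" "p Yv = 1" "p (Tv a) = 0" for a by (auto simp: p_def)
    have vX: "line_value p 1 x X" and vY: "line_value p 1 1 Y" and vT: "line_value p 1 0 (T a)" for a
      using line_value_coord[of p Xv] line_value_coord[of p Yv] line_value_coord[of p "Tv a"] by (simp_all add: p)
    have vS: "line_value p 1 (1 + x) S" using line_value_add[OF vX vY] by (simp add: add.commute)
    have vL: "line_value p 1 (1 + x) (T a + S)" for a using line_value_add[OF vT vS] by simp
    have vXT: "line_value p 1 x (X + T a)" for a using line_value_add[OF vX vT] by simp
    have vYn: "line_value p n 1 (Y ^ n)" for n using line_value_power1[OF vY, of n] by simp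
    have vE: "line_value p (out U a) ((1 + x) ^ out U a + real (out U a) * x * (1 + x) ^ (out U a - 1))
        ((T a + S) ^ out U a + of_nat (out U a) * ((X + T a) * (T a + S) ^ (out U a - 1)))" for U a
    proof (cases "out U a")
      case 0
      then show ?thesis by (simp add: line_value_1)
    next
      case (Suc m)
      have "line_value p (1 + m) (x * (1 + x) ^ m) ((X + T a) * (T a + S) ^ m)" by (intro line_value_mult vXT line_value_power1 vL)
      then have "line_value p (Suc m) (real (Suc m) * (x * (1 + x) ^ m)) (of_nat (Suc m) * ((X + T a) * (T a + S) ^ m))"
        using line_value_of_nat[of p "Suc m"] by (metis plus_1_eq_Suc)
      then have "line_value p (Suc m) ((1 + x) ^ Suc m + real (Suc m) * (x * (1 + x) ^ m))
          ((T a + S) ^ Suc m + of_nat (Suc m) * ((X + T a) * (T a + S) ^ m))"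
        by (rule line_value_add[OF line_value_power1[OF vL]])
      then show ?thesis by (simp only: Suc diff_Suc_1 mult.assoc)
    qed
    have vM: "line_value p (2 * k v + deg v) (x ^ k v * (1 + x) ^ deg v) (mon (k v) v)" for v
    proof -
      have "line_value p (k v + k v + deg v) (x ^ k v * 1 * (1 + x) ^ deg v) (mon (k v) v)"
        unfolding mon_def by (intro line_value_mult line_value_power1 vX vYn vS)
      then show ?thesis by (simp add: mult_2)
    qed
    have vU: "line_value p (1 + deg v) (x * 1) (X * Y ^ deg v)" for v by (intro line_value_mult vX vYn)
    have "line_value p N (\<Sum>U\<in>Pow V. ((\<Prod>v\<in>V. x ^ k v * (1 + x) ^ deg v) * (\<Prod>v\<in>U. x * 1) * (\<Prod>v\<in>V - U. 1)) *
        (\<Prod>a\<in>A. (1 + x) ^ out U a + real (out U a) * x * (1 + x) ^ (out U a - 1))) \<Phi>"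
      unfolding \<Phi>_eq
    proof (rule line_value_sum)
      fix U assume "U \<in> Pow V"
      then have U: "U \<subseteq> V" by simp
      have "line_value p ((\<Sum>v\<in>V. 2 * k v + deg v) + (\<Sum>v\<in>U. 1 + deg v) + (\<Sum>v\<in>V - U. 1) + (\<Sum>a\<in>A. out U a))
          (((\<Prod>v\<in>V. x ^ k v * (1 + x) ^ deg v) * (\<Prod>v\<in>U. x * 1) * (\<Prod>v\<in>V - U. 1)) *
        (\<Prod>a\<in>A. (1 + x) ^ out U a + real (out U a) * x * (1 + x) ^ (out U a - 1)))
          (C U * (\<Prod>a\<in>A. (T a + S) ^ out U a + of_nat (out U a) * ((X + T a) * (T a + S) ^ (out U a - 1))))"
        unfolding C_def by (intro line_value_mult line_value_prod vM vU vY vE)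
      moreover have "(\<Sum>v\<in>V. 2 * k v + deg v) + (\<Sum>v\<in>U. 1 + deg v) + (\<Sum>v\<in>V - U. 1) + (\<Sum>a\<in>A. out U a) = N"
      proof -
        have s: "sum h V = sum h U + sum h (V - U)" for h :: "'a \<Rightarrow> nat"
          using sum.subset_diff[OF U finV, of h] by simp
        have "(\<Sum>v\<in>V. 2 * k v + deg v) + (\<Sum>v\<in>U. 1 + deg v) + (\<Sum>v\<in>V - U. 1) + (\<Sum>v\<in>V - U. deg v) = N"
          unfolding N_def s by (simp add: sum.distrib sum_Suc sum_distrib_left[symmetric])
        then show ?thesis using inc_swap_sum by simp
      qed
      ultimately show "line_value p N (((\<Prod>v\<in>V. x ^ k v * (1 + x) ^ deg v) * (\<Prod>v\<in>U. x * 1) * (\<Prod>v\<in>V - U. 1)) *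
        (\<Prod>a\<in>A. (1 + x) ^ out U a + real (out U a) * x * (1 + x) ^ (out U a - 1)))
          (C U * (\<Prod>a\<in>A. (T a + S) ^ out U a + of_nat (out U a) * ((X + T a) * (T a + S) ^ (out U a - 1))))"
        by simp
    qed
    also have "(\<Sum>U\<in>Pow V. ((\<Prod>v\<in>V. x ^ k v * (1 + x) ^ deg v) * (\<Prod>v\<in>U. x * 1) * (\<Prod>v\<in>V - U. 1)) *
        (\<Prod>a\<in>A. (1 + x) ^ out U a + real (out U a) * x * (1 + x) ^ (out U a - 1))) = x ^ K * glued_sum x"
    proof -
      have "(\<Prod>v\<in>V. (1 + x) ^ deg v) = (\<Prod>a\<in>A. (1 + x)\<^sup>2)"
        using inc_swap_prod[where U = "{}" and L = "\<lambda>_. 1 + x"] out_empty by simp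
      then have "(\<Prod>v\<in>V. x ^ k v * (1 + x) ^ deg v) = x ^ K * (\<Prod>a\<in>A. (1 + x)\<^sup>2)"
        by (simp add: prod.distrib K_def power_sum)
      then show ?thesis
        unfolding glued_sum_def sum_distrib_left by (intro sum.cong refl) (simp add: prod.distrib mult_ac)
    qed
    finally have "dv \<Phi> (replicate N p) = fact N * (x ^ K * glued_sum x)" by (rule line_value_dv)
    moreover have "dv \<Phi> (replicate N p) = (\<Sum>i\<le>N. real (N choose i) * x ^ i * \<phi> i)"
      unfolding \<phi>_def by (rule dv_on_line[OF fin_vars _ _ _ p_def \<Phi>(1)]) (auto simp: vars_def)
    ultimately have "fact N * (x ^ K * glued_sum x) = (\<Sum>i\<le>N. fact N * (\<phi> i / (fact i * fact (N - i)) * x ^ i))"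
      by (simp add: binomial_fact mult_ac)
    then show ?thesis unfolding sum_distrib_left[symmetric] by simp
  qed
  have lc: "\<phi> (i - 1) * \<phi> (i + 1) \<le> (\<phi> i)\<^sup>2" if i: "1 \<le> i" "i < N" for i
  proof -
    have "N - (i - 1) = N - i + 1" "N - (i + 1) = N - i - 1" using i by auto
    then show ?thesis unfolding \<phi>_def using clc_word2[OF \<Phi> i, of Xv Yv] by simp
  qed
  show ?thesis using eq lc by blast
qed

end

section \<open>Independent sets of the edge replacement\<close>

definition W4_inner :: "W4_vertex set" where
  "W4_inner = {p_vertex 2, p_vertex 3, q_vertex 1, q_vertex 2, q_vertex 3, q_vertex 4}"

text \<open>The independent sets of inner vertices, when \<open>a\<close> and \<open>b\<close> tell whether the endpoints \<open>p\<^sub>1\<close> and \<open>p\<^sub>4\<close> have been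
  chosen.\<close>

definition W4_free :: "bool \<Rightarrow> bool \<Rightarrow> W4_vertex set \<Rightarrow> bool" where
  "W4_free a b T \<longleftrightarrow>
     (a \<longrightarrow> p_vertex 2 \<notin> T \<and> q_vertex 1 \<notin> T) \<and> (b \<longrightarrow> p_vertex 3 \<notin> T \<and> q_vertex 4 \<notin> T) \<and>
     \<not> (p_vertex 2 \<in> T \<and> p_vertex 3 \<in> T) \<and> \<not> (p_vertex 2 \<in> T \<and> q_vertex 2 \<in> T) \<and> \<not> (p_vertex 3 \<in> T \<and> q_vertex 3 \<in> T)"

lemma sum_Pow_insert:
  assumes "finite A" "a \<notin> A"
  shows "(\<Sum>T\<in>Pow (insert a A). f T) = (\<Sum>T\<in>Pow A. f T) + (\<Sum>T\<in>Pow A. f (insert a T))"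
proof -
  have "(\<Sum>T\<in>Pow (insert a A). f T) = (\<Sum>T\<in>Pow A. f T) + (\<Sum>T\<in>insert a ` Pow A. f T)"
    unfolding Pow_insert using assms by (intro sum.union_disjoint) auto
  also have "(\<Sum>T\<in>insert a ` Pow A. f T) = (\<Sum>T\<in>Pow A. f (insert a T))"
    by (rule sum.reindex_cong[of "insert a"]) (use assms in \<open>auto simp: inj_on_def\<close>)
  finally show ?thesis .
qed

text \<open>By enumeration of the 64 sets of inner vertices. A factor \<open>(1 + x)\<^sup>2\<close> splits off in every case; it
  is what makes the vertex form of a vertex with two edges completely log-concave.\<close>

lemma W4_sum:
  fixes x :: real
  shows "(\<Sum>T\<in>{T. T \<subseteq> W4_inner \<and> W4_free a b T}. x ^ card T) =
    (1 + x)\<^sup>2 * (if a \<and> b then 1 else if a \<or> b then 1 + 2 * x else (1 + x)\<^sup>2 + 2 * x * (1 + x))"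
proof -
  have "(\<Sum>T\<in>{T. T \<subseteq> W4_inner \<and> W4_free a b T}. x ^ card T) =
      (\<Sum>T\<in>{T \<in> Pow W4_inner. W4_free a b T}. x ^ card T)" by (rule sum.cong) auto
  also have "\<dots> = (\<Sum>T\<in>Pow W4_inner. if W4_free a b T then x ^ card T else 0)"
    by (rule sum.inter_filter) (simp add: W4_inner_def)
  also have "\<dots> = (1 + x)\<^sup>2 * (if a \<and> b then 1 else if a \<or> b then 1 + 2 * x else (1 + x)\<^sup>2 + 2 * x * (1 + x))"
    unfolding W4_inner_def
    by (cases a; cases b) (simp_all add: sum_Pow_insert W4_free_def, simp_all add: eval_nat_numeral algebra_simps)
  finally show ?thesis .
qed

lemma W4_edges_explicit:
  "W4_edges = {(p_vertex 1, p_vertex 2), (p_vertex 2, p_vertex 3), (p_vertex 3, p_vertex 4),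
     (p_vertex 1, q_vertex 1), (p_vertex 2, q_vertex 2), (p_vertex 3, q_vertex 3), (p_vertex 4, q_vertex 4)}"
proof -
  have "{1..4::nat} = {1, 2, 3, 4}" by auto
  then show ?thesis unfolding W4_edges_def by auto
qed

lemma W4_verts_explicit: "pverts W4 = {p_vertex 1, p_vertex 4} \<union> W4_inner"
proof -
  have "{1..4::nat} = {1, 2, 3, 4}" by auto
  then show ?thesis unfolding W4_def W4_inner_def by auto
qed

locale W4_replacement =
  fixes G :: "'a pair_pre_digraph" and A :: "('a \<times> 'a) set"
  assumes G: "pair_graph G" and A: "orientation A G"
begin

sublocale pair_graph G by (rule G)

lemma A_arcs: "A \<subseteq> parcs G" using A by (simp add: orientation_def)

lemma finite_A: "finite A" using A_arcs pair_finite_arcs finite_subset by blast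

lemma A_ends: "a \<in> A \<Longrightarrow> fst a \<in> pverts G \<and> snd a \<in> pverts G \<and> fst a \<noteq> snd a"
  using A_arcs pair_no_loops by (auto simp: subset_eq dest: in_arcsD1 in_arcsD2) 

lemma verts_R: "pverts (R_W4 A G) = Inl ` pverts G \<union> Inr ` (A \<times> W4_inner)"
proof -
  have "copy_vertex (p_vertex 1) (p_vertex 4) a ` pverts W4 = {Inl (fst a), Inl (snd a)} \<union> Inr ` ({a} \<times> W4_inner)" for a :: "'a \<times> 'a"
    unfolding W4_verts_explicit by (auto simp: copy_vertex_def W4_inner_def)
  then have "(\<Union>a\<in>A. copy_vertex (p_vertex 1) (p_vertex 4) a ` pverts W4) = (\<Union>a\<in>A. {Inl (fst a), Inl (snd a)} \<union> Inr ` ({a} \<times> W4_inner))"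
    by (simp only:)
  also have "\<dots> = (\<Union>a\<in>A. {Inl (fst a), Inl (snd a)}) \<union> Inr ` (A \<times> W4_inner)" by auto
  finally have "(\<Union>a\<in>A. copy_vertex (p_vertex 1) (p_vertex 4) a ` pverts W4) = (\<Union>a\<in>A. {Inl (fst a), Inl (snd a)}) \<union> Inr ` (A \<times> W4_inner)" .
  then show ?thesis unfolding R_W4_def edge_replacement_def using A_ends by auto
qed

lemma independent_R:
  "S \<in> independent_sets (R_W4 A G) \<longleftrightarrow> S \<subseteq> Inl ` pverts G \<union> Inr ` (A \<times> W4_inner) \<and>
     (\<forall>a\<in>A. W4_free (Inl (fst a) \<in> S) (Inl (snd a) \<in> S) {h. Inr (a, h) \<in> S})"
proof -
  define cv :: "'a \<times> 'a \<Rightarrow> W4_vertex \<Rightarrow> _" where "cv = copy_vertex (p_vertex 1) (p_vertex 4)"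
  have arcs: "(u, v) \<in> parcs (R_W4 A G) \<longleftrightarrow> (\<exists>a\<in>A. \<exists>g h. (g, h) \<in> W4_edges \<union> W4_edges\<inverse> \<and> u = cv a g \<and> v = cv a h)" for u v
    by (force simp: R_W4_def edge_replacement_def W4_def cv_def)
  have "(\<forall>u\<in>S. \<forall>v\<in>S. (u, v) \<notin> parcs (R_W4 A G)) \<longleftrightarrow> (\<forall>a\<in>A. \<forall>(g, h)\<in>W4_edges. \<not> (cv a g \<in> S \<and> cv a h \<in> S))"
    unfolding arcs by blast
  also have "\<dots> \<longleftrightarrow> (\<forall>a\<in>A. W4_free (Inl (fst a) \<in> S) (Inl (snd a) \<in> S) {h. Inr (a, h) \<in> S})"
    unfolding W4_edges_explicit W4_free_def by (auto simp: cv_def copy_vertex_def)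
  finally show ?thesis unfolding independent_sets_def verts_R by blast
qed

text \<open>Once the vertices of \<open>G\<close> have been chosen, the copies of \<open>W4\<close> are independent of each other.\<close>

lemma independence_sum:
  fixes x :: real
  shows "(\<Sum>S\<in>independent_sets (R_W4 A G). x ^ card S) =
    (\<Sum>U\<in>Pow (pverts G). x ^ card U * (\<Prod>a\<in>A. \<Sum>T\<in>{T. T \<subseteq> W4_inner \<and> W4_free (fst a \<in> U) (snd a \<in> U) T}. x ^ card T))"
proof -
  define B where "B U a = {T. T \<subseteq> W4_inner \<and> W4_free (fst a \<in> U) (snd a \<in> U) T}" for U and a :: "'a \<times> 'a"
  have finB: "finite (B U a)" for U a
    by (rule finite_subset[of _ "Pow W4_inner"]) (auto simp: B_def W4_inner_def)
  have finT: "finite T" if "T \<in> B U a" for T U a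
    using that by (auto simp: B_def W4_inner_def intro: finite_subset)
  have "(\<Sum>U\<in>Pow (pverts G). x ^ card U * (\<Prod>a\<in>A. \<Sum>T\<in>B U a. x ^ card T)) =
     (\<Sum>U\<in>Pow (pverts G). \<Sum>t\<in>PiE A (B U). x ^ card U * (\<Prod>a\<in>A. x ^ card (t a)))"
    by (simp add: prod_sum_PiE[OF finite_A finB] sum_distrib_left)
  also have "\<dots> = (\<Sum>(U, t)\<in>(SIGMA U:Pow (pverts G). PiE A (B U)). x ^ card U * (\<Prod>a\<in>A. x ^ card (t a)))"
    by (rule sum.Sigma) (auto intro!: finite_PiE finite_A finB)
  also have "\<dots> = (\<Sum>S\<in>independent_sets (R_W4 A G). x ^ card S)"
  proof (rule sum.reindex_bij_witness[where
      i = "\<lambda>S. ({v. Inl v \<in> S}, \<lambda>a\<in>A. {h. Inr (a, h) \<in> S})" and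
      j = "\<lambda>(U, t). Inl ` U \<union> Inr ` (SIGMA a:A. t a)"], goal_cases)
    case (1 p)
    then obtain U t where p: "p = (U, t)" "U \<subseteq> pverts G" "t \<in> PiE A (B U)" by auto
    have "(\<lambda>a\<in>A. {h. a \<in> A \<and> h \<in> t a}) = t" using p(3) by (auto simp: fun_eq_iff PiE_def extensional_def)
    moreover have "{v. Inl v \<in> Inl ` U \<union> Inr ` (SIGMA a:A. t a)} = U" by auto
    moreover have "{h. Inr (a, h) \<in> Inl ` U \<union> Inr ` (SIGMA a:A. t a)} = {h. a \<in> A \<and> h \<in> t a}" for a by auto
    ultimately show ?case unfolding p by simp
  next
    case (2 p)
    then obtain U t where p: "p = (U, t)" "U \<subseteq> pverts G" "t \<in> PiE A (B U)" by auto
    have t: "t a \<subseteq> W4_inner" "W4_free (fst a \<in> U) (snd a \<in> U) (t a)" if "a \<in> A" for a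
      using PiE_mem[OF p(3) that] by (simp_all add: B_def)
    have v: "Inl v \<in> Inl ` U \<union> Inr ` (SIGMA a:A. t a) \<longleftrightarrow> v \<in> U" for v by auto
    have h: "{h. Inr (a, h) \<in> Inl ` U \<union> Inr ` (SIGMA a:A. t a)} = t a" if "a \<in> A" for a using that by auto
    have "Inl ` U \<union> Inr ` (SIGMA a:A. t a) \<subseteq> Inl ` pverts G \<union> Inr ` (A \<times> W4_inner)"
      using p(2) t(1) by (intro Un_mono image_mono Sigma_mono) auto
    then show ?case unfolding p independent_R prod.case v 
    proof (intro conjI ballI)
      fix a assume a: "a \<in> A"
      show "W4_free (fst a \<in> U) (snd a \<in> U) {h. Inr (a, h) \<in> Inl ` U \<union> Inr ` (SIGMA a:A. t a)}"
        unfolding h[OF a] by (rule t(2)[OF a])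
    qed
  next
    case (3 S)
    have S: "S \<subseteq> Inl ` pverts G \<union> Inr ` (A \<times> W4_inner)" using 3 by (simp add: independent_R)
    have "(SIGMA a:A. (\<lambda>a\<in>A. {h. Inr (a, h) \<in> S}) a) = {(a, h). Inr (a, h) \<in> S}" using S by auto
    moreover have "Inl ` {v. Inl v \<in> S} \<union> Inr ` {(a, h). Inr (a, h) \<in> S} = S"
    proof (rule Set.set_eqI)
      fix s show "s \<in> Inl ` {v. Inl v \<in> S} \<union> Inr ` {(a, h). Inr (a, h) \<in> S} \<longleftrightarrow> s \<in> S"
        by (cases s) auto
    qed
    ultimately show ?case by (simp only: prod.case)
  next
    case (4 S)
    then have S: "S \<subseteq> Inl ` pverts G \<union> Inr ` (A \<times> W4_inner)"
      and f: "\<And>a. a \<in> A \<Longrightarrow> W4_free (Inl (fst a) \<in> S) (Inl (snd a) \<in> S) {h. Inr (a, h) \<in> S}"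
      by (auto simp: independent_R)
    have "{h. Inr (a, h) \<in> S} \<subseteq> W4_inner" for a using S by auto
    then have "(\<lambda>a\<in>A. {h. Inr (a, h) \<in> S}) \<in> PiE A (B {v. Inl v \<in> S})"
      using f by (auto simp: B_def)
    then show ?case using S by auto
  next
    case (5 p)
    then obtain U t where p: "p = (U, t)" "U \<subseteq> pverts G" "t \<in> PiE A (B U)" by auto
    have fU: "finite U" using p(2) pair_finite_verts finite_subset by blast
    have ft: "finite (t a)" if "a \<in> A" for a by (rule finT[OF PiE_mem[OF p(3) that]])
    have "card (Inl ` U \<union> Inr ` (SIGMA a:A. t a)) =
        card (Inl ` U :: ('a + ('a \<times> 'a) \<times> W4_vertex) set) + card (Inr ` (SIGMA a:A. t a) :: ('a + ('a \<times> 'a) \<times> W4_vertex) set)"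
      by (rule Finite_Set.card_Un_disjoint) (use fU finite_A ft in auto)
    also have "\<dots> = card U + (\<Sum>a\<in>A. card (t a))"
      using finite_A ft by (simp add: card_image)
    finally show ?case unfolding p by (simp add: power_add power_sum)
  qed
  finally show ?thesis by (simp add: B_def)
qed

end

section \<open>Bivariate Lorentzian polynomials\<close>

lemma det_2x2:
  assumes "A \<in> carrier_mat 2 2"
  shows "det A = A $$ (0,0) * A $$ (1,1) - A $$ (0,1) * A $$ (1,0)"
proof -
  have c: "mat_delete A 0 j \<in> carrier_mat 1 1" for j
    using mat_delete_carrier[OF assms, of 0 j] by simp
  have "det A = (\<Sum>j<2. A $$ (0, j) * cofactor A 0 j)"
    by (rule laplace_expansion_row[OF assms]) simp
  also have "\<dots> = A $$ (0,0) * det (mat_delete A 0 0) - A $$ (0,1) * det (mat_delete A 0 1)"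
    by (simp add: numeral_2_eq_2 cofactor_def)
  finally have "det A = A $$ (0,0) * det (mat_delete A 0 0) - A $$ (0,1) * det (mat_delete A 0 1)" .
  moreover have "det (mat_delete A 0 0) = A $$ (1,1)" "det (mat_delete A 0 1) = A $$ (1,0)"
    using assms by (subst det_single[OF c], simp add: mat_delete_def)+
  ultimately show ?thesis by (simp only:)
qed

text \<open>The determinant is the product of the two eigenvalues.\<close>

lemma one_positive_eigenvalue_2x2:
  fixes M :: "real mat"
  assumes M: "M \<in> carrier_mat 2 2" and sym: "M $$ (0,1) = M $$ (1,0)"
    and det: "M $$ (0,0) * M $$ (1,1) \<le> (M $$ (0,1))\<^sup>2"
  shows "at_most_one_positive_eigenvalue M"
proof -
  define t where "t = M $$ (0,0) + M $$ (1,1)"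
  define dt where "dt = M $$ (0,0) * M $$ (1,1) - (M $$ (0,1))\<^sup>2"
  have cp: "char_poly M = [:dt, - t, 1:]"
  proof -
    have "char_poly_matrix M \<in> carrier_mat 2 2" using M by simp
    then have "char_poly M = char_poly_matrix M $$ (0,0) * char_poly_matrix M $$ (1,1) - char_poly_matrix M $$ (0,1) * char_poly_matrix M $$ (1,0)"
      unfolding char_poly_def by (rule det_2x2)
    then show ?thesis using M sym
      by (simp add: char_poly_matrix_def t_def dt_def power2_eq_square algebra_simps)
  qed
  have ne: "char_poly M \<noteq> 0" by (simp add: cp)
  have root: "r * r - t * r + dt = 0" if "r \<in># proots (char_poly M)" for r
    using that ne by (simp add: cp algebra_simps)
  define F where "F = filter_mset (\<lambda>e. e > 0) (proots (char_poly M))"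
  have "size F \<le> 1"
  proof (rule ccontr)
    assume "\<not> size F \<le> 1"
    then have "size F \<noteq> 0" "size F \<noteq> 1" by auto
    then obtain r F' where F': "F = add_mset r F'" by (metis multiset_cases size_empty)
    then have "F' \<noteq> {#}" using \<open>size F \<noteq> 1\<close> by auto
    then obtain s F'' where "F' = add_mset s F''" by (metis multiset_cases)
    then have F: "F = {#r, s#} + F''" using F' by simp
    have "r \<in># F" "s \<in># F" using F by auto
    then have pos: "r > 0" "s > 0" and rs: "r \<in># proots (char_poly M)" "s \<in># proots (char_poly M)" by (auto simp: F_def)
    have "r * s = dt"
    proof (cases "r = s")
      case False
      have "(r - s) * (r + s - t) = 0" using root[OF rs(1)] root[OF rs(2)] by (simp add: algebra_simps)
      then have t: "t = r + s" using False by simp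
      show ?thesis using root[OF rs(1)] unfolding t by (simp add: algebra_simps)
    next
      case True
      have "{#r, r#} \<subseteq># proots (char_poly M)"
        using F True unfolding F_def by (metis mset_subset_eq_add_left multiset_filter_subset subset_mset.order_trans)
      then have "count {#r, r#} r \<le> count (proots (char_poly M)) r" by (rule mset_subset_eq_count)
      then have "Polynomial.order r (char_poly M) \<ge> 2" using ne by simp
      then have "[:- r, 1:] ^ 2 dvd char_poly M" by (metis order_1 power_le_dvd)
      then obtain q where "char_poly M = [:- r, 1:] ^ 2 * q" by (elim dvdE)
      then have q: "char_poly M = [:- r, 1:] * ([:- r, 1:] * q)" by (simp only: power2_eq_square mult.assoc)
      have "poly [:- r, 1:] r = 0" by simp
      then have "poly (pderiv (char_poly M)) r = 0"
        unfolding q by (simp only: pderiv_mult poly_add poly_mult)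
      then have "t = r + r" by (simp add: cp pderiv_pCons)
      then show ?thesis using root[OF rs(1)] True by (simp add: algebra_simps)
    qed
    then show False using det pos mult_pos_pos[OF pos] by (simp add: dt_def)
  qed
  then show ?thesis by (simp add: at_most_one_positive_eigenvalue_def F_def)
qed

lemma lookup_partial_deriv:
  "Poly_Mapping.lookup (partial_deriv v p) m =
     real (Poly_Mapping.lookup m v + 1) * Poly_Mapping.lookup p (m + Poly_Mapping.single v 1)"
proof -
  define m' where "m' = m + Poly_Mapping.single v 1"
  have m': "Poly_Mapping.lookup m' v = Poly_Mapping.lookup m v + 1" "m' - Poly_Mapping.single v 1 = m"
    by (simp_all add: m'_def lookup_add)
  have eq: "n = m'" if "n - Poly_Mapping.single v 1 = m" "Poly_Mapping.lookup n v \<noteq> 0" for n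
  proof (rule poly_mapping_eqI)
    fix w
    have "Poly_Mapping.lookup n w - Poly_Mapping.lookup (Poly_Mapping.single v 1) w = Poly_Mapping.lookup m w"
      using that(1) by (metis lookup_minus)
    then show "Poly_Mapping.lookup n w = Poly_Mapping.lookup m' w"
      using that(2) by (cases "w = v") (auto simp: m'_def lookup_add lookup_single)
  qed
  have "Poly_Mapping.lookup (partial_deriv v p) m =
     (\<Sum>n\<in>Poly_Mapping.keys p. if n = m' then real (Poly_Mapping.lookup n v) * Poly_Mapping.lookup p n else 0)"
    unfolding partial_deriv_def lookup_sum
  proof (intro sum.cong refl)
    fix n
    show "Poly_Mapping.lookup (Poly_Mapping.single (n - Poly_Mapping.single v 1) (real (Poly_Mapping.lookup n v) * Poly_Mapping.lookup p n)) m =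
        (if n = m' then real (Poly_Mapping.lookup n v) * Poly_Mapping.lookup p n else 0)"
    proof (cases "Poly_Mapping.lookup n v = 0")
      case False
      have "n - Poly_Mapping.single v 1 = m \<longleftrightarrow> n = m'" using eq[OF _ False] m'(2) by blast
      then show ?thesis unfolding lookup_single when_def by argo
    qed (auto simp: lookup_single when_def)
  qed
  also have "\<dots> = real (Poly_Mapping.lookup m' v) * Poly_Mapping.lookup p m'"
    by (simp add: in_keys_iff)
  finally show ?thesis by (simp add: m'_def lookup_add)
qed

text \<open>The monomial \<open>x\<^sup>i y\<^sup>j\<close>, where \<open>x\<close> has colour \<open>b\<close>.\<close>

definition mono2 :: "'c \<Rightarrow> nat \<Rightarrow> nat \<Rightarrow> ('c option \<Rightarrow>\<^sub>0 nat)" where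
  "mono2 b i j = Poly_Mapping.single (Some b) i + Poly_Mapping.single None j"

lemma lookup_mono2: "Poly_Mapping.lookup (mono2 b i j) v = (if v = Some b then i else if v = None then j else 0)"
  by (auto simp: mono2_def lookup_add lookup_single when_def)

lemma mono2_add: "mono2 b i j + mono2 b i' j' = mono2 b (i + i') (j + j')"
  by (rule poly_mapping_eqI) (auto simp: lookup_add lookup_mono2)

lemma mono2_eq_iff [simp]: "mono2 b i j = mono2 b i' j' \<longleftrightarrow> i = i' \<and> j = j'"
proof
  assume "mono2 b i j = mono2 b i' j'"
  then have "Poly_Mapping.lookup (mono2 b i j) v = Poly_Mapping.lookup (mono2 b i' j') v" for v by simp
  from this[of "Some b"] this[of None] show "i = i' \<and> j = j'" by (simp add: lookup_mono2)
qed simp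

lemma single_mono2:
  "Poly_Mapping.single (Some b) (Suc 0) = mono2 b (Suc 0) 0" "Poly_Mapping.single None (Suc 0) = mono2 b 0 (Suc 0)"
  by (simp_all add: mono2_def)

lemma total_degree_mono2: "total_degree (mono2 b i j) = i + j"
proof -
  have "total_degree (mono2 b i j) = (\<Sum>v\<in>{Some b, None}. Poly_Mapping.lookup (mono2 b i j) v)"
    unfolding total_degree_def
    by (rule sum.mono_neutral_left) (auto simp: in_keys_iff lookup_mono2 split: if_splits)
  then show ?thesis by (simp add: lookup_mono2)
qed

lemma lookup_derivs:
  "set us \<subseteq> {Some b, None} \<Longrightarrow> Poly_Mapping.lookup (foldr partial_deriv us p) (mono2 b i j) =
     fact (i + count_list us (Some b)) / fact i * (fact (j + count_list us None) / fact j) *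
       Poly_Mapping.lookup p (mono2 b (i + count_list us (Some b)) (j + count_list us None))"
proof (induction us arbitrary: i j)
  case (Cons u us)
  have f: "real (n + 1) * (x / fact (Suc n)) = x / fact n" for n x
    by (simp add: divide_simps)
  from Cons.prems consider "u = Some b" | "u = None" by auto
  then show ?case
  proof cases
    case 1
    have "Poly_Mapping.lookup (foldr partial_deriv (u # us) p) (mono2 b i j) =
        real (i + 1) * Poly_Mapping.lookup (foldr partial_deriv us p) (mono2 b i j + mono2 b 1 0)"
      using 1 by (simp add: lookup_partial_deriv lookup_mono2 single_mono2)
    also have "\<dots> = real (i + 1) * (fact (Suc i + count_list us (Some b)) / fact (Suc i)) * (fact (j + count_list us None) / fact j) *
       Poly_Mapping.lookup p (mono2 b (Suc i + count_list us (Some b)) (j + count_list us None))"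
      using Cons.IH[of "Suc i" j] Cons.prems by (simp add: mono2_add mult.assoc)
    finally show ?thesis unfolding f using 1 by simp
  next
    case 2
    have "Poly_Mapping.lookup (foldr partial_deriv (u # us) p) (mono2 b i j) =
        real (j + 1) * Poly_Mapping.lookup (foldr partial_deriv us p) (mono2 b i j + mono2 b 0 1)"
      using 2 by (simp add: lookup_partial_deriv lookup_mono2 single_mono2(2)[of b])
    also have "\<dots> = fact (i + count_list us (Some b)) / fact i * (real (j + 1) * (fact (Suc j + count_list us None) / fact (Suc j))) *
       Poly_Mapping.lookup p (mono2 b (i + count_list us (Some b)) (Suc j + count_list us None))"
      using Cons.IH[of i "Suc j"] Cons.prems by (simp add: mono2_add mult_ac)
    finally show ?thesis unfolding f using 2 by simp
  qed
qed simp

text \<open>A derivative of order \<open>d - 2\<close> involves three consecutive coefficients, and the factorials make its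
  Hessian a Hankel matrix. The support is a segment.\<close>

lemma lorentzian_bivariate:
  fixes p :: "'c option rpoly" and a :: "nat \<Rightarrow> real"
  assumes keys: "\<And>m. Poly_Mapping.lookup p m \<noteq> 0 \<Longrightarrow> \<exists>i\<in>{l..u}. m = mono2 b i (d - i)"
    and a: "\<And>i. i \<in> {l..u} \<Longrightarrow> Poly_Mapping.lookup p (mono2 b i (d - i)) = a i" "\<And>i. i \<in> {l..u} \<Longrightarrow> a i > 0"
    and ud: "u \<le> d"
    and ulc: "\<And>i. l < i \<Longrightarrow> i < u \<Longrightarrow> (fact (i - 1) * fact (d - i + 1) * a (i - 1)) * (fact (i + 1) * fact (d - i - 1) * a (i + 1))
        \<le> (fact i * fact (d - i) * a i)\<^sup>2"
  shows "lorentzian {None, Some b} p"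
proof -
  have keyI: "m \<in> Poly_Mapping.keys p \<Longrightarrow> \<exists>i\<in>{l..u}. m = mono2 b i (d - i)" for m
    using keys by (simp add: in_keys_iff)
  have vars: "poly_vars p \<subseteq> {None, Some b}"
    unfolding poly_vars_def
  proof (intro UN_least subsetI)
    fix m v assume "m \<in> Poly_Mapping.keys p" "v \<in> Poly_Mapping.keys m"
    then show "v \<in> {None, Some b}" using keyI[of m] by (auto simp: in_keys_iff lookup_mono2 split: if_splits)
  qed
  have hom: "homogeneous d p"
    unfolding homogeneous_def using keyI ud by (fastforce simp: total_degree_mono2)
  have nn: "Poly_Mapping.lookup p m \<ge> 0" for m
    using keys[of m] a by (cases "Poly_Mapping.lookup p m = 0") (auto simp: less_imp_le)
  define g where "g i = (\<lambda>v. if v = Some b then int i else if v = None then int d - int i else 0)" for i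
  have supp: "support p = g ` {l..u}"
  proof (intro equalityI subsetI)
    fix \<alpha> assume "\<alpha> \<in> support p"
    then obtain m where m: "Poly_Mapping.lookup p m \<noteq> 0" "\<alpha> = (\<lambda>v. int (Poly_Mapping.lookup m v))" by (auto simp: support_def)
    then obtain i where i: "i \<in> {l..u}" "m = mono2 b i (d - i)" using keys by blast
    then have "\<alpha> = g i" using m(2) ud by (auto simp: g_def lookup_mono2)
    then show "\<alpha> \<in> g ` {l..u}" using i(1) by blast
  next
    fix \<alpha> assume "\<alpha> \<in> g ` {l..u}"
    then obtain i where i: "i \<in> {l..u}" "\<alpha> = g i" by blast
    then have "\<alpha> = (\<lambda>v. int (Poly_Mapping.lookup (mono2 b i (d - i)) v))" using ud by (auto simp: g_def lookup_mono2)
    moreover have "Poly_Mapping.lookup p (mono2 b i (d - i)) \<noteq> 0" using a i(1) by fastforce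
    ultimately show "\<alpha> \<in> support p" unfolding support_def by blast
  qed
  have conv: "M_convex (support p)"
    unfolding M_convex_def supp
  proof (intro conjI ballI allI impI)
    fix \<alpha> \<beta> v assume "\<alpha> \<in> g ` {l..u}" "\<beta> \<in> g ` {l..u}" and gt: "\<alpha> v > \<beta> v"
    then obtain i j where ij: "i \<in> {l..u}" "\<alpha> = g i" "j \<in> {l..u}" "\<beta> = g j" by blast
    consider "v = Some b" "i > j" | "v = None" "i < j" using gt ij by (auto simp: g_def split: if_splits)
    then show "\<exists>w. \<alpha> w < \<beta> w \<and> (\<lambda>x. \<alpha> x - of_bool (x = v) + of_bool (x = w)) \<in> g ` {l..u}"
    proof cases
      case 1
      have eq: "(\<lambda>x. \<alpha> x - of_bool (x = v) + of_bool (x = None)) = g (i - 1)"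
      proof (rule ext)
        fix x
        have "int (i - 1) = int i - 1" using 1 by simp
        then show "\<alpha> x - of_bool (x = v) + of_bool (x = None) = g (i - 1) x" using 1 ij by (simp add: g_def)
      qed
      have "i - 1 \<in> {l..u}" using 1 ij by auto
      then have "(\<lambda>x. \<alpha> x - of_bool (x = v) + of_bool (x = None)) \<in> g ` {l..u}" unfolding eq by (rule imageI)
      moreover have "\<alpha> None < \<beta> None" using 1 ij by (simp add: g_def)
      ultimately show ?thesis by blast
    next
      case 2
      have eq: "(\<lambda>x. \<alpha> x - of_bool (x = v) + of_bool (x = Some b)) = g (i + 1)"
        by (rule ext) (use 2 ij in \<open>simp add: g_def\<close>)
      have "i + 1 \<in> {l..u}" using 2 ij by auto
      then have "(\<lambda>x. \<alpha> x - of_bool (x = v) + of_bool (x = Some b)) \<in> g ` {l..u}" unfolding eq by (rule imageI)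
      moreover have "\<alpha> (Some b) < \<beta> (Some b)" using 2 ij by (simp add: g_def)
      ultimately show ?thesis by blast
    qed
  qed simp
  define q where "q i = (if i \<in> {l..u} then fact i * fact (d - i) * a i else 0)" for i
  have q: "fact i * fact (d - i) * Poly_Mapping.lookup p (mono2 b i (d - i)) = q i" for i
  proof (cases "i \<in> {l..u}")
    case False
    then have "Poly_Mapping.lookup p (mono2 b i (d - i)) = 0" using keys[of "mono2 b i (d - i)"] by auto
    then show ?thesis using False by (auto simp: q_def)
  qed (simp add: q_def a)
  have qlc: "q i * q (i + 2) \<le> (q (i + 1))\<^sup>2" for i
  proof (cases "l \<le> i \<and> i + 2 \<le> u")
    case True
    have "d - (i + 1) + 1 = d - i" "d - (i + 1) - 1 = d - (i + 2)" using True ud by auto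
    then show ?thesis using ulc[of "i + 1"] True by (simp add: q_def)
  next
    case False
    then have eq: "q i * q (i + 2) = 0" by (auto simp: q_def)
    show ?thesis unfolding eq by simp
  qed
  have hess: "at_most_one_positive_eigenvalue (hessian xs (foldr partial_deriv vs p))"
    if vs: "set vs \<subseteq> {None, Some b}" "length vs + 2 = d" and xs: "distinct xs" "set xs = {None, Some b}" for vs xs
  proof -
    define i where "i = count_list vs (Some b)"
    define j where "j = count_list vs None"
    have ij: "i + j + 2 = d"
    proof -
      have "count_list ws (Some b) + count_list ws None = length ws" if "set ws \<subseteq> {None, Some b}" for ws
        using that by (induction ws) auto
      then show ?thesis using vs by (simp add: i_def j_def)
    qed
    have entry: "Poly_Mapping.lookup (partial_deriv v (partial_deriv w (foldr partial_deriv vs p))) 0 =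
        q (i + count_list [v, w] (Some b))" if vw: "v \<in> {None, Some b}" "w \<in> {None, Some b}" for v w
    proof -
      have n: "count_list [v, w] None = 2 - count_list [v, w] (Some b)" "count_list [v, w] (Some b) \<le> 2" using vw by auto
      have sub: "set (v # w # vs) \<subseteq> {Some b, None}" using vs vw by auto
      have c: "count_list (v # w # vs) (Some b) = i + count_list [v, w] (Some b)"
        "count_list (v # w # vs) None = d - (i + count_list [v, w] (Some b))"
        using n ij vw by (auto simp: i_def j_def)
      have "Poly_Mapping.lookup (foldr partial_deriv (v # w # vs) p) (mono2 b 0 0) = q (i + count_list [v, w] (Some b))"
        unfolding lookup_derivs[OF sub] add_0 c fact_0 div_by_1 by (rule q)
      then show ?thesis by (simp add: mono2_def)
    qed
    have len: "length xs = 2" using distinct_card[OF xs(1)] xs(2) by simp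
    then obtain v w where xs': "xs = [v, w]" by (metis (no_types, lifting) One_nat_def Suc_1 length_0_conv length_Suc_conv)
    then have vw: "(v = None \<and> w = Some b) \<or> (v = Some b \<and> w = None)" using xs by auto
    define M where "M = hessian xs (foldr partial_deriv vs p)"
    have M: "M \<in> carrier_mat 2 2" by (simp add: M_def hessian_def len)
    have Me: "M $$ (0,0) = q (i + count_list [v, v] (Some b))" "M $$ (0,1) = q (i + count_list [v, w] (Some b))"
      "M $$ (1,0) = q (i + count_list [w, v] (Some b))" "M $$ (1,1) = q (i + count_list [w, w] (Some b))"
      using entry[of v v] entry[of v w] entry[of w v] entry[of w w] vw by (auto simp: M_def hessian_def xs')
    have "M $$ (0,0) * M $$ (1,1) \<le> (M $$ (0,1))\<^sup>2"
      unfolding Me using vw qlc[of i] by (auto simp: mult.commute)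
    moreover have "M $$ (0,1) = M $$ (1,0)" unfolding Me using vw by auto
    ultimately show ?thesis using one_positive_eigenvalue_2x2[OF M] by (simp add: M_def)
  qed
  show ?thesis
    unfolding lorentzian_def using vars hom nn conv hess by blast
qed

section \<open>Independence polynomials with one colour\<close>

lemma map_key_mono2: "Poly_Mapping.map_key Some (mono2 b i j) = Poly_Mapping.single b i"
  by (rule poly_mapping_eqI) (auto simp: map_key.rep_eq lookup_mono2 lookup_single when_def)

lemma lookup_sum_single:
  "finite A \<Longrightarrow> Poly_Mapping.lookup (\<Sum>S\<in>A. Poly_Mapping.single (h S) (1::real)) m = real (card {S\<in>A. h S = m})"
proof -
  assume A: "finite A"
  have "Poly_Mapping.lookup (\<Sum>S\<in>A. Poly_Mapping.single (h S) (1::real)) m = (\<Sum>S\<in>A. if h S = m then 1 else 0)"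
    unfolding lookup_sum by (intro sum.cong) (auto simp: lookup_single when_def)
  also have "\<dots> = real (card {S\<in>A. h S = m})"
    using A by (simp add: sum.inter_filter[symmetric])
  finally show ?thesis .
qed

text \<open>The degree \<open>\<alpha>\<close> is minimal, because the monomial of a largest set has degree \<open>\<alpha>\<close> already.\<close>

lemma homogenisation_unicoloured:
  fixes b :: 'c
  assumes fin: "finite \<S>" and max: "\<And>S. S \<in> \<S> \<Longrightarrow> card S \<le> \<alpha>" and att: "\<exists>S\<in>\<S>. card S = \<alpha>"
  shows "homogenisation (\<Sum>S\<in>\<S>. Var b ^ card S) = (\<Sum>S\<in>\<S>. Poly_Mapping.single (mono2 b (card S) (\<alpha> - card S)) 1)"
proof -
  define P :: "'c rpoly" where "P = (\<Sum>S\<in>\<S>. Var b ^ card S)"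
  define H :: "'c option rpoly" where "H = (\<Sum>S\<in>\<S>. Poly_Mapping.single (mono2 b (card S) (\<alpha> - card S)) 1)"
  have P: "P = (\<Sum>S\<in>\<S>. Poly_Mapping.single (Poly_Mapping.single b (card S)) 1)" by (simp add: P_def Var_power)
  have lH: "Poly_Mapping.lookup H m = real (card {S\<in>\<S>. mono2 b (card S) (\<alpha> - card S) = m})" for m
    unfolding H_def by (rule lookup_sum_single[OF fin])
  have lP: "Poly_Mapping.lookup P m = real (card {S\<in>\<S>. Poly_Mapping.single b (card S) = m})" for m
    unfolding P by (rule lookup_sum_single[OF fin])
  have kH: "\<exists>S\<in>\<S>. m = mono2 b (card S) (\<alpha> - card S)" if "m \<in> Poly_Mapping.keys H" for m
    using that unfolding in_keys_iff lH by (auto simp: card_eq_0_iff)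
  have hom: "homogeneous \<alpha> H"
    unfolding homogeneous_def using kH max by (fastforce simp: total_degree_mono2)
  have deh: "dehomogenise H = P"
  proof -
    have add: "dehomogenise (f + g) = dehomogenise f + dehomogenise g" for f g :: "'c option rpoly"
    proof -
      have "dehomogenise h = (\<Sum>m\<in>K. Poly_Mapping.single (Poly_Mapping.map_key Some m) (Poly_Mapping.lookup h m))"
        if "finite K" "Poly_Mapping.keys h \<subseteq> K" for h :: "'c option rpoly" and K
        unfolding dehomogenise_altdef using that by (intro sum.mono_neutral_left) (auto simp: in_keys_iff)
      from this[of "Poly_Mapping.keys f \<union> Poly_Mapping.keys g"] show ?thesis
        using Poly_Mapping.keys_add[of f g] by (simp add: lookup_add single_add sum.distrib)
    qed
    have single: "dehomogenise (Poly_Mapping.single m 1) = Poly_Mapping.single (Poly_Mapping.map_key Some m) 1" for m :: "'c option \<Rightarrow>\<^sub>0 nat"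
      by (simp add: dehomogenise_altdef)
    have zero: "dehomogenise (0 :: 'c option rpoly) = 0" by (simp add: dehomogenise_altdef)
    have "dehomogenise (\<Sum>S\<in>\<T>. Poly_Mapping.single (mono2 b (card S) (\<alpha> - card S)) 1) = (\<Sum>S\<in>\<T>. Poly_Mapping.single (Poly_Mapping.single b (card S)) 1)" for \<T> :: "'a set set"
      by (induction \<T> rule: infinite_finite_induct) (simp_all add: add single zero map_key_mono2)
    then show ?thesis unfolding H_def P .
  qed
  have least: "\<alpha> \<le> d'" if h': "homogeneous d' h'" "dehomogenise h' = P" for d' h'
  proof -
    obtain S where S: "S \<in> \<S>" "card S = \<alpha>" using att by blast
    have "Poly_Mapping.lookup P (Poly_Mapping.single b \<alpha>) \<noteq> 0"
      unfolding lP using S fin by (auto simp: card_eq_0_iff)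
    then have "Poly_Mapping.lookup (dehomogenise h') (Poly_Mapping.single b \<alpha>) \<noteq> 0" using h'(2) by simp
    then obtain m where m: "m \<in> Poly_Mapping.keys h'" "Poly_Mapping.map_key Some m = Poly_Mapping.single b \<alpha>"
      unfolding dehomogenise_altdef lookup_sum by (metis (mono_tags, lifting) lookup_single_not_eq sum.neutral)
    have "total_degree (Poly_Mapping.single b \<alpha>) = \<alpha>" by (simp add: total_degree_def)
    then have "total_degree m = Poly_Mapping.lookup m None + \<alpha>" using total_degree_option[of m] m(2) by simp
    then show ?thesis using h'(1) m(1) by (auto simp: homogeneous_def)
  qed
  have "is_homogenisation P H"
    unfolding is_homogenisation_def using hom deh least by blast
  then have "homogenisation P = H"
    using ex1_homogenisation is_homogenisation_homogenisation by blast
  then show ?thesis by (simp add: P_def H_def)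
qed

lemma binomial_ratio:
  fixes c0 c1 c2 :: real
  assumes i: "1 \<le> i" "i < d"
  shows "(fact (i - 1) * fact (d - i + 1) * c0) * (fact (i + 1) * fact (d - i - 1) * c2) \<le> (fact i * fact (d - i) * c1)\<^sup>2
     \<longleftrightarrow> c0 * c2 * (real (i + 1) * real (d - i + 1)) \<le> c1\<^sup>2 * (real i * real (d - i))"
proof -
  obtain i' where i': "i = Suc i'" using i by (cases i) auto
  obtain j where j: "d - i = Suc j" using i by (cases "d - i") auto
  define F :: real where "F = (fact i' * fact j)\<^sup>2 * real i * real (d - i)"
  have F: "F > 0" using i by (simp add: F_def)
  have e1: "(fact (i - 1) * fact (d - i + 1) * c0) * (fact (i + 1) * fact (d - i - 1) * c2) = F * (c0 * c2 * (real (i + 1) * real (d - i + 1)))"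
    unfolding F_def j by (simp add: i' power2_eq_square algebra_simps)
  have e2: "(fact i * fact (d - i) * c1)\<^sup>2 = F * (c1\<^sup>2 * (real i * real (d - i)))"
    unfolding F_def j by (simp add: i' power2_eq_square algebra_simps)
  show ?thesis unfolding e1 e2 by (rule mult_le_cancel_left_pos[OF F])
qed

text \<open>The quotient \<open>(u + 1) / u\<close> decreases in \<open>u\<close>: larger exponents of \<open>x\<close> and \<open>y\<close> relax the condition.\<close>

lemma ratio_mono:
  fixes c0 c1 c2 :: real
  assumes le: "c0 * c2 * (real (u + 1) * real (w + 1)) \<le> c1\<^sup>2 * (real u * real w)"
    and c: "c0 * c2 \<ge> 0" and uw: "1 \<le> u" "1 \<le> w" "u \<le> u'" "w \<le> w'"
  shows "c0 * c2 * (real (u' + 1) * real (w' + 1)) \<le> c1\<^sup>2 * (real u' * real w')"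
proof -
  have 1: "real (u' + 1) * real u \<le> real (u + 1) * real u'" "real (w' + 1) * real w \<le> real (w + 1) * real w'"
    using uw by (simp_all add: algebra_simps)
  have "(real u * real w) * (c0 * c2 * (real (u' + 1) * real (w' + 1))) = c0 * c2 * ((real (u' + 1) * real u) * (real (w' + 1) * real w))"
    by (simp add: mult_ac)
  also have "\<dots> \<le> c0 * c2 * ((real (u + 1) * real u') * (real (w + 1) * real w'))"
    by (intro mult_left_mono mult_mono 1 c) auto
  also have "\<dots> = (c0 * c2 * (real (u + 1) * real (w + 1))) * (real u' * real w')" by (simp add: mult_ac)
  also have "\<dots> \<le> (c1\<^sup>2 * (real u * real w)) * (real u' * real w')"
    by (intro mult_right_mono le) auto
  also have "\<dots> = (real u * real w) * (c1\<^sup>2 * (real u' * real w'))" by (simp add: mult_ac)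
  finally show ?thesis using uw by simp
qed

text \<open>The inequality for \<open>\<phi>\<close> is the condition of \<open>lorentzian_bivariate\<close> for the multiple by \<open>x\<^sup>K\<close> of degree \<open>N\<close>.
  With \<open>k = K + N\<close> the exponents in \<open>(x y)\<^sup>k\<close> times the homogenisation are at least as large as there.\<close>

lemma lorentzian_homogenised_if_log_concave:
  fixes b :: 'c and \<S> :: "'a set set"
  assumes fin: "finite \<S>" and empty: "{} \<in> \<S>"
    and down: "\<And>S T. S \<in> \<S> \<Longrightarrow> T \<subseteq> S \<Longrightarrow> T \<in> \<S>"
    and eq: "\<And>x::real. x ^ K * (\<Sum>S\<in>\<S>. x ^ card S) = (\<Sum>i\<le>N. \<phi> i / (fact i * fact (N - i)) * x ^ i)"
    and lc: "\<And>i. 1 \<le> i \<Longrightarrow> i < N \<Longrightarrow> \<phi> (i - 1) * \<phi> (i + 1) \<le> (\<phi> i)\<^sup>2"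
  shows "\<exists>k. lorentzian {None, Some b} ((Var (Some b) * Var None) ^ k * homogenisation (\<Sum>S\<in>\<S>. Var b ^ card S))"
proof -
  define \<alpha> where "\<alpha> = Max (card ` \<S>)"
  have max: "card S \<le> \<alpha>" if "S \<in> \<S>" for S unfolding \<alpha>_def using fin that by simp
  have "\<alpha> \<in> card ` \<S>" unfolding \<alpha>_def using fin empty by (intro Max_in) auto
  then have att: "\<exists>S\<in>\<S>. card S = \<alpha>" by auto
  define c where "c j = real (card {S\<in>\<S>. card S = j})" for j
  have cpos: "c j > 0" if j: "j \<le> \<alpha>" for j
  proof -
    obtain S where S: "S \<in> \<S>" "card S = \<alpha>" using att by blast
    obtain T where "T \<subseteq> S" "card T = j" using obtain_subset_with_card_n[of j S] S j by metis
    then have "T \<in> {S\<in>\<S>. card S = j}" using down S by blast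
    then show ?thesis unfolding c_def using fin by (auto simp: card_gt_0_iff)
  qed
  have sumc: "(\<Sum>S\<in>\<S>. x ^ card S) = (\<Sum>j\<le>\<alpha>. c j * x ^ j)" for x :: real
  proof -
    have "(\<Sum>S\<in>\<S>. x ^ card S) = (\<Sum>j\<le>\<alpha>. \<Sum>S\<in>{S\<in>\<S>. card S = j}. x ^ card S)"
      using sum.group[OF fin, of "{..\<alpha>}" card "\<lambda>S. x ^ card S"] max by (simp add: image_subset_iff)
    also have "\<dots> = (\<Sum>j\<le>\<alpha>. c j * x ^ j)" by (intro sum.cong refl) (simp add: c_def)
    finally show ?thesis .
  qed
  define p1 where "p1 = (\<Sum>j\<le>\<alpha>. monom (c j) (j + K))"
  define p2 where "p2 = (\<Sum>i\<le>N. monom (\<phi> i / (fact i * fact (N - i))) i)"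
  have "poly p1 x = poly p2 x" for x
    using eq[of x] unfolding sumc p1_def p2_def
    by (simp add: poly_sum poly_monom sum_distrib_left power_add mult_ac)
  then have p12: "p1 = p2" using poly_eq_poly_eq_iff by blast
  have coef: "c j = (if j + K \<le> N then \<phi> (j + K) / (fact (j + K) * fact (N - (j + K))) else 0)" if "j \<le> \<alpha>" for j
  proof -
    have "coeff p1 (j + K) = c j" unfolding p1_def using that by (simp add: coeff_sum)
    moreover have "coeff p2 (j + K) = (if j + K \<le> N then \<phi> (j + K) / (fact (j + K) * fact (N - (j + K))) else 0)"
      unfolding p2_def by (simp add: coeff_sum)
    ultimately show ?thesis using p12 by simp
  qed
  have aN: "\<alpha> + K \<le> N" using coef[of \<alpha>] cpos[of \<alpha>] by (auto split: if_splits)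
  have strict: "c (j - 1) * c (j + 1) * (real (j + K + 1) * real (N - (j + K) + 1)) \<le> (c j)\<^sup>2 * (real (j + K) * real (N - (j + K)))"
    if j: "1 \<le> j" "j < \<alpha>" for j
  proof -
    have i: "1 \<le> j + K" "j + K < N" using j aN by auto
    have \<phi>: "\<phi> (l + K) = fact (l + K) * fact (N - (l + K)) * c l" if "l \<le> \<alpha>" for l
      using coef[OF that] aN that by simp
    have idx: "j + K - 1 = j - 1 + K" "j + K + 1 = j + 1 + K" "N - (j - 1 + K) = N - (j + K) + 1" "N - (j + 1 + K) = N - (j + K) - 1"
      using j i by auto
    have "(fact (j + K - 1) * fact (N - (j + K) + 1) * c (j - 1)) * (fact (j + K + 1) * fact (N - (j + K) - 1) * c (j + 1))
        \<le> (fact (j + K) * fact (N - (j + K)) * c j)\<^sup>2"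
      using lc[OF i] \<phi>[of "j - 1"] \<phi>[of j] \<phi>[of "j + 1"] j unfolding idx by simp
    then show ?thesis by (simp only: binomial_ratio[OF i])
  qed
  define k where "k = K + N"
  define d where "d = \<alpha> + 2 * k"
  define Q :: "'c option rpoly" where "Q = (\<Sum>S\<in>\<S>. Poly_Mapping.single (mono2 b (card S + k) (d - (card S + k))) 1)"
  have Q: "(Var (Some b) * Var None) ^ k * homogenisation (\<Sum>S\<in>\<S>. Var b ^ card S) = Q"
  proof -
    have hom: "homogenisation (\<Sum>S\<in>\<S>. Var b ^ card S) = (\<Sum>S\<in>\<S>. Poly_Mapping.single (mono2 b (card S) (\<alpha> - card S)) 1)"
      by (rule homogenisation_unicoloured[OF fin max att])
    show ?thesis unfolding hom Q_def sum_distrib_left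
    proof (rule sum.cong[OF refl])
      fix S assume "S \<in> \<S>"
      then have m: "card S \<le> \<alpha>" by (rule max)
      have "d - (card S + k) = k + (\<alpha> - card S)" using m by (simp add: d_def)
      then have "mono2 b k k + mono2 b (card S) (\<alpha> - card S) = mono2 b (card S + k) (d - (card S + k))"
        by (simp add: mono2_add add.commute)
      then show "(Var (Some b) * Var None) ^ k * Poly_Mapping.single (mono2 b (card S) (\<alpha> - card S)) 1 =
          (Poly_Mapping.single (mono2 b (card S + k) (d - (card S + k))) 1 :: 'c option rpoly)"
        by (simp add: power_mult_distrib Var_power mult_single mono2_def[of b k k, symmetric])
    qed
  qed
  have lQ: "Poly_Mapping.lookup Q m = real (card {S\<in>\<S>. mono2 b (card S + k) (d - (card S + k)) = m})" for m
    unfolding Q_def by (rule lookup_sum_single[OF fin])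
  have "lorentzian {None, Some b} Q"
  proof (rule lorentzian_bivariate[where l = k and u = "\<alpha> + k" and d = d and a = "\<lambda>i. c (i - k)"])
    fix m assume "Poly_Mapping.lookup Q m \<noteq> 0"
    then obtain S where S: "S \<in> \<S>" "mono2 b (card S + k) (d - (card S + k)) = m" unfolding lQ by (auto simp: card_eq_0_iff)
    then show "\<exists>i\<in>{k..\<alpha> + k}. m = mono2 b i (d - i)" using max[OF S(1)] by (intro bexI[of _ "card S + k"]) auto
  next
    fix i assume i: "i \<in> {k..\<alpha> + k}"
    have "{S\<in>\<S>. mono2 b (card S + k) (d - (card S + k)) = mono2 b i (d - i)} = {S\<in>\<S>. card S = i - k}"
      using i by auto
    then show "Poly_Mapping.lookup Q (mono2 b i (d - i)) = c (i - k)" unfolding lQ c_def by simp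
    show "c (i - k) > 0" using i by (intro cpos) auto
  next
    show "\<alpha> + k \<le> d" by (simp add: d_def)
  next
    fix i assume i: "k < i" "i < \<alpha> + k"
    define j where "j = i - k"
    have j: "1 \<le> j" "j < \<alpha>" "i = j + k" using i by (auto simp: j_def)
    have i1: "1 \<le> i" "i < d" using i by (auto simp: d_def)
    have "c (j - 1) * c (j + 1) * (real (i + 1) * real (d - i + 1)) \<le> (c j)\<^sup>2 * (real i * real (d - i))"
    proof (rule ratio_mono[OF strict[OF j(1,2)]])
      show "0 \<le> c (j - 1) * c (j + 1)" by (simp add: c_def)
    qed (use j aN in \<open>auto simp: k_def d_def\<close>)
    moreover have "i - 1 - k = j - 1" "i + 1 - k = j + 1" "i - k = j" using j by auto
    ultimately show "(fact (i - 1) * fact (d - i + 1) * c (i - 1 - k)) * (fact (i + 1) * fact (d - i - 1) * c (i + 1 - k))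
        \<le> (fact i * fact (d - i) * c (i - k))\<^sup>2"
      by (simp only: binomial_ratio[OF i1])
  qed
  then show ?thesis using Q by metis
qed

theorem mainTheorem2:
  fixes G :: "'a pair_pre_digraph" and D :: "('a \<times> 'a) set" and bound :: 'c
  assumes "pair_graph G" and "orientation D G"
  shows "pre_lorentzian (R_W4 D G) (\<lambda>_. bound) bound"
proof -
  interpret R: W4_replacement G D by (rule W4_replacement.intro) (fact assms)+
  interpret E: simple_edges "pverts G" D
    by (rule simple_edges.intro) (use R.pair_finite_verts R.finite_A R.A_ends in auto)
  interpret R': pair_graph "R_W4 D G" by (rule pair_graph_R_W4[OF assms])
  define \<S> where "\<S> = independent_sets (R_W4 D G)"
  have fin: "finite \<S>"
    unfolding \<S>_def by (rule finite_subset[of _ "Pow (pverts (R_W4 D G))"]) (auto simp: independent_sets_def R'.pair_finite_verts)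
  have sum: "(\<Sum>S\<in>\<S>. x ^ card S) = E.glued_sum x" for x
    unfolding \<S>_def R.independence_sum E.glued_sum_def
  proof (intro sum.cong refl arg_cong2[where f = "(*)"] prod.cong)
    fix U a assume "U \<in> Pow (pverts G)" and a: "a \<in> D"
    have ne: "fst a \<noteq> snd a" using R.A_ends[OF a] by simp
    have "{fst a, snd a} - U = (if fst a \<in> U then {} else {fst a}) \<union> (if snd a \<in> U then {} else {snd a})" by auto
    then have "E.out U a = (if fst a \<in> U \<and> snd a \<in> U then 0 else if fst a \<in> U \<or> snd a \<in> U then 1 else 2)"
      using ne by (simp add: E.out_def)
    then show "(\<Sum>T\<in>{T. T \<subseteq> W4_inner \<and> W4_free (fst a \<in> U) (snd a \<in> U) T}. x ^ card T) =
        (1 + x)\<^sup>2 * ((1 + x) ^ E.out U a + real (E.out U a) * x * (1 + x) ^ (E.out U a - 1))"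
      unfolding W4_sum by (auto simp: algebra_simps)
  qed
  have indep_poly: "coloured_indep_poly (R_W4 D G) (\<lambda>_. bound) = (\<Sum>S\<in>\<S>. Var bound ^ card S)"
    by (simp add: coloured_indep_poly_def \<S>_def)
  obtain N K \<phi> where \<phi>: "\<And>x. x ^ K * E.glued_sum x = (\<Sum>i\<le>N. \<phi> i / (fact i * fact (N - i)) * x ^ i)"
    "\<And>i. 1 \<le> i \<Longrightarrow> i < N \<Longrightarrow> \<phi> (i - 1) * \<phi> (i + 1) \<le> (\<phi> i)\<^sup>2"
    using E.glued_sum_log_concave by blast
  have "\<exists>k. lorentzian {None, Some bound} ((Var (Some bound) * Var None) ^ k * homogenisation (\<Sum>S\<in>\<S>. Var bound ^ card S))"
  proof (rule lorentzian_homogenised_if_log_concave[OF fin _ _ _ \<phi>(2)])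
    show "{} \<in> \<S>" by (simp add: \<S>_def independent_sets_def)
    show "T \<in> \<S>" if "S \<in> \<S>" "T \<subseteq> S" for S T using that by (auto simp: \<S>_def independent_sets_def)
    show "x ^ K * (\<Sum>S\<in>\<S>. x ^ card S) = (\<Sum>i\<le>N. \<phi> i / (fact i * fact (N - i)) * x ^ i)" for x
      by (simp only: sum \<phi>(1))
  qed
  moreover have "insert None (Some ` insert bound ((\<lambda>_. bound) ` pverts (R_W4 D G))) = {None, Some bound}" by auto
  moreover have "partitioned_graph (R_W4 D G) (\<lambda>_. bound) bound"
    using pair_graph_R_W4[OF assms] by (simp add: partitioned_graph_def)
  ultimately show ?thesis unfolding pre_lorentzian_def indep_poly by simp
qed

end
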